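(* Let $d>4$ and let $c_0>0$ be the fixed constant described in the context. There are constants $c_1,c_2,c_3,c_4,c_5>0$, depending on $d$ but not on $\beta$ or $r$, such that $$\tau_\beta^{\mathbb T_r}(0,x)\le \tau_\beta(0,x)+c_1\frac{\chi(\beta)}{r^d}$$ for all integers $r\ge 3$, all $\beta\in(0,\beta_c)$ and all $x\in\mathbb T_r$, and $$\tau_\beta^{\mathbb T_r}(0,x)\ge \tau_\beta(0,x)+c_2\frac{\chi(\beta)}{r^d}$$ for all integers $r\ge 3$, all $\beta\in[\beta_c-c_3r^{-2},\,\beta_c-c_4r^{-d/2}]$ (with $\beta>0$) and all $x\in\mathbb T_r$ with $\|x\|_\infty\ge c_5$. Moreover, the constant $c_3$ is given by $c_3=\frac49c_0^2$.
   Context: Ising model. For a finite graph $\mathcal G=(V,E)$ and inverse temperature $\beta>0$, the Ising expectation of a function $F$ of $\sigma\in\{-1,+1\}^V$ is $\langle F\rangle^{\mathcal G}_\beta=\frac{1}{Z}\sum_\sigma F(\sigma)\exp\big(\beta\sum_{xy\in E}\sigma_x\sigma_y\big)$ with $Z=\sum_\sigma \exp\big(\beta\sum_{xy\in E}\sigma_x\sigma_y\big)$. For $d\ge1$ and an integer $r\ge3$, $\Lambda_r=[-r/2,r/2)^d\cap\mathbb Z^d$ is the graph with nearest-neighbour edges (free boundary conditions), and $\mathbb T_r=(\mathbb Z/r\mathbb Z)^d$ is the discrete torus with nearest-neighbour edges. A point of $\mathbb T_r$ is identified with its representative in $\Lambda_r\subset\mathbb Z^d$; in particular $\|x\|_\infty$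 and $\tau_\beta(0,x)$ for $x\in\mathbb T_r$ are evaluated at that representative. Two-point functions: $\tau_\beta^{\Lambda_r}(x,y)=\langle\sigma_x\sigma_y\rangle_\beta^{\Lambda_r}$, $\tau_\beta^{\mathbb T_r}(x,y)=\langle\sigma_x\sigma_y\rangle_\beta^{\mathbb T_r}$, and the infinite-volume two-point function is $\tau_\beta(x,y)=\lim_{r\to\infty}\tau_\beta^{\Lambda_r}(x,y)$ for $x,y\in\mathbb Z^d$ (the limit is increasing in $r$). The infinite-volume susceptibility is $\chi(\beta)=\sum_{x\in\mathbb Z^d}\tau_\beta(0,x)\in[0,\infty]$. The critical value is $\beta_c=\sup\{\beta>0:\chi(\beta)<\infty\}$. Known inputs for $d>4$: $\chi(\beta)$ is bounded above and below by positive multiples of $(\beta_c-\beta)^{-1}$ for $\beta<\beta_c$ (Aizenman); and (Duminil-Copin–Panis) there are positive constants $c_0,C_0$, which we fix, such that for all $\beta\le\beta_c$: $\tau_\beta(0,x)\le \frac{C_0}{\max(1,\|x\|_\infty)^{d-2}}e^{-c_0(\beta_c-\beta)^{1/2}\|x\|_\infty}$ for all $x\in\mathbb Z^d$, and $\tau_\beta(0,x)\ge\frac{c_0}{\max(1,\|x\|_\infty)^{d-2}}$ for all $x\in\mathbb Z^d$ with $\|x\|_\infty\le c_0(\beta_c-\beta)^{-1/2}$. *)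

theory Defs
  imports "HOL-Analysis.Analysis" "HOL-Number_Theory.Cong"
begin

(* Edges are two-element sets {x, y}, so the product over an edge e is \<sigma>_x \<sigma>_y.
   Configurations are extensional functions, hence there are exactly 2 ^ card V of them. *)
definition ising_weight :: "'a set set \<Rightarrow> real \<Rightarrow> ('a \<Rightarrow> real) \<Rightarrow> real" where
  "ising_weight E \<beta> \<sigma> = exp (\<beta> * (\<Sum>e\<in>E. \<Prod>x\<in>e. \<sigma> x))"

definition ising_expectation ::
    "'a set \<Rightarrow> 'a set set \<Rightarrow> real \<Rightarrow> (('a \<Rightarrow> real) \<Rightarrow> real) \<Rightarrow> real" where
  "ising_expectation V E \<beta> F =
     (\<Sum>\<sigma>\<in>V \<rightarrow>\<^sub>E {-1, 1}. F \<sigma> * ising_weight E \<beta> \<sigma>) /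
     (\<Sum>\<sigma>\<in>V \<rightarrow>\<^sub>E {-1, 1}. ising_weight E \<beta> \<sigma>)"

definition box_vertices :: "nat \<Rightarrow> (int ^ 'd) set" where
  "box_vertices r = {x. \<forall>i. - (real r / 2) \<le> real_of_int (x $ i) \<and> real_of_int (x $ i) < real r / 2}"

definition box_edges :: "nat \<Rightarrow> (int ^ 'd) set set" where
  "box_edges r =
     {{x, y} |x y. x \<in> box_vertices r \<and> y \<in> box_vertices r \<and> (\<exists>i. y = x + axis i 1)}"

(* The vertices of the torus (Z/rZ)^d are its representatives in the box, and adjacency is
   taken modulo r.  For r \<ge> 3 this graph has no loops and no multiple edges. *)
definition torus_edges :: "nat \<Rightarrow> (int ^ 'd) set set" where
  "torus_edges r =
     {{x, y} |x y. x \<in> box_vertices r \<and> y \<in> box_vertices r \<and>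
        (\<exists>i. \<forall>j. [y $ j = (x + axis i 1) $ j] (mod int r))}"

definition tau_box :: "nat \<Rightarrow> real \<Rightarrow> int ^ 'd \<Rightarrow> int ^ 'd \<Rightarrow> real" where
  "tau_box r \<beta> x y = ising_expectation (box_vertices r) (box_edges r) \<beta> (\<lambda>\<sigma>. \<sigma> x * \<sigma> y)"

definition tau_torus :: "nat \<Rightarrow> real \<Rightarrow> int ^ 'd \<Rightarrow> int ^ 'd \<Rightarrow> real" where
  "tau_torus r \<beta> x y = ising_expectation (box_vertices r) (torus_edges r) \<beta> (\<lambda>\<sigma>. \<sigma> x * \<sigma> y)"

(* The finitely many r for which x or y lies outside the box do not affect the limit. *)
definition tau :: "real \<Rightarrow> int ^ 'd \<Rightarrow> int ^ 'd \<Rightarrow> real" where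
  "tau \<beta> x y = lim (\<lambda>r. tau_box r \<beta> x y)"

(* The susceptibility and the critical value depend on the dimension d = CARD('d), which is
   passed through a type argument. *)
definition chi :: "'d::finite itself \<Rightarrow> real \<Rightarrow> ereal" where
  "chi _ \<beta> = (\<Sum>\<^sub>\<infinity>x::int ^ 'd. ereal (tau \<beta> 0 x))"

(* A supremum of reals: it is meaningful when the set is nonempty and bounded above, which is
   the case for every d \<ge> 2. *)
definition beta_c :: "'d::finite itself \<Rightarrow> real" where
  "beta_c T = Sup {\<beta>. \<beta> > 0 \<and> chi T \<beta> < \<infinity>}"

definition sup_norm :: "int ^ 'd \<Rightarrow> real" where
  "sup_norm x = real_of_int (Max (range (\<lambda>i. \<bar>x $ i\<bar>)))"

end

(* The product of two independent copies of a pair-coupled Ising model is again a spin system, and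
   splitting according to the set A of vertices where the two configurations agree turns both a
   graph G and a double cover H of G into a mixture of models on A and on its complement, with
   coupling constants that differ only on the complement.  The four functions theorem applied to
   this mixture shows that the two-point function of G is at most that of H summed over a fibre,
   and it also yields the Lebowitz and GHS inequalities.  Expanding the two-point function on A in
   clusters C and removing C from the mixture bounds the defect by the two-point function between
   the two points of a fibre times a convolution of two-point functions.

   The torus with one period doubled is a double cover of the torus.  Doubling all periods
   indefinitely unrolls it to Z^d, so that the two-point function of the torus lies between the
   periodisation of tau and this periodisation minus 2 B(x) times the sum of tau over the nonzero
   period lattice, where B is the convolution square of the periodisation on the torus.  In the
   passage to the limit the boundary is handled by wiring it to a single vertex.  The assumed
   bounds on tau make chi of order 1/(beta_c - beta), and the sum of tau over the period lattice
   without 0 is of order 1/((beta_c - beta) r^d), which is chi/r^d; the lower window makes B(x)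
   small once x is far from 0. *)
theory Submission
  imports Defs
begin

text \<open>Periods are doubled one at a time, because a graph is compared only with its double
  covers. One doubling costs at most the correlation across the half period \<open>\<gamma>\<close>
  times a convolution. By the upper bound, available on every enlarged torus, this correlation is at
  most the sum of \<open>tau\<close> over the period vectors lost in the step, and the convolutions,
  summed over the copies, always give the same \<open>B x\<close>; so the losses telescope. The
  obstacle is that the cluster argument is circular: the mean cluster size is bounded by a term that
  contains it with a factor, which has to be at most 1/2. As \<open>B 0\<close> is at least 1,
  diagonal terms must be split off, which is possible because the two points of a fibre are
  distinct. What is left is of order 1/(eps^2 r^d), with eps the distance to criticality: the
  plateau 1/(eps r^d) times chi, and its square times r^d. This is the origin of the window c4
  r^(-d/2). The window c3 r^(-2) lets the lower bound on \<open>tau\<close> reach x shifted by a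
  nonzero period: r/2 + r must be at most c0/sqrt eps, hence 4/9. Finally, d > 4 makes |x|^(2-d)
  square summable, and this makes B small far from 0.\<close>

section \<open>Spin systems with pair couplings\<close>

(* A configuration is represented by the set of its plus spins. *)
definition spin :: "'a set \<Rightarrow> 'a \<Rightarrow> real" where
  "spin \<sigma> x = (if x \<in> \<sigma> then 1 else - 1)"

definition chr :: "'a set \<Rightarrow> 'a set \<Rightarrow> real" where
  "chr S \<sigma> = (\<Prod>x\<in>S. spin \<sigma> x)"

(* The sum runs over ordered pairs, so an unordered pair is counted twice; the diagonal only
   contributes a constant. *)
definition energy :: "'a set \<Rightarrow> ('a \<Rightarrow> 'a \<Rightarrow> real) \<Rightarrow> 'a set \<Rightarrow> real" where
  "energy V k \<sigma> = (\<Sum>a\<in>V. \<Sum>b\<in>V. k a b * (spin \<sigma> a * spin \<sigma> b))"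

text \<open>Dividing by the number of configurations makes averages over disjoint vertex sets
  multiply, so free vertices leave no trace and models on different vertex sets can be compared
  without factors of 2.\<close>

definition avg :: "'a set \<Rightarrow> ('a set \<Rightarrow> real) \<Rightarrow> real" where
  "avg V f = (\<Sum>\<sigma>\<in>Pow V. f \<sigma>) / 2 ^ card V"

definition wavg :: "'a set \<Rightarrow> ('a \<Rightarrow> 'a \<Rightarrow> real) \<Rightarrow> ('a set \<Rightarrow> real) \<Rightarrow> real" where
  "wavg V k f = avg V (\<lambda>\<sigma>. f \<sigma> * exp (energy V k \<sigma>))"

definition zsum :: "'a set \<Rightarrow> ('a \<Rightarrow> 'a \<Rightarrow> real) \<Rightarrow> real" where
  "zsum V k = wavg V k (\<lambda>_. 1)"

definition two :: "'a set \<Rightarrow> ('a \<Rightarrow> 'a \<Rightarrow> real) \<Rightarrow> 'a \<Rightarrow> 'a \<Rightarrow> real" where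
  "two V k a b = wavg V k (\<lambda>\<sigma>. spin \<sigma> a * spin \<sigma> b)"

definition corr :: "'a set \<Rightarrow> ('a \<Rightarrow> 'a \<Rightarrow> real) \<Rightarrow> 'a \<Rightarrow> 'a \<Rightarrow> real" where
  "corr V k a b = two V k a b / zsum V k"

section \<open>Signs, characters and uniform averages\<close>

lemma spin_sq [simp]: "spin \<sigma> x * spin \<sigma> x = 1"
  by (simp add: spin_def)

lemma abs_spin [simp]: "\<bar>spin \<sigma> x\<bar> = 1"
  by (simp add: spin_def)

lemma spin_Int: "x \<in> A \<Longrightarrow> spin (\<sigma> \<inter> A) x = spin \<sigma> x"
  by (simp add: spin_def)

lemma spin_sym_diff: "spin (sym_diff \<sigma> D) x = spin \<sigma> x * (if x \<in> D then - 1 else 1)"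
  by (auto simp: spin_def)

lemma chr_empty [simp]: "chr {} \<sigma> = 1"
  by (simp add: chr_def)

lemma chr_cases: "chr S \<sigma> = 1 \<or> chr S \<sigma> = - 1"
proof (cases "finite S")
  case True
  then show ?thesis
    by (induction S) (auto simp: chr_def spin_def)
qed (simp add: chr_def)

lemma abs_chr [simp]: "\<bar>chr S \<sigma>\<bar> = 1"
  using chr_cases[of S \<sigma>] by auto

text \<open>\<open>spin (- D)\<close> is -1 exactly on \<open>D\<close>, so
  \<open>chr S (- D)\<close> is the sign that \<open>chr S\<close> picks up when the spins in
  \<open>D\<close> are flipped.\<close>

lemma chr_sym_diff: "chr S (sym_diff \<sigma> D) = chr S \<sigma> * chr S (- D)"
  unfolding chr_def prod.distrib[symmetric]
  by (rule prod.cong) (auto simp: spin_def)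

lemma chr_mult:
  assumes "finite S" "finite T"
  shows "chr S \<sigma> * chr T \<sigma> = chr (sym_diff S T) \<sigma>"
proof -
  have S: "chr S \<sigma> = chr (S - T) \<sigma> * chr (S \<inter> T) \<sigma>"
    unfolding chr_def by (metis Int_Diff_disjoint Int_Diff_Un assms(1) finite_Diff finite_Int inf_commute mult.commute prod.union_disjoint)
  have T: "chr T \<sigma> = chr (T - S) \<sigma> * chr (S \<inter> T) \<sigma>"
    unfolding chr_def by (metis Int_Diff_disjoint Int_Diff_Un assms(2) finite_Diff finite_Int inf_commute mult.commute prod.union_disjoint)
  have "chr (S \<inter> T) \<sigma> * chr (S \<inter> T) \<sigma> = 1"
    using chr_cases[of "S \<inter> T" \<sigma>] by auto
  then have "chr S \<sigma> * chr T \<sigma> = chr (S - T) \<sigma> * chr (T - S) \<sigma>"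
    unfolding S T by (metis (no_types, lifting) mult.assoc mult.commute mult.right_neutral)
  also have "\<dots> = chr (sym_diff S T) \<sigma>"
    unfolding chr_def using assms by (subst prod.union_disjoint) auto
  finally show ?thesis .
qed

lemma spin_mult_chr: "spin \<sigma> a * spin \<sigma> b = chr (if a = b then {} else {a, b}) \<sigma>"
  by (simp add: chr_def)

lemma sum_Pow_insert:
  assumes "finite V" "x \<notin> V"
  shows "(\<Sum>\<sigma>\<in>Pow (insert x V). f \<sigma>) = (\<Sum>\<sigma>\<in>Pow V. f \<sigma> + f (insert x \<sigma>))"
proof -
  have inj: "inj_on (insert x) (Pow V)"
    using assms by (auto simp: inj_on_def)
  have "Pow V \<inter> insert x ` Pow V = {}"
    using assms by auto
  then show ?thesis
    using assms by (simp add: Pow_insert sum.union_disjoint sum.reindex[OF inj] sum.distrib)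
qed

lemma avg_cong: "(\<And>\<sigma>. \<sigma> \<subseteq> V \<Longrightarrow> f \<sigma> = g \<sigma>) \<Longrightarrow> avg V f = avg V g"
  by (simp add: avg_def)

lemma avg_add: "avg V (\<lambda>\<sigma>. f \<sigma> + g \<sigma>) = avg V f + avg V g"
  by (simp add: avg_def sum.distrib add_divide_distrib)

lemma avg_diff: "avg V (\<lambda>\<sigma>. f \<sigma> - g \<sigma>) = avg V f - avg V g"
  by (simp add: avg_def sum_subtractf diff_divide_distrib)

lemma avg_cmult: "avg V (\<lambda>\<sigma>. c * f \<sigma>) = c * avg V f"
  by (simp add: avg_def sum_distrib_left)

lemma avg_sum: "avg V (\<lambda>\<sigma>. \<Sum>i\<in>I. f i \<sigma>) = (\<Sum>i\<in>I. avg V (f i))"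
  unfolding avg_def sum_divide_distrib[symmetric] by (subst sum.swap) simp

lemma avg_const: "finite V \<Longrightarrow> avg V (\<lambda>_. c) = c"
  by (simp add: avg_def card_Pow)

lemma avg_nonneg: "(\<And>\<sigma>. \<sigma> \<subseteq> V \<Longrightarrow> 0 \<le> f \<sigma>) \<Longrightarrow> 0 \<le> avg V f"
  by (auto simp: avg_def intro!: divide_nonneg_nonneg sum_nonneg)

lemma avg_pos: "finite V \<Longrightarrow> (\<And>\<sigma>. \<sigma> \<subseteq> V \<Longrightarrow> 0 < f \<sigma>) \<Longrightarrow> 0 < avg V f"
  unfolding avg_def by (intro divide_pos_pos sum_pos) auto

lemma avg_mono: "(\<And>\<sigma>. \<sigma> \<subseteq> V \<Longrightarrow> f \<sigma> \<le> g \<sigma>) \<Longrightarrow> avg V f \<le> avg V g"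
  by (auto simp: avg_def intro!: divide_right_mono sum_mono)

lemma avg_shift:
  assumes "D \<subseteq> V"
  shows "avg V (\<lambda>\<sigma>. f (sym_diff \<sigma> D)) = avg V f"
proof -
  have "(\<Sum>\<sigma>\<in>Pow V. f (sym_diff \<sigma> D)) = (\<Sum>\<sigma>\<in>Pow V. f \<sigma>)"
    by (rule sum.reindex_bij_witness[where i = "\<lambda>\<sigma>. sym_diff \<sigma> D" and j = "\<lambda>\<sigma>. sym_diff \<sigma> D"])
      (use assms in auto)
  then show ?thesis
    by (simp add: avg_def)
qed

lemma avg_shift_left:
  assumes "D \<subseteq> V"
  shows "avg V (\<lambda>\<sigma>. f (sym_diff D \<sigma>)) = avg V f"
  using avg_shift[OF assms, of f] by (simp add: Un_commute)

lemma avg_swap: "avg V (\<lambda>\<sigma>. avg W (\<lambda>\<tau>. f \<sigma> \<tau>)) = avg W (\<lambda>\<tau>. avg V (\<lambda>\<sigma>. f \<sigma> \<tau>))"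
  unfolding avg_def sum_divide_distrib[symmetric]
  by (subst sum.swap) (simp add: field_simps)

text \<open>A pair of configurations is the same as one configuration and the set \<open>D\<close>
  where the other differs from it. Both Ginibre's argument and the decomposition by the set of
  agreement rest on this substitution.\<close>

lemma avg_pair_shift:
  "avg V (\<lambda>\<sigma>. avg V (\<lambda>\<tau>. f \<sigma> \<tau>)) = avg V (\<lambda>D. avg V (\<lambda>\<sigma>. f \<sigma> (sym_diff \<sigma> D)))"
proof -
  have "avg V (\<lambda>\<sigma>. avg V (\<lambda>\<tau>. f \<sigma> \<tau>)) = avg V (\<lambda>\<sigma>. avg V (\<lambda>D. f \<sigma> (sym_diff \<sigma> D)))"
    by (intro avg_cong avg_shift_left[symmetric]) auto
  also have "\<dots> = avg V (\<lambda>D. avg V (\<lambda>\<sigma>. f \<sigma> (sym_diff \<sigma> D)))"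
    by (rule avg_swap)
  finally show ?thesis .
qed

lemma avg_indep:
  assumes "finite V" "A \<subseteq> V"
  shows "avg V (\<lambda>\<sigma>. f (\<sigma> \<inter> A) * g (\<sigma> \<inter> (V - A))) = avg A f * avg (V - A) g"
proof -
  have "(\<Sum>\<sigma>\<in>Pow V. f (\<sigma> \<inter> A) * g (\<sigma> \<inter> (V - A)))
      = (\<Sum>(\<sigma>, \<tau>)\<in>Pow A \<times> Pow (V - A). f \<sigma> * g \<tau>)"
    by (rule sum.reindex_bij_witness[where i = "\<lambda>(\<sigma>, \<tau>). \<sigma> \<union> \<tau>"
          and j = "\<lambda>\<sigma>. (\<sigma> \<inter> A, \<sigma> \<inter> (V - A))"])
      (use assms in \<open>auto intro!: arg_cong2[of _ _ _ _ "(*)"] arg_cong[of _ _ f] arg_cong[of _ _ g]\<close>)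
  also have "\<dots> = (\<Sum>\<sigma>\<in>Pow A. f \<sigma>) * (\<Sum>\<tau>\<in>Pow (V - A). g \<tau>)"
    by (simp add: sum_product sum.cartesian_product)
  moreover have "(2::real) ^ card V = 2 ^ card A * 2 ^ card (V - A)"
    using assms by (metis card_Diff_subset card_mono le_add_diff_inverse power_add finite_subset)
  ultimately show ?thesis
    by (simp add: avg_def)
qed

lemma avg_Int:
  assumes "finite V" "A \<subseteq> V"
  shows "avg V (\<lambda>\<sigma>. f (\<sigma> \<inter> A)) = avg A f"
  using avg_indep[OF assms, of f "\<lambda>_. 1"] assms by (simp add: avg_const)

section \<open>Restriction of a model to a subset of its vertices\<close>

lemma energy_Int: "A \<subseteq> B \<Longrightarrow> energy A k (\<sigma> \<inter> B) = energy A k \<sigma>"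
  unfolding energy_def by (intro sum.cong) (auto simp: spin_def)

lemma energy_add: "energy V (\<lambda>a b. k a b + l a b) \<sigma> = energy V k \<sigma> + energy V l \<sigma>"
  by (simp add: energy_def sum.distrib algebra_simps)

lemma energy_restrict:
  assumes "finite V" "A \<subseteq> V"
  shows "energy V (\<lambda>a b. if a \<in> A \<and> b \<in> A then k a b else 0) \<sigma> = energy A k \<sigma>"
proof -
  have "energy V (\<lambda>a b. if a \<in> A \<and> b \<in> A then k a b else 0) \<sigma>
      = (\<Sum>a\<in>V. if a \<in> A then (\<Sum>b\<in>V. if b \<in> A then k a b * (spin \<sigma> a * spin \<sigma> b) else 0) else 0)"
    unfolding energy_def by (auto intro!: sum.cong)
  also have "\<dots> = energy A k \<sigma>"
    using assms by (simp add: sum.inter_restrict[symmetric] Int_absorb1 energy_def)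
  finally show ?thesis .
qed

text \<open>With the couplings outside \<open>A\<close> put to zero the remaining spins are free and
  average out. In this way a model on \<open>A\<close> becomes a model on \<open>V\<close>, and
  removing vertices becomes lowering couplings.\<close>

lemma wavg_restrict:
  assumes "finite V" "A \<subseteq> V" "\<And>\<sigma>. f (\<sigma> \<inter> A) = f \<sigma>"
  shows "wavg V (\<lambda>a b. if a \<in> A \<and> b \<in> A then k a b else 0) f = wavg A k f"
proof -
  have "wavg V (\<lambda>a b. if a \<in> A \<and> b \<in> A then k a b else 0) f
      = avg V (\<lambda>\<sigma>. f (\<sigma> \<inter> A) * exp (energy A k (\<sigma> \<inter> A)))"
    using assms by (simp add: wavg_def energy_restrict energy_Int)
  also have "\<dots> = wavg A k f"
    unfolding wavg_def by (rule avg_Int[OF assms(1,2)])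
  finally show ?thesis .
qed

lemma zsum_restrict:
  assumes "finite V" "A \<subseteq> V"
  shows "zsum V (\<lambda>a b. if a \<in> A \<and> b \<in> A then k a b else 0) = zsum A k"
  unfolding zsum_def using assms by (intro wavg_restrict) auto

lemma two_restrict:
  assumes "finite V" "A \<subseteq> V" "a \<in> A" "b \<in> A"
  shows "two V (\<lambda>a b. if a \<in> A \<and> b \<in> A then k a b else 0) a b = two A k a b"
  unfolding two_def using assms by (intro wavg_restrict) (auto simp: spin_Int)

lemma energy_cong: "(\<And>a b. a \<in> V \<Longrightarrow> b \<in> V \<Longrightarrow> k a b = l a b) \<Longrightarrow> energy V k \<sigma> = energy V l \<sigma>"
  by (simp add: energy_def)

lemma wavg_cong:
  assumes "\<And>a b. a \<in> V \<Longrightarrow> b \<in> V \<Longrightarrow> k a b = l a b" "\<And>\<sigma>. \<sigma> \<subseteq> V \<Longrightarrow> f \<sigma> = g \<sigma>"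
  shows "wavg V k f = wavg V l g"
proof -
  have "energy V k = energy V l"
    by (intro ext energy_cong assms)
  then show ?thesis
    unfolding wavg_def using assms(2) by (intro avg_cong) simp
qed

lemma zsum_cong: "(\<And>a b. a \<in> V \<Longrightarrow> b \<in> V \<Longrightarrow> k a b = l a b) \<Longrightarrow> zsum V k = zsum V l"
  unfolding zsum_def by (rule wavg_cong) simp_all

lemma two_cong: "(\<And>a b. a \<in> V \<Longrightarrow> b \<in> V \<Longrightarrow> k a b = l a b) \<Longrightarrow> two V k x y = two V l x y"
  unfolding two_def by (rule wavg_cong) simp_all

lemma corr_cong: "(\<And>a b. a \<in> V \<Longrightarrow> b \<in> V \<Longrightarrow> k a b = l a b) \<Longrightarrow> corr V k x y = corr V l x y"
  unfolding corr_def by (metis zsum_cong two_cong)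

lemma zsum_pos: "finite V \<Longrightarrow> 0 < zsum V k"
  by (simp add: zsum_def wavg_def avg_pos)

lemma zsum_neq0 [simp]: "finite V \<Longrightarrow> zsum V k \<noteq> 0"
  using zsum_pos[of V k] by simp

lemma two_refl: "two V k a a = zsum V k"
  by (simp add: two_def zsum_def)

lemma corr_refl: "finite V \<Longrightarrow> corr V k a a = 1"
  by (simp add: corr_def two_refl)

lemma two_commute: "two V k a b = two V k b a"
  by (simp add: two_def mult.commute)

lemma corr_commute: "corr V k a b = corr V k b a"
  by (simp add: corr_def two_commute)

lemma two_eq_corr: "finite V \<Longrightarrow> two V k a b = corr V k a b * zsum V k"
  by (simp add: corr_def)

section \<open>Griffiths inequalities\<close>

text \<open>The cone of functions whose expansion in the characters \<open>chr S\<close> has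
  nonnegative coefficients. As an inductive predicate its closure under sums and products follows by
  rule induction, without uniqueness of the expansion.\<close>

inductive gcone :: "'a set \<Rightarrow> ('a set \<Rightarrow> real) \<Rightarrow> bool" for V where
  gcone_zero: "gcone V (\<lambda>\<sigma>. 0)"
| gcone_step: "gcone V f \<Longrightarrow> S \<subseteq> V \<Longrightarrow> 0 \<le> c \<Longrightarrow> gcone V (\<lambda>\<sigma>. c * chr S \<sigma> + f \<sigma>)"

lemma gcone_chr: "S \<subseteq> V \<Longrightarrow> 0 \<le> c \<Longrightarrow> gcone V (\<lambda>\<sigma>. c * chr S \<sigma>)"
  using gcone_step[OF gcone_zero] by fastforce

lemma gcone_const: "0 \<le> c \<Longrightarrow> gcone V (\<lambda>\<sigma>. c)"
  using gcone_chr[of "{}" V c] by simp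

lemma gcone_add:
  assumes "gcone V f" "gcone V g"
  shows "gcone V (\<lambda>\<sigma>. f \<sigma> + g \<sigma>)"
  using assms(1)
proof induction
  case gcone_zero
  then show ?case using assms(2) by simp
next
  case (gcone_step f S c)
  then show ?case
    using gcone.gcone_step[of V "\<lambda>\<sigma>. f \<sigma> + g \<sigma>" S c] by (simp add: add.assoc)
qed

lemma gcone_chr_mult:
  assumes "finite V" "gcone V f" "S \<subseteq> V" "0 \<le> c"
  shows "gcone V (\<lambda>\<sigma>. c * chr S \<sigma> * f \<sigma>)"
  using assms(2)
proof induction
  case gcone_zero
  then show ?case by (simp add: gcone.gcone_zero)
next
  case (gcone_step f T d)
  have "c * chr S \<sigma> * (d * chr T \<sigma> + f \<sigma>) = c * d * chr (sym_diff S T) \<sigma> + c * chr S \<sigma> * f \<sigma>" for \<sigma>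
    using chr_mult[of S T \<sigma>] assms gcone_step.hyps finite_subset[of S V] finite_subset[of T V]
    by (simp add: algebra_simps)
  moreover have "sym_diff S T \<subseteq> V"
    using assms gcone_step.hyps by auto
  ultimately show ?case
    using gcone.gcone_step[OF gcone_step.IH, of "sym_diff S T" "c * d"] assms gcone_step.hyps by simp
qed

lemma gcone_mult:
  assumes "finite V" "gcone V f" "gcone V g"
  shows "gcone V (\<lambda>\<sigma>. f \<sigma> * g \<sigma>)"
  using assms(2)
proof induction
  case gcone_zero
  then show ?case by (simp add: gcone.gcone_zero)
next
  case (gcone_step f S c)
  then show ?case
    using gcone_add[OF gcone_chr_mult[OF assms(1) assms(3), of S c] gcone_step.IH]
    by (simp add: algebra_simps)
qed

lemma gcone_prod:
  assumes "finite V" "\<And>i. i \<in> I \<Longrightarrow> gcone V (f i)"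
  shows "gcone V (\<lambda>\<sigma>. \<Prod>i\<in>I. f i \<sigma>)"
  using assms(2)
proof (induction I rule: infinite_finite_induct)
  case (insert x F)
  then show ?case
    using gcone_mult[OF assms(1), of "f x" "\<lambda>\<sigma>. \<Prod>i\<in>F. f i \<sigma>"] by simp
qed (simp_all add: gcone_const)

lemma gcone_sum:
  assumes "\<And>i. i \<in> I \<Longrightarrow> gcone V (f i)"
  shows "gcone V (\<lambda>\<sigma>. \<Sum>i\<in>I. f i \<sigma>)"
  using assms
proof (induction I rule: infinite_finite_induct)
  case (insert x F)
  then show ?case
    using gcone_add[of V "f x" "\<lambda>\<sigma>. \<Sum>i\<in>F. f i \<sigma>"] by simp
qed (simp_all add: gcone_const)

lemma gcone_spin2: "a \<in> V \<Longrightarrow> b \<in> V \<Longrightarrow> gcone V (\<lambda>\<sigma>. spin \<sigma> a * spin \<sigma> b)"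
  using gcone_chr[of "if a = b then {} else {a, b}" V 1] unfolding spin_mult_chr by (auto split: if_splits)

lemma exp_spin2:
  "exp (c * (spin \<sigma> a * spin \<sigma> b)) = cosh c + sinh c * (spin \<sigma> a * spin \<sigma> b)"
  by (simp add: spin_def cosh_def sinh_def algebra_simps add_divide_distrib[symmetric])

lemma gcone_exp_spin2:
  assumes "finite V" "a \<in> V" "b \<in> V" "0 \<le> c"
  shows "gcone V (\<lambda>\<sigma>. exp (c * (spin \<sigma> a * spin \<sigma> b)))"
  unfolding exp_spin2 using assms
  by (intro gcone_add gcone_const gcone_mult gcone_spin2) (auto simp: order.trans[OF _ cosh_real_ge_1])

lemma gcone_exp_energy:
  assumes "finite V" "\<And>a b. a \<in> V \<Longrightarrow> b \<in> V \<Longrightarrow> 0 \<le> k a b"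
  shows "gcone V (\<lambda>\<sigma>. exp (energy V k \<sigma>))"
  unfolding energy_def using assms by (simp add: exp_sum) (intro gcone_prod gcone_exp_spin2; auto)

text \<open>If \<open>S\<close> has an element \<open>x\<close>, flipping the spin at
  \<open>x\<close> reverses the sign of \<open>chr S\<close>, so the average is 0; for empty
  \<open>S\<close> it is 1.\<close>

lemma avg_chr_nonneg:
  assumes "finite V" "S \<subseteq> V"
  shows "0 \<le> avg V (chr S)"
proof (cases "S = {}")
  case False
  then obtain x where x: "x \<in> S" by blast
  have "finite S"
    using assms finite_subset by blast
  have "chr S (- {x}) = (\<Prod>y\<in>S. if y = x then - 1 else 1)"
    unfolding chr_def by (rule prod.cong) (auto simp: spin_def)
  also have "\<dots> = - 1"
    using \<open>finite S\<close> x by simp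
  finally have "avg V (\<lambda>\<sigma>. chr S (sym_diff \<sigma> {x})) = - avg V (chr S)"
    using avg_cmult[of V "- 1" "chr S"] by (simp add: chr_sym_diff)
  then show ?thesis
    using avg_shift[of "{x}" V "chr S"] x assms by (simp add: subset_iff)
next
  case True
  then have "chr S = (\<lambda>_. 1)"
    by auto
  then show ?thesis
    using assms by (simp add: avg_const)
qed

lemma gcone_avg_nonneg:
  assumes "finite V" "gcone V f"
  shows "0 \<le> avg V f"
  using assms(2)
proof induction
  case gcone_zero
  then show ?case by (simp add: avg_def)
next
  case (gcone_step f S c)
  then show ?case
    using avg_chr_nonneg[OF assms(1), of S] by (simp add: avg_add avg_cmult)
qed

lemma chr_spin2_sym_diff:
  "spin (sym_diff \<sigma> D) a * spin (sym_diff \<sigma> D) b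
    = spin \<sigma> a * spin \<sigma> b * (spin (- D) a * spin (- D) b)"
  by (simp add: spin_def)

lemma energy_sym_diff:
  "energy V k (sym_diff \<sigma> D) = energy V (\<lambda>a b. k a b * (spin (- D) a * spin (- D) b)) \<sigma>"
  unfolding energy_def chr_spin2_sym_diff by (intro sum.cong) simp_all

(* Ginibre's argument: with \<tau> = sym_diff \<sigma> D the difference of the two sides is, for fixed D,
   the average of a function in the gcone. *)
lemma wavg_chr_compare:
  assumes "finite V" "\<And>a b. a \<in> V \<Longrightarrow> b \<in> V \<Longrightarrow> \<bar>k' a b\<bar> \<le> k a b" "S \<subseteq> V" "\<bar>c\<bar> \<le> 1"
  shows "c * wavg V k' (chr S) * zsum V k \<le> wavg V k (chr S) * zsum V k'"
proof -
  let ?w = "\<lambda>\<sigma>. exp (energy V k \<sigma>)" and ?w' = "\<lambda>\<sigma>. exp (energy V k' \<sigma>)"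
  have "0 \<le> avg V (\<lambda>D. avg V (\<lambda>\<sigma>. (chr S \<sigma> - c * chr S (sym_diff \<sigma> D)) * (?w \<sigma> * ?w' (sym_diff \<sigma> D))))"
  proof (rule avg_nonneg)
    fix D
    \<comment> \<open>For fixed \<open>D\<close> the weights of both copies combine into one model
      in \<open>\<sigma>\<close>; its coupling, \<open>k\<close> plus or minus \<open>k'\<close>, is
      ferromagnetic because \<open>k\<close> dominates the absolute value of
      \<open>k'\<close>.\<close>
    let ?l = "\<lambda>a b. k a b + k' a b * (spin (- D) a * spin (- D) b)"
    have l: "0 \<le> ?l a b" if "a \<in> V" "b \<in> V" for a b
      using assms(2)[OF that] by (auto simp: spin_def)
    have c: "0 \<le> 1 - c * chr S (- D)"
      using chr_cases[of S "- D"] assms(4) by auto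
    have "(chr S \<sigma> - c * chr S (sym_diff \<sigma> D)) * (?w \<sigma> * ?w' (sym_diff \<sigma> D))
        = (1 - c * chr S (- D)) * chr S \<sigma> * exp (energy V ?l \<sigma>)" for \<sigma>
      by (simp only: chr_sym_diff energy_sym_diff energy_add exp_add) (simp add: algebra_simps)
    then show "0 \<le> avg V (\<lambda>\<sigma>. (chr S \<sigma> - c * chr S (sym_diff \<sigma> D)) * (?w \<sigma> * ?w' (sym_diff \<sigma> D)))"
      using gcone_avg_nonneg[OF assms(1) gcone_chr_mult[OF assms(1) gcone_exp_energy[OF assms(1) l] assms(3) c]]
      by simp
  qed
  also have "\<dots> = avg V (\<lambda>\<sigma>. avg V (\<lambda>\<tau>. (chr S \<sigma> - c * chr S \<tau>) * (?w \<sigma> * ?w' \<tau>)))"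
    by (rule avg_pair_shift[symmetric])
  also have "\<dots> = avg V (\<lambda>\<sigma>. (chr S \<sigma> * ?w \<sigma>) * zsum V k' - ?w \<sigma> * (c * wavg V k' (chr S)))"
    by (rule avg_cong) (simp add: zsum_def wavg_def avg_cmult[symmetric] avg_diff[symmetric] algebra_simps)
  also have "\<dots> = wavg V k (chr S) * zsum V k' - c * wavg V k' (chr S) * zsum V k"
    using avg_cmult[of V "zsum V k'" "\<lambda>\<sigma>. chr S \<sigma> * ?w \<sigma>"] avg_cmult[of V "c * wavg V k' (chr S)" ?w]
    by (simp add: avg_diff wavg_def zsum_def algebra_simps)
  finally show ?thesis
    by simp
qed

text \<open>Signs are allowed in \<open>k'\<close> because the couplings met below need not be
  ferromagnetic: \<open>m\<close> on the set of disagreement and the conditioned couplings in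
  \<open>corr_quotient\<close>. The two signs of the correlation come from
  \<open>wavg_chr_compare\<close> with \<open>c\<close> equal to 1 and to -1.\<close>

lemma abs_corr_le:
  assumes "finite V" "\<And>a b. a \<in> V \<Longrightarrow> b \<in> V \<Longrightarrow> \<bar>k' a b\<bar> \<le> k a b" "x \<in> V" "y \<in> V"
  shows "\<bar>corr V k' x y\<bar> \<le> corr V k x y"
proof -
  let ?S = "if x = y then {} else {x, y}"
  have "two V l x y = wavg V l (chr ?S)" for l
    by (simp add: two_def spin_mult_chr)
  moreover have "c * wavg V k' (chr ?S) * zsum V k \<le> wavg V k (chr ?S) * zsum V k'" if "\<bar>c\<bar> \<le> 1" for c
    using assms that by (intro wavg_chr_compare) auto
  from this[of 1] this[of "- 1"]
  have "\<bar>wavg V k' (chr ?S)\<bar> * zsum V k \<le> wavg V k (chr ?S) * zsum V k'"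
    by (cases "wavg V k' (chr ?S) \<ge> 0") auto
  ultimately show ?thesis
    using zsum_pos[OF assms(1), of k] zsum_pos[OF assms(1), of k']
    by (simp add: corr_def field_simps)
qed

lemma corr_mono:
  assumes "finite V" "\<And>a b. a \<in> V \<Longrightarrow> b \<in> V \<Longrightarrow> 0 \<le> k' a b"
    "\<And>a b. a \<in> V \<Longrightarrow> b \<in> V \<Longrightarrow> k' a b \<le> k a b" "x \<in> V" "y \<in> V"
  shows "corr V k' x y \<le> corr V k x y"
  using abs_corr_le[of V k' k x y] assms by fastforce

lemma corr_nonneg:
  assumes "finite V" "\<And>a b. a \<in> V \<Longrightarrow> b \<in> V \<Longrightarrow> 0 \<le> k a b" "x \<in> V" "y \<in> V"
  shows "0 \<le> corr V k x y"
  using abs_corr_le[of V k k x y] assms by fastforce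

lemma two_le_zsum: "\<bar>two V k a b\<bar> \<le> zsum V k"
proof -
  have le: "c * two V k a b \<le> zsum V k" if "\<bar>c\<bar> \<le> 1" for c
    unfolding two_def zsum_def wavg_def avg_cmult[symmetric]
    using that by (intro avg_mono) (auto simp: spin_def abs_le_iff)
  from le[of 1] le[of "- 1"] show ?thesis
    by (simp add: abs_le_iff)
qed

lemma corr_le_1: "finite V \<Longrightarrow> corr V k a b \<le> 1"
  using two_le_zsum[of V k a b] zsum_pos[of V k] by (simp add: corr_def)

lemma corr_subset_mono:
  assumes "finite V" "\<And>a b. a \<in> V \<Longrightarrow> b \<in> V \<Longrightarrow> 0 \<le> k a b" "A \<subseteq> V" "x \<in> A" "y \<in> A"
  shows "corr A k x y \<le> corr V k x y"
proof -
  have "corr A k x y = corr V (\<lambda>a b. if a \<in> A \<and> b \<in> A then k a b else 0) x y"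
    using assms by (simp add: corr_def two_restrict zsum_restrict)
  also have "\<dots> \<le> corr V k x y"
    using assms by (intro corr_mono) auto
  finally show ?thesis .
qed

text \<open>The exponential of a multiple of a sign is affine in that sign. This drives the
  inductions that switch on couplings one ordered pair at a time.\<close>

lemma wavg_add_pair:
  assumes "finite V" "a \<in> V" "b \<in> V"
  shows "wavg V (\<lambda>u v. k u v + (if (u, v) = (a, b) then c else 0)) f
    = cosh c * wavg V k f + sinh c * wavg V k (\<lambda>\<sigma>. spin \<sigma> a * spin \<sigma> b * f \<sigma>)"
proof -
  have "energy V (\<lambda>u v. if (u, v) = (a, b) then c else 0) \<sigma> = c * (spin \<sigma> a * spin \<sigma> b)" for \<sigma>
  proof -
    have "energy V (\<lambda>u v. if (u, v) = (a, b) then c else 0) \<sigma>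
        = (\<Sum>u\<in>V. \<Sum>v\<in>V. if v = b then (if u = a then c * (spin \<sigma> a * spin \<sigma> b) else 0) else 0)"
      unfolding energy_def by (intro sum.cong) auto
    then show ?thesis
      using assms by simp
  qed
  then show ?thesis
    by (simp add: wavg_def energy_add exp_add exp_spin2 avg_cmult[symmetric] avg_add[symmetric] algebra_simps)
qed

text \<open>Switching on the coupling of one pair multiplies the partition function by cosh plus
  sinh times the correlation of that pair. By \<open>abs_corr_le\<close> every such factor is at
  least as large for the dominating couplings.\<close>

lemma zsum_add_compare:
  assumes "finite V" "\<And>a b. a \<in> V \<Longrightarrow> b \<in> V \<Longrightarrow> \<bar>k' a b\<bar> \<le> k a b"
    "\<And>a b. a \<in> V \<Longrightarrow> b \<in> V \<Longrightarrow> \<bar>l' a b\<bar> \<le> l a b"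
  shows "zsum V (\<lambda>a b. k' a b + l' a b) * zsum V k \<le> zsum V (\<lambda>a b. k a b + l a b) * zsum V k'"
proof -
  define K where "K X = (\<lambda>a b. k a b + (if (a, b) \<in> X then l a b else 0))" for X
  define K' where "K' X = (\<lambda>a b. k' a b + (if (a, b) \<in> X then l' a b else 0))" for X
  have "zsum V (K' X) * zsum V k \<le> zsum V (K X) * zsum V k'" if "X \<subseteq> V \<times> V" for X
    using finite_subset[OF that finite_cartesian_product[OF assms(1,1)]] that
  proof (induction X)
    case empty
    then show ?case by (simp add: K_def K'_def mult.commute)
  next
    case (insert e X)
    obtain a b where e: "e = (a, b)" by force
    have ab: "a \<in> V" "b \<in> V"
      using insert e by auto
    have KK: "\<bar>K' X u v\<bar> \<le> K X u v" if "u \<in> V" "v \<in> V" for u v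
      using assms(2,3)[OF that] by (auto simp: K_def K'_def)
    have "K (insert e X) = (\<lambda>u v. K X u v + (if (u, v) = (a, b) then l a b else 0))"
      "K' (insert e X) = (\<lambda>u v. K' X u v + (if (u, v) = (a, b) then l' a b else 0))"
      using insert.hyps by (auto simp: K_def K'_def e intro!: ext)
    then have eq: "zsum V (K (insert e X)) = cosh (l a b) * zsum V (K X) + sinh (l a b) * two V (K X) a b"
      "zsum V (K' (insert e X)) = cosh (l' a b) * zsum V (K' X) + sinh (l' a b) * two V (K' X) a b"
      by (simp_all only: zsum_def two_def wavg_add_pair[OF assms(1) ab] mult_1_right)
    have ll: "\<bar>l' a b\<bar> \<le> l a b"
      using assms(3) ab by simp
    have "sinh (l' a b) * corr V (K' X) a b \<le> \<bar>sinh (l' a b)\<bar> * \<bar>corr V (K' X) a b\<bar>"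
      by (metis abs_ge_self abs_mult)
    also have "\<dots> \<le> sinh (l a b) * corr V (K X) a b"
      using ll abs_corr_le[of V "K' X" "K X" a b] KK ab assms(1)
      by (intro mult_mono) (auto simp: abs_le_iff simp flip: sinh_real_abs)
    moreover have "cosh (l' a b) \<le> cosh (l a b)"
      using ll by (metis abs_ge_zero abs_of_nonneg cosh_real_abs cosh_real_nonneg_le_iff order.trans)
    ultimately have le: "zsum V (K' (insert e X)) / zsum V (K' X) \<le> zsum V (K (insert e X)) / zsum V (K X)"
      unfolding eq using assms(1) by (simp add: add_divide_distrib two_eq_corr)
    have "zsum V (K' (insert e X)) * zsum V k
        = zsum V (K' (insert e X)) / zsum V (K' X) * (zsum V (K' X) * zsum V k)"
      using assms(1) by simp
    also have "\<dots> \<le> zsum V (K (insert e X)) / zsum V (K X) * (zsum V (K X) * zsum V k')"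
      using insert.IH insert.prems le zsum_pos[OF assms(1)]
      by (intro mult_mono[OF le]) (auto simp: less_imp_le)
    also have "\<dots> = zsum V (K (insert e X)) * zsum V k'"
      using assms(1) by simp
    finally show ?case .
  qed
  from this[of "V \<times> V"] show ?thesis
    by (simp add: K_def K'_def cong: zsum_cong)
qed

text \<open>The growth of the partition function from \<open>B \<inter> B'\<close> to
  \<open>B'\<close> with coupling \<open>m\<close> is compared with its growth from \<open>B\<close>
  to \<open>B \<union> B'\<close> with coupling \<open>p\<close>: a pair in \<open>B'\<close> that
  does not lie in \<open>B \<inter> B'\<close> is also new for \<open>B\<close>. Allowing two
  different couplings lets base and cover enter the four functions theorem together.\<close>

lemma zsum_supermodular:
  assumes "finite U" "\<And>a b. a \<in> U \<Longrightarrow> b \<in> U \<Longrightarrow> \<bar>m a b\<bar> \<le> p a b" "B \<subseteq> U" "B' \<subseteq> U"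
  shows "zsum B p * zsum B' m \<le> zsum (B \<union> B') p * zsum (B \<inter> B') m"
proof -
  let ?r = "\<lambda>A k a b. if a \<in> A \<and> b \<in> A then k a b else (0::real)"
  let ?l' = "\<lambda>a b. ?r B' m a b - ?r (B \<inter> B') m a b" and ?l = "\<lambda>a b. ?r (B \<union> B') p a b - ?r B p a b"
  have "zsum U (\<lambda>a b. ?r (B \<inter> B') m a b + ?l' a b) * zsum U (?r B p)
      \<le> zsum U (\<lambda>a b. ?r B p a b + ?l a b) * zsum U (?r (B \<inter> B') m)"
    by (rule zsum_add_compare[OF assms(1)]) (use assms(2) in force)+
  then show ?thesis
    using assms zsum_restrict[of U "B \<union> B'" p] zsum_restrict[of U "B \<inter> B'" m]
    by (simp add: zsum_restrict le_infI1 mult.commute)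
qed

section \<open>The four functions theorem\<close>

text \<open>The case of the subsets of a single point. Both mixed products x =
  \<open>a0 * b1\<close> and y = \<open>a1 * b0\<close> are at most P = \<open>c1 * d0\<close>, and
  their product is at most P times \<open>c0 * d1\<close>; expanding (P - x) (P - y) >= 0 then
  bounds their sum by P + \<open>c0 * d1\<close>.\<close>

lemma four_numbers:
  fixes a0 a1 b0 b1 c0 c1 d0 d1 :: real
  assumes nn: "0 \<le> a0" "0 \<le> a1" "0 \<le> b0" "0 \<le> b1" "0 \<le> c0" "0 \<le> c1" "0 \<le> d0" "0 \<le> d1"
    and le: "a0 * b0 \<le> c0 * d0" "a0 * b1 \<le> c1 * d0" "a1 * b0 \<le> c1 * d0" "a1 * b1 \<le> c1 * d1"
  shows "(a0 + a1) * (b0 + b1) \<le> (c0 + c1) * (d0 + d1)"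
proof (cases "c1 * d0 = 0")
  case True
  then have "a0 * b1 = 0" "a1 * b0 = 0"
    using le nn by (metis antisym mult_nonneg_nonneg)+
  then show ?thesis
    using le(1,4) True mult_nonneg_nonneg[OF \<open>0 \<le> c0\<close> \<open>0 \<le> d1\<close>]
    by (simp only: distrib_left distrib_right)
next
  case False
  then have P: "0 < c1 * d0"
    using nn by (metis less_eq_real_def mult_nonneg_nonneg)
  have "(a0 * b1 + a1 * b0) * (c1 * d0) \<le> (c1 * d0) * (c1 * d0) + (a0 * b0) * (a1 * b1)"
    using mult_nonneg_nonneg[of "c1 * d0 - a0 * b1" "c1 * d0 - a1 * b0"] le by (simp add: algebra_simps)
  also have "\<dots> \<le> (c1 * d0) * (c1 * d0) + (c0 * d0) * (c1 * d1)"
    using le nn mult_mono[OF le(1) le(4)] by simp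
  also have "\<dots> = (c1 * d0 + c0 * d1) * (c1 * d0)"
    by (simp add: algebra_simps)
  finally have "a0 * b1 + a1 * b0 \<le> c1 * d0 + c0 * d1"
    using P by (rule mult_right_le_imp_le)
  then show ?thesis
    using le by (simp add: algebra_simps)
qed

text \<open>The inequality of Ahlswede and Daykin. Each function is summed over the presence of one
  point \<open>x\<close>, and \<open>four_numbers\<close> shows that the hypothesis survives, so
  induction on the ground set applies.\<close>

theorem four_functions:
  fixes \<alpha> \<beta> \<gamma> \<delta> :: "'a set \<Rightarrow> real"
  assumes "finite U"
    and "\<And>A. A \<subseteq> U \<Longrightarrow> 0 \<le> \<alpha> A" "\<And>A. A \<subseteq> U \<Longrightarrow> 0 \<le> \<beta> A"
    and "\<And>A. A \<subseteq> U \<Longrightarrow> 0 \<le> \<gamma> A" "\<And>A. A \<subseteq> U \<Longrightarrow> 0 \<le> \<delta> A"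
    and "\<And>A B. A \<subseteq> U \<Longrightarrow> B \<subseteq> U \<Longrightarrow> \<alpha> A * \<beta> B \<le> \<gamma> (A \<union> B) * \<delta> (A \<inter> B)"
  shows "sum \<alpha> (Pow U) * sum \<beta> (Pow U) \<le> sum \<gamma> (Pow U) * sum \<delta> (Pow U)"
  using assms
proof (induction U arbitrary: \<alpha> \<beta> \<gamma> \<delta>)
  case empty
  then show ?case using empty(5)[of "{}" "{}"] by simp
next
  case (insert x U)
  have sub: "A \<subseteq> insert x U" "insert x A \<subseteq> insert x U" if "A \<subseteq> U" for A
    using that by auto
  have le: "(\<alpha> A + \<alpha> (insert x A)) * (\<beta> B + \<beta> (insert x B))
      \<le> (\<gamma> (A \<union> B) + \<gamma> (insert x (A \<union> B))) * (\<delta> (A \<inter> B) + \<delta> (insert x (A \<inter> B)))"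
    if AB: "A \<subseteq> U" "B \<subseteq> U" for A B
  proof (rule four_numbers)
    have x: "x \<notin> A" "x \<notin> B"
      using AB insert.hyps by auto
    note h = insert.prems(5)
    show "\<alpha> A * \<beta> B \<le> \<gamma> (A \<union> B) * \<delta> (A \<inter> B)"
      using h[of A B] sub AB by simp
    show "\<alpha> A * \<beta> (insert x B) \<le> \<gamma> (insert x (A \<union> B)) * \<delta> (A \<inter> B)"
      using h[of A "insert x B"] sub AB x by simp
    show "\<alpha> (insert x A) * \<beta> B \<le> \<gamma> (insert x (A \<union> B)) * \<delta> (A \<inter> B)"
      using h[of "insert x A" B] sub AB x by simp
    have "insert x A \<inter> insert x B = insert x (A \<inter> B)" "insert x A \<union> insert x B = insert x (A \<union> B)"
      by auto
    then show "\<alpha> (insert x A) * \<beta> (insert x B) \<le> \<gamma> (insert x (A \<union> B)) * \<delta> (insert x (A \<inter> B))"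
      using h[of "insert x A" "insert x B"] sub AB by simp
    show "0 \<le> \<alpha> A" "0 \<le> \<alpha> (insert x A)" "0 \<le> \<beta> B" "0 \<le> \<beta> (insert x B)"
      "0 \<le> \<gamma> (A \<union> B)" "0 \<le> \<gamma> (insert x (A \<union> B))" "0 \<le> \<delta> (A \<inter> B)" "0 \<le> \<delta> (insert x (A \<inter> B))"
      using AB by (auto intro!: insert.prems(1-4))
  qed
  have nn: "0 \<le> \<alpha> A + \<alpha> (insert x A)" "0 \<le> \<beta> A + \<beta> (insert x A)"
    "0 \<le> \<gamma> A + \<gamma> (insert x A)" "0 \<le> \<delta> A + \<delta> (insert x A)" if "A \<subseteq> U" for A
    using that by (auto intro!: add_nonneg_nonneg insert.prems(1-4))
  have "(\<Sum>A\<in>Pow U. \<alpha> A + \<alpha> (insert x A)) * (\<Sum>A\<in>Pow U. \<beta> A + \<beta> (insert x A))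
      \<le> (\<Sum>A\<in>Pow U. \<gamma> A + \<gamma> (insert x A)) * (\<Sum>A\<in>Pow U. \<delta> A + \<delta> (insert x A))"
    by (rule insert.IH) (fact nn le)+
  then show ?case
    by (simp only: sum_Pow_insert[OF insert.hyps])
qed

section \<open>Pairs of configurations and double covers\<close>

definition join :: "'a set \<Rightarrow> 'a set \<Rightarrow> ('a \<times> bool) set" where
  "join \<sigma> \<tau> = \<sigma> \<times> {False} \<union> \<tau> \<times> {True}"

definition lift :: "('a \<Rightarrow> 'a \<Rightarrow> real) \<Rightarrow> ('a \<Rightarrow> 'a \<Rightarrow> real) \<Rightarrow> 'a \<times> bool \<Rightarrow> 'a \<times> bool \<Rightarrow> real" where
  "lift k0 k1 = (\<lambda>(a, i) (b, j). if i = j then k0 a b else k1 a b)"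

text \<open>The energy of a double cover in terms of its two sheets. With \<open>k1\<close> zero it
  describes two independent copies of the base, so that base and cover share one formalism.\<close>

definition pair_energy ::
    "'a set \<Rightarrow> ('a \<Rightarrow> 'a \<Rightarrow> real) \<Rightarrow> ('a \<Rightarrow> 'a \<Rightarrow> real) \<Rightarrow> 'a set \<Rightarrow> 'a set \<Rightarrow> real" where
  "pair_energy V k0 k1 \<sigma> \<tau> = (\<Sum>a\<in>V. \<Sum>b\<in>V. k0 a b * (spin \<sigma> a * spin \<sigma> b + spin \<tau> a * spin \<tau> b)
      + k1 a b * (spin \<sigma> a * spin \<tau> b + spin \<tau> a * spin \<sigma> b))"

definition pair_avg ::
    "'a set \<Rightarrow> ('a \<Rightarrow> 'a \<Rightarrow> real) \<Rightarrow> ('a \<Rightarrow> 'a \<Rightarrow> real) \<Rightarrow> ('a set \<Rightarrow> 'a set \<Rightarrow> real) \<Rightarrow> real" where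
  "pair_avg V k0 k1 \<Psi> = avg V (\<lambda>\<sigma>. avg V (\<lambda>\<tau>. \<Psi> \<sigma> \<tau> * exp (pair_energy V k0 k1 \<sigma> \<tau>)))"

text \<open>The law of the set \<open>A\<close> of agreement, weighted by a partition function on
  each side. The pair \<open>p\<close>, \<open>p\<close> belongs to two copies of the base, the pair
  \<open>p\<close>, \<open>m\<close> to the cover. It is left unnormalised because the four
  functions theorem compares products of such sums.\<close>

definition mix ::
    "'a set \<Rightarrow> ('a \<Rightarrow> 'a \<Rightarrow> real) \<Rightarrow> ('a \<Rightarrow> 'a \<Rightarrow> real) \<Rightarrow> ('a set \<Rightarrow> real) \<Rightarrow> real" where
  "mix V p m f = (\<Sum>A\<in>Pow V. f A * (zsum A p * zsum (V - A) m))"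

text \<open>The value 0 outside \<open>A\<close> reflects that the sum of two opposite spins
  vanishes; it also makes the function increasing in \<open>A\<close> for ferromagnetic couplings,
  as \<open>mix_fkg\<close> requires.\<close>

definition corr0 :: "'a set \<Rightarrow> ('a \<Rightarrow> 'a \<Rightarrow> real) \<Rightarrow> 'a \<Rightarrow> 'a \<Rightarrow> real" where
  "corr0 A p a b = (if a \<in> A \<and> b \<in> A then corr A p a b else 0)"

section \<open>The double cover as a model of pairs of configurations\<close>

lemma spin_join: "spin (join \<sigma> \<tau>) (a, i) = (if i then spin \<tau> a else spin \<sigma> a)"
  by (auto simp: spin_def join_def)

lemma sum_Times_bool:
  "finite V \<Longrightarrow> (\<Sum>x\<in>V \<times> UNIV. f x) = (\<Sum>a\<in>V. f (a, False) + f (a, True))"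
proof -
  have "(\<Sum>x\<in>V \<times> UNIV. f x) = (\<Sum>a\<in>V. \<Sum>i\<in>UNIV. f (a, i))"
    by (simp add: sum.cartesian_product)
  then show ?thesis
    by (simp add: UNIV_bool add.commute)
qed

lemma energy_join: "finite V \<Longrightarrow> energy (V \<times> UNIV) (lift k0 k1) (join \<sigma> \<tau>) = pair_energy V k0 k1 \<sigma> \<tau>"
  unfolding energy_def pair_energy_def sum.distrib[symmetric]
  by (simp add: sum_Times_bool lift_def spin_join sum.distrib[symmetric])
    (intro sum.cong refl, simp add: algebra_simps)

lemma avg_Times_bool:
  assumes "finite V"
  shows "avg (V \<times> UNIV) f = avg V (\<lambda>\<sigma>. avg V (\<lambda>\<tau>. f (join \<sigma> \<tau>)))"
proof -
  have "(\<Sum>\<Omega>\<in>Pow (V \<times> UNIV). f \<Omega>) = (\<Sum>(\<sigma>, \<tau>)\<in>Pow V \<times> Pow V. f (join \<sigma> \<tau>))"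
  proof (rule sum.reindex_bij_witness[where i = "\<lambda>(\<sigma>, \<tau>). join \<sigma> \<tau>"
        and j = "\<lambda>\<Omega>. ({a. (a, False) \<in> \<Omega>}, {a. (a, True) \<in> \<Omega>})"])
    have eq: "join {a. (a, False) \<in> \<Omega>} {a. (a, True) \<in> \<Omega>} = \<Omega>" for \<Omega> :: "('a \<times> bool) set"
    proof (rule set_eqI)
      fix x :: "'a \<times> bool"
      show "x \<in> join {a. (a, False) \<in> \<Omega>} {a. (a, True) \<in> \<Omega>} \<longleftrightarrow> x \<in> \<Omega>"
        by (cases x; cases "snd x") (auto simp: join_def)
    qed
    show "(case ({a. (a, False) \<in> \<Omega>}, {a. (a, True) \<in> \<Omega>}) of (\<sigma>, \<tau>) \<Rightarrow> join \<sigma> \<tau>) = \<Omega>" for \<Omega> :: "('a \<times> bool) set"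
      by (simp add: eq)
    show "(case ({a. (a, False) \<in> \<Omega>}, {a. (a, True) \<in> \<Omega>}) of (\<sigma>, \<tau>) \<Rightarrow> f (join \<sigma> \<tau>)) = f \<Omega>" for \<Omega> :: "('a \<times> bool) set"
      by (simp add: eq)
  qed (auto simp: join_def)
  also have "\<dots> = (\<Sum>\<sigma>\<in>Pow V. \<Sum>\<tau>\<in>Pow V. f (join \<sigma> \<tau>))"
    by (simp add: sum.cartesian_product)
  finally show ?thesis
    using assms by (simp add: avg_def card_cartesian_product mult.commute[of _ 2] mult_2 power_add
        sum_divide_distrib)
qed

lemma wavg_lift:
  assumes "finite V"
  shows "wavg (V \<times> UNIV) (lift k0 k1) \<Phi> = pair_avg V k0 k1 (\<lambda>\<sigma> \<tau>. \<Phi> (join \<sigma> \<tau>))"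
  using assms by (simp add: wavg_def avg_Times_bool pair_avg_def energy_join)

lemma pair_avg_prod: "pair_avg V k (\<lambda>_ _. 0) (\<lambda>\<sigma> \<tau>. f \<sigma> * g \<tau>) = wavg V k f * wavg V k g"
proof -
  have "pair_energy V k (\<lambda>_ _. 0) \<sigma> \<tau> = energy V k \<sigma> + energy V k \<tau>" for \<sigma> \<tau>
    by (simp add: pair_energy_def energy_def sum.distrib algebra_simps)
  then have "pair_avg V k (\<lambda>_ _. 0) (\<lambda>\<sigma> \<tau>. f \<sigma> * g \<tau>)
      = avg V (\<lambda>\<sigma>. wavg V k g * (f \<sigma> * exp (energy V k \<sigma>)))"
    by (simp add: pair_avg_def wavg_def exp_add avg_cmult[symmetric] algebra_simps)
  then show ?thesis
    by (simp add: avg_cmult wavg_def)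
qed

lemma pair_avg_add:
  "pair_avg V k0 k1 (\<lambda>\<sigma> \<tau>. f \<sigma> \<tau> + g \<sigma> \<tau>) = pair_avg V k0 k1 f + pair_avg V k0 k1 g"
  by (simp add: pair_avg_def avg_add[symmetric] distrib_right)

lemma pair_avg_diff:
  "pair_avg V k0 k1 (\<lambda>\<sigma> \<tau>. f \<sigma> \<tau> - g \<sigma> \<tau>) = pair_avg V k0 k1 f - pair_avg V k0 k1 g"
  by (simp add: pair_avg_def avg_diff[symmetric] left_diff_distrib)

text \<open>On \<open>A\<close> the two spins agree and all terms add up; on the complement they are
  opposite, so the terms in \<open>k1\<close> change sign; between \<open>A\<close> and its
  complement everything cancels.\<close>

lemma pair_energy_sym_diff:
  assumes "finite V" "A \<subseteq> V"
  shows "pair_energy V k0 k1 \<sigma> (sym_diff \<sigma> (V - A))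
    = energy A (\<lambda>a b. 2 * (k0 a b + k1 a b)) \<sigma> + energy (V - A) (\<lambda>a b. 2 * (k0 a b - k1 a b)) \<sigma>"
proof -
  let ?p = "\<lambda>a b. 2 * (k0 a b + k1 a b)" and ?m = "\<lambda>a b. 2 * (k0 a b - k1 a b)"
  have "pair_energy V k0 k1 \<sigma> (sym_diff \<sigma> (V - A))
      = energy V (\<lambda>a b. (if a \<in> A \<and> b \<in> A then ?p a b else 0)
          + (if a \<in> V - A \<and> b \<in> V - A then ?m a b else 0)) \<sigma>"
    unfolding pair_energy_def energy_def
    by (intro sum.cong refl) (auto simp: spin_sym_diff algebra_simps)
  also have "\<dots> = energy A ?p \<sigma> + energy (V - A) ?m \<sigma>"
    unfolding energy_add using assms by (simp only: energy_restrict Diff_subset)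
  finally show ?thesis .
qed

(* The decomposition according to the set A where the two configurations agree. *)
lemma pair_avg_mix:
  assumes "finite V" "p = (\<lambda>a b. 2 * (k0 a b + k1 a b))" "m = (\<lambda>a b. 2 * (k0 a b - k1 a b))"
    and \<Psi>: "\<And>A \<sigma>. A \<subseteq> V \<Longrightarrow> \<sigma> \<subseteq> V \<Longrightarrow>
      \<Psi> \<sigma> (sym_diff \<sigma> (V - A)) = F A (\<sigma> \<inter> A) * G A (\<sigma> \<inter> (V - A))"
    and f: "\<And>A. A \<subseteq> V \<Longrightarrow> wavg A p (F A) = f A * zsum A p"
    and g: "\<And>A. A \<subseteq> V \<Longrightarrow> wavg (V - A) m (G A) = g A * zsum (V - A) m"
  shows "pair_avg V k0 k1 \<Psi> = mix V p m (\<lambda>A. f A * g A) / 2 ^ card V"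
proof -
  define H where "H D = avg V (\<lambda>\<sigma>. \<Psi> \<sigma> (sym_diff \<sigma> D) * exp (pair_energy V k0 k1 \<sigma> (sym_diff \<sigma> D)))" for D
  have HA: "H (V - A) = f A * g A * (zsum A p * zsum (V - A) m)" if A: "A \<subseteq> V" for A
  proof -
    have "H (V - A) = avg V (\<lambda>\<sigma>. (F A (\<sigma> \<inter> A) * exp (energy A p (\<sigma> \<inter> A)))
        * (G A (\<sigma> \<inter> (V - A)) * exp (energy (V - A) m (\<sigma> \<inter> (V - A)))))"
      unfolding H_def
    proof (rule avg_cong)
      fix \<sigma> assume \<sigma>: "\<sigma> \<subseteq> V"
      show "\<Psi> \<sigma> (sym_diff \<sigma> (V - A)) * exp (pair_energy V k0 k1 \<sigma> (sym_diff \<sigma> (V - A)))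
          = (F A (\<sigma> \<inter> A) * exp (energy A p (\<sigma> \<inter> A)))
            * (G A (\<sigma> \<inter> (V - A)) * exp (energy (V - A) m (\<sigma> \<inter> (V - A))))"
        unfolding \<Psi>[OF A \<sigma>] pair_energy_sym_diff[OF assms(1) A] assms(2,3)[symmetric] exp_add
        by (simp add: energy_Int)
    qed
    also have "\<dots> = wavg A p (F A) * wavg (V - A) m (G A)"
      unfolding wavg_def by (rule avg_indep[OF assms(1) A])
    finally show ?thesis
      using A by (simp add: f g)
  qed
  have "pair_avg V k0 k1 \<Psi> = avg V H"
    unfolding pair_avg_def H_def by (rule avg_pair_shift)
  also have "(\<Sum>D\<in>Pow V. H D) = (\<Sum>A\<in>Pow V. H (V - A))"
    by (rule sum.reindex_bij_witness[where i = "\<lambda>A. V - A" and j = "\<lambda>A. V - A"])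
      (auto simp: double_diff)
  then have "avg V H = mix V p m (\<lambda>A. f A * g A) / 2 ^ card V"
    by (simp add: avg_def mix_def HA)
  finally show ?thesis .
qed

lemma wavg_const: "wavg A p (\<lambda>_. c) = c * zsum A p"
  by (simp add: wavg_def zsum_def avg_cmult)

lemma wavg_corr0:
  assumes "finite A"
  shows "wavg A p (\<lambda>\<sigma>. if a \<in> A \<and> b \<in> A then spin \<sigma> a * spin \<sigma> b else 0) = corr0 A p a b * zsum A p"
proof (cases "a \<in> A \<and> b \<in> A")
  case True
  then show ?thesis
    using two_eq_corr[OF assms, of p a b] by (simp add: corr0_def two_def)
qed (auto simp: corr0_def wavg_const)

lemma wavg_corr0_scaled:
  assumes "finite A"
  shows "wavg A p (\<lambda>\<sigma>. c * (if a \<in> A \<and> b \<in> A then spin \<sigma> a * spin \<sigma> b else 0)) = c * corr0 A p a b * zsum A p"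
  using wavg_corr0[OF assms, of p a b] by (simp add: wavg_def avg_cmult mult.assoc)

lemma mix_cmult: "mix V p m (\<lambda>A. c * f A) = c * mix V p m f"
  by (simp add: mix_def sum_distrib_left mult.assoc)

text \<open>With equal couplings on both sides the law is symmetric: flipping one of two independent
  copies exchanges agreement and disagreement.\<close>

lemma mix_swap: "mix V p p f = mix V p p (\<lambda>A. f (V - A))"
  unfolding mix_def
  by (rule sum.reindex_bij_witness[where i = "\<lambda>A. V - A" and j = "\<lambda>A. V - A"])
    (auto simp: double_diff)

lemma mix_one_pos: "finite V \<Longrightarrow> 0 < mix V p m (\<lambda>_. 1)"
  unfolding mix_def by (intro sum_pos) (auto intro!: mult_pos_pos zsum_pos intro: finite_subset)

lemma zsum_lift:
  assumes "finite V" "p = (\<lambda>a b. 2 * (k0 a b + k1 a b))" "m = (\<lambda>a b. 2 * (k0 a b - k1 a b))"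
  shows "zsum (V \<times> UNIV) (lift k0 k1) = mix V p m (\<lambda>_. 1) / 2 ^ card V"
proof -
  have "pair_avg V k0 k1 (\<lambda>_ _. 1) = mix V p m (\<lambda>A. 1 * 1) / 2 ^ card V"
    by (rule pair_avg_mix[OF assms, where F = "\<lambda>_ _. 1" and G = "\<lambda>_ _. 1"]) (simp_all add: wavg_const)
  then show ?thesis
    using assms(1) by (simp add: zsum_def wavg_lift)
qed

text \<open>The sum of the two spins at a vertex is 0 where they disagree and twice the spin where
  they agree. Only the sets \<open>A\<close> containing \<open>a\<close> and \<open>b\<close>
  survive, and the two factors of 2 give the 4.\<close>

lemma pair_avg_sum_sum:
  assumes "finite V" "p = (\<lambda>a b. 2 * (k0 a b + k1 a b))" "m = (\<lambda>a b. 2 * (k0 a b - k1 a b))"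
    "a \<in> V" "b \<in> V"
  shows "pair_avg V k0 k1 (\<lambda>\<sigma> \<tau>. (spin \<sigma> a + spin \<tau> a) * (spin \<sigma> b + spin \<tau> b))
    = 4 * mix V p m (\<lambda>A. corr0 A p a b) / 2 ^ card V"
proof -
  have "pair_avg V k0 k1 (\<lambda>\<sigma> \<tau>. (spin \<sigma> a + spin \<tau> a) * (spin \<sigma> b + spin \<tau> b))
    = mix V p m (\<lambda>A. 4 * corr0 A p a b * 1) / 2 ^ card V"
  proof (rule pair_avg_mix[OF assms(1-3),
        where F = "\<lambda>A \<sigma>. 4 * (if a \<in> A \<and> b \<in> A then spin \<sigma> a * spin \<sigma> b else 0)" and G = "\<lambda>_ _. 1"])
    show "wavg A p (\<lambda>\<sigma>. 4 * (if a \<in> A \<and> b \<in> A then spin \<sigma> a * spin \<sigma> b else 0))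
        = 4 * corr0 A p a b * zsum A p" if "A \<subseteq> V" for A
      using that assms(1) finite_subset by (intro wavg_corr0_scaled) blast
  qed (use assms(4,5) in \<open>auto simp: spin_sym_diff spin_Int wavg_const algebra_simps\<close>)
  then show ?thesis
    using mix_cmult[of V p m 4 "\<lambda>A. corr0 A p a b"] by simp
qed

lemma wavg_sum: "wavg V k (\<lambda>\<sigma>. \<Sum>i\<in>I. f i \<sigma>) = (\<Sum>i\<in>I. wavg V k (f i))"
  by (simp add: wavg_def sum_distrib_right avg_sum)

lemma sum_two_lift:
  assumes "finite V" "p = (\<lambda>a b. 2 * (k0 a b + k1 a b))" "m = (\<lambda>a b. 2 * (k0 a b - k1 a b))"
    "a \<in> V" "b \<in> V"
  shows "(\<Sum>i\<in>UNIV. \<Sum>j\<in>UNIV. two (V \<times> UNIV) (lift k0 k1) (a, i) (b, j))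
    = 4 * mix V p m (\<lambda>A. corr0 A p a b) / 2 ^ card V"
proof -
  have "(\<Sum>i\<in>UNIV. \<Sum>j\<in>UNIV. two (V \<times> UNIV) (lift k0 k1) (a, i) (b, j))
      = pair_avg V k0 k1 (\<lambda>\<sigma> \<tau>. \<Sum>i\<in>UNIV. \<Sum>j\<in>UNIV. spin (join \<sigma> \<tau>) (a, i) * spin (join \<sigma> \<tau>) (b, j))"
    unfolding two_def wavg_sum[symmetric] using assms(1) by (rule wavg_lift)
  also have "\<dots> = pair_avg V k0 k1 (\<lambda>\<sigma> \<tau>. (spin \<sigma> a + spin \<tau> a) * (spin \<sigma> b + spin \<tau> b))"
    by (simp add: UNIV_bool spin_join algebra_simps)
  finally show ?thesis
    using pair_avg_sum_sum[OF assms] by simp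
qed

lemma sum_corr_lift:
  assumes "finite V" "p = (\<lambda>a b. 2 * (k0 a b + k1 a b))" "m = (\<lambda>a b. 2 * (k0 a b - k1 a b))"
    "a \<in> V" "b \<in> V"
  shows "(\<Sum>i\<in>UNIV. \<Sum>j\<in>UNIV. corr (V \<times> UNIV) (lift k0 k1) (a, i) (b, j))
    = 4 * mix V p m (\<lambda>A. corr0 A p a b) / mix V p m (\<lambda>_. 1)"
  unfolding corr_def sum_divide_distrib[symmetric] sum_two_lift[OF assms] zsum_lift[OF assms(1-3)]
  by simp

lemma corr_lift_fibre:
  assumes "finite V" "p = (\<lambda>a b. 2 * (k0 a b + k1 a b))" "m = (\<lambda>a b. 2 * (k0 a b - k1 a b))" "y \<in> V"
  shows "corr (V \<times> UNIV) (lift k0 k1) (y, False) (y, True)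
    = mix V p m (\<lambda>A. if y \<in> A then 1 else - 1) / mix V p m (\<lambda>_. 1)"
proof -
  have "pair_avg V k0 k1 (\<lambda>\<sigma> \<tau>. spin \<sigma> y * spin \<tau> y)
      = mix V p m (\<lambda>A. (if y \<in> A then 1 else - 1) * 1) / 2 ^ card V"
    by (rule pair_avg_mix[OF assms(1-3), where F = "\<lambda>A _. if y \<in> A then 1 else - 1" and G = "\<lambda>_ _. 1"])
      (use assms(4) in \<open>auto simp: wavg_const spin_sym_diff\<close>)
  then show ?thesis
    using assms(1) by (simp add: corr_def two_def wavg_lift spin_join zsum_lift[OF assms(1-3)])
qed

text \<open>The product of the two spins over \<open>y\<close> is 1 if \<open>y\<close> lies in
  \<open>A\<close> and -1 otherwise. The four-point function of the cover thus tests on which side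
  \<open>y\<close> lies, which is how the weight of the clusters through \<open>y\<close> is
  detected later.\<close>

lemma sum_four_lift:
  assumes "finite V" "p = (\<lambda>a b. 2 * (k0 a b + k1 a b))" "m = (\<lambda>a b. 2 * (k0 a b - k1 a b))"
    "a \<in> V" "b \<in> V" "y \<in> V"
  shows "(\<Sum>i\<in>UNIV. \<Sum>j\<in>UNIV. wavg (V \<times> UNIV) (lift k0 k1)
      (\<lambda>\<Omega>. spin \<Omega> (a, i) * spin \<Omega> (b, j) * spin \<Omega> (y, False) * spin \<Omega> (y, True)))
    = 4 * mix V p m (\<lambda>A. corr0 A p a b * (if y \<in> A then 1 else - 1)) / 2 ^ card V"
proof -
  let ?e = "\<lambda>A. if y \<in> A then 1 else - 1 :: real"
  have "(\<Sum>i\<in>UNIV. \<Sum>j\<in>UNIV. wavg (V \<times> UNIV) (lift k0 k1)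
      (\<lambda>\<Omega>. spin \<Omega> (a, i) * spin \<Omega> (b, j) * spin \<Omega> (y, False) * spin \<Omega> (y, True)))
      = pair_avg V k0 k1 (\<lambda>\<sigma> \<tau>. \<Sum>i\<in>UNIV. \<Sum>j\<in>UNIV. spin (join \<sigma> \<tau>) (a, i) * spin (join \<sigma> \<tau>) (b, j)
          * spin (join \<sigma> \<tau>) (y, False) * spin (join \<sigma> \<tau>) (y, True))"
    unfolding wavg_sum[symmetric] using assms(1) by (rule wavg_lift)
  also have "\<dots> = pair_avg V k0 k1
      (\<lambda>\<sigma> \<tau>. (spin \<sigma> a + spin \<tau> a) * (spin \<sigma> b + spin \<tau> b) * (spin \<sigma> y * spin \<tau> y))"
    by (simp add: UNIV_bool spin_join algebra_simps)
  also have "\<dots> = mix V p m (\<lambda>A. (4 * ?e A) * corr0 A p a b * 1) / 2 ^ card V"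
  proof (rule pair_avg_mix[OF assms(1-3), where G = "\<lambda>_ _. 1"
        and F = "\<lambda>A \<sigma>. (4 * ?e A) * (if a \<in> A \<and> b \<in> A then spin \<sigma> a * spin \<sigma> b else 0)"])
    show "wavg A p (\<lambda>\<sigma>. (4 * ?e A) * (if a \<in> A \<and> b \<in> A then spin \<sigma> a * spin \<sigma> b else 0))
        = (4 * ?e A) * corr0 A p a b * zsum A p" if "A \<subseteq> V" for A
      using that assms(1) finite_subset by (intro wavg_corr0_scaled) blast
  qed (use assms(4-6) in \<open>auto simp: spin_sym_diff spin_Int wavg_const algebra_simps\<close>)
  also have "(\<lambda>A. (4 * ?e A) * corr0 A p a b * 1) = (\<lambda>A. 4 * (corr0 A p a b * ?e A))"
    by auto
  finally show ?thesis
    by (simp add: mix_cmult)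
qed

lemma wavg_spin_eq_0:
  assumes "a \<in> V"
  shows "wavg V k (\<lambda>\<sigma>. spin \<sigma> a) = 0"
proof -
  have "energy V k (sym_diff \<sigma> V) = energy V k \<sigma>" for \<sigma>
    unfolding energy_def by (intro sum.cong refl) (simp add: spin_sym_diff)
  then have "avg V (\<lambda>\<sigma>. spin (sym_diff \<sigma> V) a * exp (energy V k (sym_diff \<sigma> V)))
      = - wavg V k (\<lambda>\<sigma>. spin \<sigma> a)"
    using assms avg_cmult[of V "- 1" "\<lambda>\<sigma>. spin \<sigma> a * exp (energy V k \<sigma>)"]
    by (simp add: spin_sym_diff wavg_def)
  then show ?thesis
    using avg_shift[of V V "\<lambda>\<sigma>. spin \<sigma> a * exp (energy V k \<sigma>)"] by (simp add: wavg_def)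
qed

lemma zsum_sq_eq_mix:
  assumes "finite V" "p = (\<lambda>a b. 2 * k a b)"
  shows "zsum V k * zsum V k = mix V p p (\<lambda>_. 1) / 2 ^ card V"
proof -
  have "pair_avg V k (\<lambda>_ _. 0) (\<lambda>_ _. 1 * 1) = mix V p p (\<lambda>A. 1 * 1) / 2 ^ card V"
    by (rule pair_avg_mix[where F = "\<lambda>_ _. 1" and G = "\<lambda>_ _. 1"]) (simp_all add: wavg_const assms)
  then show ?thesis
    unfolding pair_avg_prod by (simp add: zsum_def)
qed

text \<open>In two independent copies the cross terms vanish by spin flip and the two diagonal terms
  are equal. Up to the factor 2 this is the right-hand side of \<open>sum_corr_lift\<close> with
  \<open>m\<close> replaced by \<open>p\<close>.\<close>

lemma corr_eq_mix:
  assumes "finite V" "p = (\<lambda>a b. 2 * k a b)" "a \<in> V" "b \<in> V"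
  shows "corr V k a b = 2 * mix V p p (\<lambda>A. corr0 A p a b) / mix V p p (\<lambda>_. 1)"
proof -
  have "(\<lambda>\<sigma> \<tau>. (spin \<sigma> a + spin \<tau> a) * (spin \<sigma> b + spin \<tau> b)) = (\<lambda>\<sigma> \<tau>. (spin \<sigma> a * spin \<sigma> b) * 1
      + spin \<sigma> a * spin \<tau> b + spin \<sigma> b * spin \<tau> a + 1 * (spin \<tau> a * spin \<tau> b))"
    by (auto simp: algebra_simps)
  then have "pair_avg V k (\<lambda>_ _. 0) (\<lambda>\<sigma> \<tau>. (spin \<sigma> a + spin \<tau> a) * (spin \<sigma> b + spin \<tau> b))
      = 2 * (two V k a b * zsum V k)"
    using assms by (simp only: pair_avg_add pair_avg_prod) (simp add: wavg_spin_eq_0 two_def zsum_def)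
  then have "two V k a b * zsum V k = 2 * mix V p p (\<lambda>A. corr0 A p a b) / 2 ^ card V"
    using pair_avg_sum_sum[of V p k "\<lambda>_ _. 0" p a b] assms by simp
  then have "corr V k a b * (zsum V k * zsum V k) = 2 * mix V p p (\<lambda>A. corr0 A p a b) / 2 ^ card V"
    using assms(1) by (simp add: corr_def)
  then show ?thesis
    unfolding zsum_sq_eq_mix[OF assms(1,2)] using mix_one_pos[OF assms(1), of p p]
    by (simp add: field_simps)
qed

section \<open>Consequences of the four functions theorem\<close>

lemma corr0_nonneg:
  "finite A \<Longrightarrow> (\<And>a b. a \<in> A \<Longrightarrow> b \<in> A \<Longrightarrow> 0 \<le> p a b) \<Longrightarrow> 0 \<le> corr0 A p a b"
  by (simp add: corr0_def corr_nonneg)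

lemma corr0_mono:
  assumes "finite B" "\<And>a b. a \<in> B \<Longrightarrow> b \<in> B \<Longrightarrow> 0 \<le> p a b" "A \<subseteq> B"
  shows "corr0 A p a b \<le> corr0 B p a b"
  using assms corr_subset_mono[of B p A a b] corr0_nonneg[of B p a b]
  by (auto simp: corr0_def subset_iff split: if_splits)

text \<open>Replacing \<open>p\<close> by the weaker \<open>m\<close> on the complement favours
  large \<open>A\<close>. The hypothesis of \<open>four_functions\<close> is the product of
  \<open>zsum_supermodular\<close> for \<open>A\<close>, \<open>B\<close> and of its version for the
  complements, where the two couplings differ.\<close>

lemma mix_fkg:
  assumes "finite U" and pm: "\<And>a b. a \<in> U \<Longrightarrow> b \<in> U \<Longrightarrow> \<bar>m a b\<bar> \<le> p a b"
    and f: "\<And>A. A \<subseteq> U \<Longrightarrow> 0 \<le> f A" "\<And>A B. A \<subseteq> B \<Longrightarrow> B \<subseteq> U \<Longrightarrow> f A \<le> f B"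
  shows "mix U p p f * mix U p m (\<lambda>_. 1) \<le> mix U p m f * mix U p p (\<lambda>_. 1)"
  unfolding mix_def
proof (rule four_functions[OF assms(1)])
  fix A B assume AB: "A \<subseteq> U" "B \<subseteq> U"
  have fin: "finite X" if "X \<subseteq> U" for X
    using that assms(1) finite_subset by blast
  have Z: "0 \<le> zsum X k" if "X \<subseteq> U" for X k
    using zsum_pos[OF fin[OF that], of k] by simp
  have pp: "\<bar>p a b\<bar> \<le> p a b" if "a \<in> U" "b \<in> U" for a b
    using pm[OF that] by linarith
  have 1: "zsum A p * zsum B p \<le> zsum (A \<union> B) p * zsum (A \<inter> B) p"
    by (rule zsum_supermodular[OF assms(1) pp AB])
  have "zsum (U - A) p * zsum (U - B) m
      \<le> zsum ((U - A) \<union> (U - B)) p * zsum ((U - A) \<inter> (U - B)) m"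
    by (rule zsum_supermodular[OF assms(1) pm]) auto
  then have 2: "zsum (U - A) p * zsum (U - B) m \<le> zsum (U - A \<inter> B) p * zsum (U - (A \<union> B)) m"
    by (simp add: Diff_Int Diff_Un)
  have 3: "f A \<le> f (A \<union> B)"
    using AB by (intro f(2)) auto
  have "f A * ((zsum A p * zsum B p) * (zsum (U - A) p * zsum (U - B) m))
      \<le> f (A \<union> B) * ((zsum (A \<union> B) p * zsum (A \<inter> B) p)
          * (zsum (U - A \<inter> B) p * zsum (U - (A \<union> B)) m))"
    using AB by (intro mult_mono 1 2 3 f(1) mult_nonneg_nonneg Z) auto
  then show "f A * (zsum A p * zsum (U - A) p) * (1 * (zsum B p * zsum (U - B) m))
      \<le> f (A \<union> B) * (zsum (A \<union> B) p * zsum (U - (A \<union> B)) m)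
        * (1 * (zsum (A \<inter> B) p * zsum (U - A \<inter> B) p))"
    by (simp add: mult_ac)
next
  have Z: "0 \<le> zsum X k" if "X \<subseteq> U" for X k
    using zsum_pos[of X k] finite_subset[OF that assms(1)] by simp
  show "0 \<le> f A * (zsum A p * zsum (U - A) p)" "0 \<le> 1 * (zsum A p * zsum (U - A) m)"
    "0 \<le> f A * (zsum A p * zsum (U - A) m)" "0 \<le> 1 * (zsum A p * zsum (U - A) p)" if "A \<subseteq> U" for A
    using that by (auto intro!: mult_nonneg_nonneg f(1) Z)
qed

text \<open>By supermodularity of the partition function the law of \<open>A\<close> is positively
  associated, and \<open>h\<close> of the complement decreases in \<open>A\<close>.\<close>

lemma mix_negative_correlation:
  assumes "finite U" and p: "\<And>a b. a \<in> U \<Longrightarrow> b \<in> U \<Longrightarrow> 0 \<le> p a b"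
    and f: "\<And>A. A \<subseteq> U \<Longrightarrow> 0 \<le> f A" "\<And>A B. A \<subseteq> B \<Longrightarrow> B \<subseteq> U \<Longrightarrow> f A \<le> f B"
    and h: "\<And>A. A \<subseteq> U \<Longrightarrow> 0 \<le> h A" "\<And>A B. A \<subseteq> B \<Longrightarrow> B \<subseteq> U \<Longrightarrow> h A \<le> h B"
  shows "mix U p p (\<lambda>A. f A * h (U - A)) * mix U p p (\<lambda>_. 1)
    \<le> mix U p p f * mix U p p (\<lambda>A. h (U - A))"
  unfolding mix_def
proof (rule four_functions[OF assms(1)])
  fix A B assume AB: "A \<subseteq> U" "B \<subseteq> U"
  have Z: "0 \<le> zsum X k" if "X \<subseteq> U" for X k
    using zsum_pos[of X k] finite_subset[OF that assms(1)] by simp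
  have pp: "\<bar>p a b\<bar> \<le> p a b" if "a \<in> U" "b \<in> U" for a b
    using p[OF that] by linarith
  have 1: "zsum A p * zsum B p \<le> zsum (A \<union> B) p * zsum (A \<inter> B) p"
    by (rule zsum_supermodular[OF assms(1) pp AB])
  have "zsum (U - A) p * zsum (U - B) p
      \<le> zsum ((U - A) \<union> (U - B)) p * zsum ((U - A) \<inter> (U - B)) p"
    by (rule zsum_supermodular[OF assms(1) pp]) auto
  then have 2: "zsum (U - A) p * zsum (U - B) p \<le> zsum (U - A \<inter> B) p * zsum (U - (A \<union> B)) p"
    by (simp add: Diff_Int Diff_Un)
  have 3: "f A \<le> f (A \<union> B)" "h (U - A) \<le> h (U - A \<inter> B)"
    using AB by (auto intro!: f(2) h(2))
  have "(f A * h (U - A)) * ((zsum A p * zsum B p) * (zsum (U - A) p * zsum (U - B) p))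
      \<le> (f (A \<union> B) * h (U - A \<inter> B)) * ((zsum (A \<union> B) p * zsum (A \<inter> B) p)
          * (zsum (U - A \<inter> B) p * zsum (U - (A \<union> B)) p))"
    using AB by (intro mult_mono 1 2 3 f(1) h(1) mult_nonneg_nonneg Z) auto
  then show "f A * h (U - A) * (zsum A p * zsum (U - A) p) * (1 * (zsum B p * zsum (U - B) p))
      \<le> f (A \<union> B) * (zsum (A \<union> B) p * zsum (U - (A \<union> B)) p)
        * (h (U - A \<inter> B) * (zsum (A \<inter> B) p * zsum (U - A \<inter> B) p))"
    by (simp add: mult_ac)
next
  have Z: "0 \<le> zsum X k" if "X \<subseteq> U" for X k
    using zsum_pos[of X k] finite_subset[OF that assms(1)] by simp
  show "0 \<le> f A * h (U - A) * (zsum A p * zsum (U - A) p)" "0 \<le> 1 * (zsum A p * zsum (U - A) p)"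
    "0 \<le> f A * (zsum A p * zsum (U - A) p)" "0 \<le> h (U - A) * (zsum A p * zsum (U - A) p)"
    if "A \<subseteq> U" for A
    using that by (auto intro!: mult_nonneg_nonneg f(1) h(1) Z)
qed

(* Lebowitz' inequality: the left-hand side of the four-point expansion is the mixed average of
   corr0 A a b * corr0 (V - A) c d. *)
theorem lebowitz:
  assumes "finite V" and k: "\<And>a b. a \<in> V \<Longrightarrow> b \<in> V \<Longrightarrow> 0 \<le> k a b"
    and abcd: "a \<in> V" "b \<in> V" "c \<in> V" "d \<in> V"
  shows "wavg V k (\<lambda>\<sigma>. spin \<sigma> a * spin \<sigma> b * spin \<sigma> c * spin \<sigma> d) / zsum V k
    \<le> corr V k a b * corr V k c d + corr V k a c * corr V k b d + corr V k a d * corr V k b c"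
proof -
  define p where "p = (\<lambda>a b. 2 * k a b)"
  have p: "0 \<le> p a b" if "a \<in> V" "b \<in> V" for a b
    using k[OF that] by (simp add: p_def)
  have fin: "finite A" if "A \<subseteq> V" for A
    using that assms(1) finite_subset by blast
  let ?W = "wavg V k (\<lambda>\<sigma>. spin \<sigma> a * spin \<sigma> b * spin \<sigma> c * spin \<sigma> d)"
  \<comment> \<open>Nonzero only if \<open>a\<close> and \<open>b\<close> lie in the set of
    agreement and \<open>c\<close> and \<open>d\<close> in its complement, where each bracket is
    twice a spin.\<close>
  let ?\<Psi> = "\<lambda>\<sigma> \<tau>. (spin \<sigma> a + spin \<tau> a) * (spin \<sigma> b + spin \<tau> b) * ((spin \<sigma> c - spin \<tau> c) * (spin \<sigma> d - spin \<tau> d))"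
  let ?g = "\<lambda>a b. mix V p p (\<lambda>A. corr0 A p a b)" and ?g' = "\<lambda>a b. mix V p p (\<lambda>A. corr0 (V - A) p a b)"
  let ?M = "mix V p p (\<lambda>_. 1)"
  have M: "0 < ?M"
    using assms(1) by (rule mix_one_pos)
  \<comment> \<open>A factor with a single spin of one copy averages to 0; what remains are the
    four-point functions and the products of two-point functions.\<close>
  have "?\<Psi> = (\<lambda>\<sigma> \<tau>. (spin \<sigma> a * spin \<sigma> b * spin \<sigma> c * spin \<sigma> d) * 1
      - (spin \<sigma> a * spin \<sigma> b * spin \<sigma> c) * spin \<tau> d - (spin \<sigma> a * spin \<sigma> b * spin \<sigma> d) * spin \<tau> c
      + (spin \<sigma> a * spin \<sigma> b) * (spin \<tau> c * spin \<tau> d) + (spin \<sigma> a * spin \<sigma> c * spin \<sigma> d) * spin \<tau> b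
      - (spin \<sigma> a * spin \<sigma> c) * (spin \<tau> b * spin \<tau> d) - (spin \<sigma> a * spin \<sigma> d) * (spin \<tau> b * spin \<tau> c)
      + spin \<sigma> a * (spin \<tau> b * spin \<tau> c * spin \<tau> d) + (spin \<sigma> b * spin \<sigma> c * spin \<sigma> d) * spin \<tau> a
      - (spin \<sigma> b * spin \<sigma> c) * (spin \<tau> a * spin \<tau> d) - (spin \<sigma> b * spin \<sigma> d) * (spin \<tau> a * spin \<tau> c)
      + spin \<sigma> b * (spin \<tau> a * spin \<tau> c * spin \<tau> d) + (spin \<sigma> c * spin \<sigma> d) * (spin \<tau> a * spin \<tau> b)
      - spin \<sigma> c * (spin \<tau> a * spin \<tau> b * spin \<tau> d) - spin \<sigma> d * (spin \<tau> a * spin \<tau> b * spin \<tau> c)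
      + 1 * (spin \<tau> a * spin \<tau> b * spin \<tau> c * spin \<tau> d))"
    by (intro ext) (simp add: algebra_simps)
  then have "pair_avg V k (\<lambda>_ _. 0) ?\<Psi> = 2 * (?W * zsum V k + two V k a b * two V k c d
      - two V k a c * two V k b d - two V k a d * two V k b c)"
    using abcd by (simp only: pair_avg_add pair_avg_diff pair_avg_prod wavg_spin_eq_0)
      (simp add: two_def zsum_def)
  moreover have "pair_avg V k (\<lambda>_ _. 0) ?\<Psi>
      = mix V p p (\<lambda>A. 4 * corr0 A p a b * (4 * corr0 (V - A) p c d)) / 2 ^ card V"
  proof (rule pair_avg_mix[OF assms(1),
        where F = "\<lambda>A \<sigma>. 4 * (if a \<in> A \<and> b \<in> A then spin \<sigma> a * spin \<sigma> b else 0)"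
        and G = "\<lambda>A \<sigma>. 4 * (if c \<in> V - A \<and> d \<in> V - A then spin \<sigma> c * spin \<sigma> d else 0)"])
    show "wavg A p (\<lambda>\<sigma>. 4 * (if a \<in> A \<and> b \<in> A then spin \<sigma> a * spin \<sigma> b else 0))
        = 4 * corr0 A p a b * zsum A p" if "A \<subseteq> V" for A
      using fin[OF that] by (rule wavg_corr0_scaled)
    show "wavg (V - A) p (\<lambda>\<sigma>. 4 * (if c \<in> V - A \<and> d \<in> V - A then spin \<sigma> c * spin \<sigma> d else 0))
        = 4 * corr0 (V - A) p c d * zsum (V - A) p" for A
      using assms(1) by (intro wavg_corr0_scaled) simp
    fix A \<sigma> assume "A \<subseteq> V"
    show "?\<Psi> \<sigma> (sym_diff \<sigma> (V - A)) = 4 * (if a \<in> A \<and> b \<in> A then spin (\<sigma> \<inter> A) a * spin (\<sigma> \<inter> A) b else 0)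
       * (4 * (if c \<in> V - A \<and> d \<in> V - A then spin (\<sigma> \<inter> (V - A)) c * spin (\<sigma> \<inter> (V - A)) d else 0))"
      using abcd unfolding spin_sym_diff by (cases "a \<in> A"; cases "b \<in> A"; cases "c \<in> A"; cases "d \<in> A") (auto simp: spin_Int)
  qed (simp_all add: p_def)
  moreover have "(\<lambda>A. 4 * corr0 A p a b * (4 * corr0 (V - A) p c d))
      = (\<lambda>A. 16 * (corr0 A p a b * corr0 (V - A) p c d))"
    by auto
  ultimately have eq: "?W * zsum V k + two V k a b * two V k c d
      - two V k a c * two V k b d - two V k a d * two V k b c
      = 8 * mix V p p (\<lambda>A. corr0 A p a b * corr0 (V - A) p c d) / 2 ^ card V"
    by (simp add: mix_cmult)
  have "mix V p p (\<lambda>A. corr0 A p a b * corr0 (V - A) p c d) * ?M \<le> ?g a b * ?g' c d"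
    using corr0_nonneg[of _ p] corr0_mono[of _ p] fin p
    by (intro mix_negative_correlation[OF assms(1)]) (auto simp: subset_iff)
  also have "?g' c d = ?g c d"
    by (rule mix_swap[symmetric])
  also have "?g a b * ?g c d = (corr V k a b * corr V k c d) * ?M * ?M / 4"
    using M by (simp add: corr_eq_mix[OF assms(1) p_def] abcd)
  finally have "mix V p p (\<lambda>A. corr0 A p a b * corr0 (V - A) p c d) \<le> corr V k a b * corr V k c d * ?M / 4"
    using M by (simp add: field_simps)
  then have "8 * mix V p p (\<lambda>A. corr0 A p a b * corr0 (V - A) p c d) / 2 ^ card V
      \<le> 2 * (corr V k a b * corr V k c d) * (?M / 2 ^ card V)"
    by (simp add: field_simps)
  then have "?W * zsum V k \<le> ((corr V k a b * corr V k c d + corr V k a c * corr V k b d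
      + corr V k a d * corr V k b c) * zsum V k) * zsum V k"
    unfolding eq[symmetric] zsum_sq_eq_mix[OF assms(1) p_def, symmetric]
    by (simp add: two_eq_corr[OF assms(1)] algebra_simps)
  then show ?thesis
    unfolding pos_divide_le_eq[OF zsum_pos[OF assms(1)]]
    using zsum_pos[OF assms(1)] by (rule mult_right_le_imp_le)
qed

text \<open>By the symmetry between \<open>A\<close> and its complement one may always call
  \<open>A\<close> the side that contains \<open>g\<close>.\<close>

lemma mix_split:
  assumes "finite V" "g \<in> V"
  shows "mix V p p f = mix V p p (\<lambda>A. if g \<in> A then f A + f (V - A) else 0)"
proof -
  have "mix V p p f = mix V p p (\<lambda>A. if g \<in> A then f A else 0) + mix V p p (\<lambda>A. if g \<in> V - A then f A else 0)"
    unfolding mix_def sum.distrib[symmetric] using assms by (intro sum.cong) auto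
  also have "mix V p p (\<lambda>A. if g \<in> V - A then f A else 0)
      = mix V p p (\<lambda>A. if g \<in> A then f (V - A) else 0)"
    unfolding mix_def
    by (rule sum.reindex_bij_witness[where i = "\<lambda>A. V - A" and j = "\<lambda>A. V - A"])
      (auto simp: double_diff)
  finally show ?thesis
    unfolding mix_def by (simp add: sum.distrib[symmetric] distrib_right if_distrib cong: if_cong)
      (intro sum.cong refl, auto simp: algebra_simps)
qed

lemma mix_insert:
  assumes "finite U" "g \<notin> U"
  shows "mix (insert g U) p m (\<lambda>A. if g \<in> A then f A else 0)
    = (\<Sum>A\<in>Pow U. f (insert g A) * (zsum (insert g A) p * zsum (U - A) m))"
  unfolding mix_def sum_Pow_insert[OF assms] using assms(2)
  by (intro sum.cong) (auto intro!: arg_cong[of _ _ "\<lambda>X. zsum X m"])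

(* The GHS inequality, with the vertex g in the role of the magnetic field. *)
theorem corr_remove_vertex:
  assumes "finite V" and k: "\<And>a b. a \<in> V \<Longrightarrow> b \<in> V \<Longrightarrow> 0 \<le> k a b"
    and V: "g \<in> V" "a \<in> V - {g}" "b \<in> V - {g}"
  shows "corr V k a b \<le> corr (V - {g}) k a b + corr V k a g * corr V k g b"
proof -
  define p where "p = (\<lambda>a b. 2 * k a b)"
  have p: "0 \<le> p a b" if "a \<in> V" "b \<in> V" for a b
    using k[OF that] by (simp add: p_def)
  define U where "U = V - {g}"
  have U: "finite U" "g \<notin> U" "V = insert g U" "a \<in> U" "b \<in> U" "U \<subseteq> V"
    using assms(1) V by (auto simp: U_def)
  have fin: "finite A" if "A \<subseteq> V" for A
    using that assms(1) finite_subset by blast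
  \<comment> \<open>Each bracket vanishes unless its vertex and \<open>g\<close> lie on different
    sides of the set of agreement, and then it is twice a spin product; the square of the spin at
    \<open>g\<close> drops out.\<close>
  let ?\<Psi> = "\<lambda>\<sigma> \<tau>. (spin \<sigma> a * spin \<sigma> g - spin \<tau> a * spin \<tau> g) * (spin \<sigma> b * spin \<sigma> g - spin \<tau> b * spin \<tau> g)"
  let ?h = "\<lambda>A. if g \<in> A then corr0 (V - A) p a b else corr0 A p a b"
  define X where "X = (\<Sum>A\<in>Pow U. corr0 (U - A) p a b * (zsum (insert g A) p * zsum (U - A) p))"
  define Y where "Y = (\<Sum>A\<in>Pow U. 1 * (zsum (insert g A) p * zsum (U - A) p))"
  define X0 where "X0 = mix U p p (\<lambda>A. corr0 (U - A) p a b)"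
  define Y0 where "Y0 = mix U p p (\<lambda>_. 1)"
  have "?\<Psi> = (\<lambda>\<sigma> \<tau>. (spin \<sigma> a * spin \<sigma> b) * 1 - (spin \<sigma> a * spin \<sigma> g) * (spin \<tau> g * spin \<tau> b)
      - (spin \<sigma> g * spin \<sigma> b) * (spin \<tau> a * spin \<tau> g) + 1 * (spin \<tau> a * spin \<tau> b))"
    by (intro ext) (simp add: algebra_simps)
  then have "pair_avg V k (\<lambda>_ _. 0) ?\<Psi> = 2 * (two V k a b * zsum V k - two V k a g * two V k g b)"
    by (simp only: pair_avg_add pair_avg_diff pair_avg_prod) (simp add: two_def zsum_def)
  moreover have "pair_avg V k (\<lambda>_ _. 0) ?\<Psi> = mix V p p (\<lambda>A. 4 * ?h A) / 2 ^ card V"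
  proof -
    let ?F = "\<lambda>A \<sigma>. if g \<in> A then 1 else 4 * (if a \<in> A \<and> b \<in> A then spin \<sigma> a * spin \<sigma> b else 0)"
    let ?G = "\<lambda>A \<sigma>. if g \<in> A then 4 * (if a \<in> V - A \<and> b \<in> V - A then spin \<sigma> a * spin \<sigma> b else 0) else 1"
    have "pair_avg V k (\<lambda>_ _. 0) ?\<Psi> = mix V p p (\<lambda>A. (if g \<in> A then 1 else 4 * corr0 A p a b)
        * (if g \<in> A then 4 * corr0 (V - A) p a b else 1)) / 2 ^ card V"
    proof (rule pair_avg_mix[OF assms(1), where F = ?F and G = ?G])
      show "wavg A p (?F A) = (if g \<in> A then 1 else 4 * corr0 A p a b) * zsum A p" if "A \<subseteq> V" for A
        using wavg_corr0_scaled[OF fin[OF that], of p 4 a b] by (auto simp: wavg_const)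
      show "wavg (V - A) p (?G A) = (if g \<in> A then 4 * corr0 (V - A) p a b else 1) * zsum (V - A) p" for A
        using wavg_corr0_scaled[of "V - A" p 4 a b] assms(1) by (auto simp: wavg_const)
      fix A \<sigma> assume "A \<subseteq> V"
      show "?\<Psi> \<sigma> (sym_diff \<sigma> (V - A)) = ?F A (\<sigma> \<inter> A) * ?G A (\<sigma> \<inter> (V - A))"
        using V unfolding spin_sym_diff by (cases "a \<in> A"; cases "b \<in> A"; cases "g \<in> A") (auto simp: spin_Int)
    qed (simp_all add: p_def)
    also have "(\<lambda>A. (if g \<in> A then 1 else 4 * corr0 A p a b) * (if g \<in> A then 4 * corr0 (V - A) p a b else 1))
        = (\<lambda>A. 4 * ?h A)"
      by auto
    finally show ?thesis .
  qed
  moreover have "mix V p p ?h = 2 * X"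
  proof -
    have "mix V p p ?h = mix V p p (\<lambda>A. if g \<in> A then 2 * corr0 (V - A) p a b else 0)"
      unfolding mix_split[OF assms(1) V(1), of p ?h] using V(1)
      by (intro arg_cong[of _ _ "mix V p p"] ext) (auto simp: double_diff)
    also have "\<dots> = (\<Sum>A\<in>Pow U. 2 * corr0 (V - insert g A) p a b * (zsum (insert g A) p * zsum (U - A) p))"
      unfolding U(3) using U(1,2) by (rule mix_insert)
    also have "\<dots> = 2 * X"
      unfolding X_def sum_distrib_left U(3) using U(2)
      by (intro sum.cong) (auto simp: insert_Diff_if intro!: arg_cong[of _ _ "\<lambda>X. corr0 X p a b"])
    finally show ?thesis .
  qed
  ultimately have top: "two V k a b * zsum V k - two V k a g * two V k g b = 4 * X / 2 ^ card V"
    by (simp add: mix_cmult)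
  have "mix V p p (\<lambda>_. 1) = mix V p p (\<lambda>A. if g \<in> A then 2 else 0)"
    unfolding mix_split[OF assms(1) V(1), of p "\<lambda>_. 1"] by (intro arg_cong[of _ _ "mix V p p"]) auto
  also have "\<dots> = (\<Sum>A\<in>Pow U. 2 * (zsum (insert g A) p * zsum (U - A) p))"
    unfolding U(3) using U(1,2) by (rule mix_insert)
  finally have "mix V p p (\<lambda>_. 1) = 2 * Y"
    by (simp add: Y_def sum_distrib_left)
  then have ZZ: "zsum V k * zsum V k = 2 * Y / 2 ^ card V"
    using zsum_sq_eq_mix[OF assms(1) p_def] by simp
  have Z: "0 < zsum V k"
    using assms(1) by (rule zsum_pos)
  have Y: "0 < Y"
    using mult_pos_pos[OF Z Z] unfolding ZZ by (simp add: zero_less_divide_iff)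
  have "corr V k a b - corr V k a g * corr V k g b
      = (two V k a b * zsum V k - two V k a g * two V k g b) / (zsum V k * zsum V k)"
    using Z by (simp add: corr_def field_simps)
  also have "\<dots> = 2 * X / Y"
    unfolding top ZZ using Y by (simp add: field_simps)
  also have "\<dots> \<le> 2 * X0 / Y0"
  proof -
    \<comment> \<open>Attaching \<open>g\<close> to \<open>A\<close> in the weight enlarges
      \<open>A\<close> and so lowers the correlation on \<open>U - A\<close>; without
      \<open>g\<close> the mixture is that of the model on \<open>U\<close>.\<close>
    have "X * Y0 \<le> Y * X0"
      unfolding X_def Y_def X0_def Y0_def mix_def
    proof (rule four_functions[OF U(1)])
      fix A B assume AB: "A \<subseteq> U" "B \<subseteq> U"
      have Z: "0 \<le> zsum X k" if "X \<subseteq> V" for X k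
        using zsum_pos[OF fin[OF that]] by (simp add: less_imp_le)
      have pp: "\<bar>p a b\<bar> \<le> p a b" if "a \<in> V" "b \<in> V" for a b
        using p[OF that] by linarith
      have "zsum (insert g A) p * zsum B p \<le> zsum (insert g A \<union> B) p * zsum (insert g A \<inter> B) p"
        using AB U by (intro zsum_supermodular[OF assms(1) pp]) auto
      moreover have "insert g A \<inter> B = A \<inter> B" "insert g A \<union> B = insert g (A \<union> B)"
        using AB U by auto
      ultimately have 1: "zsum (insert g A) p * zsum B p \<le> zsum (insert g (A \<union> B)) p * zsum (A \<inter> B) p"
        by simp
      have "zsum (U - A) p * zsum (U - B) p
          \<le> zsum ((U - A) \<union> (U - B)) p * zsum ((U - A) \<inter> (U - B)) p"
        using U by (intro zsum_supermodular[OF assms(1) pp]) auto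
      then have 2: "zsum (U - A) p * zsum (U - B) p \<le> zsum (U - A \<inter> B) p * zsum (U - (A \<union> B)) p"
        by (simp add: Diff_Int Diff_Un)
      have 3: "corr0 (U - A) p a b \<le> corr0 (U - A \<inter> B) p a b"
        using U p by (intro corr0_mono) auto
      have 4: "0 \<le> corr0 (U - A \<inter> B) p a b"
        using U p by (intro corr0_nonneg) auto
      have "corr0 (U - A) p a b * ((zsum (insert g A) p * zsum B p) * (zsum (U - A) p * zsum (U - B) p))
          \<le> corr0 (U - A \<inter> B) p a b * ((zsum (insert g (A \<union> B)) p * zsum (A \<inter> B) p)
            * (zsum (U - A \<inter> B) p * zsum (U - (A \<union> B)) p))"
        using AB U by (intro mult_mono 1 2 3 4 mult_nonneg_nonneg Z) auto
      then show "corr0 (U - A) p a b * (zsum (insert g A) p * zsum (U - A) p) * (1 * (zsum B p * zsum (U - B) p))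
          \<le> 1 * (zsum (insert g (A \<union> B)) p * zsum (U - (A \<union> B)) p)
            * (corr0 (U - A \<inter> B) p a b * (zsum (A \<inter> B) p * zsum (U - A \<inter> B) p))"
        by (simp add: mult_ac)
    next
      have Z: "0 \<le> zsum X k" if "X \<subseteq> V" for X k
        using zsum_pos[OF fin[OF that]] by (simp add: less_imp_le)
      have C: "0 \<le> corr0 (U - A) p a b" for A
        using U p by (intro corr0_nonneg) auto
      show "0 \<le> corr0 (U - A) p a b * (zsum (insert g A) p * zsum (U - A) p)"
        "0 \<le> 1 * (zsum A p * zsum (U - A) p)" "0 \<le> 1 * (zsum (insert g A) p * zsum (U - A) p)"
        "0 \<le> corr0 (U - A) p a b * (zsum A p * zsum (U - A) p)" if "A \<subseteq> U" for A
        using that U by (auto intro!: mult_nonneg_nonneg Z C)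
    qed
    then show ?thesis
      using Y mix_one_pos[OF U(1), of p p] by (simp add: Y0_def field_simps)
  qed
  also have "X0 = mix U p p (\<lambda>A. corr0 A p a b)"
    unfolding X0_def by (rule mix_swap[symmetric])
  also have "2 * \<dots> / Y0 = corr U k a b"
    unfolding Y0_def corr_eq_mix[OF U(1) p_def U(4,5)] by simp
  finally show ?thesis
    by (simp add: U_def)
qed

section \<open>Cluster decomposition of the two-point function\<close>

text \<open>The connected component of \<open>a\<close> when the ordered pairs in \<open>N\<close>
  serve as undirected edges. Intersecting closed sets gives minimality at once and avoids
  paths.\<close>

definition cluster :: "('a \<times> 'a) set \<Rightarrow> 'a \<Rightarrow> 'a set" where
  "cluster N a = \<Inter> {X. a \<in> X \<and> (\<forall>(u, v)\<in>N. u \<in> X \<longleftrightarrow> v \<in> X)}"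

definition bond :: "('a \<Rightarrow> 'a \<Rightarrow> real) \<Rightarrow> 'a \<times> 'a \<Rightarrow> 'a set \<Rightarrow> real" where
  "bond p e \<sigma> = exp (p (fst e) (snd e) * (spin \<sigma> (fst e) * spin \<sigma> (snd e))) - 1"

text \<open>The factors 1 + \<open>bond\<close> are expanded as in a Mayer expansion;
  \<open>conn\<close> collects the edge sets that connect all of \<open>C\<close>, without reference
  to the surrounding graph.\<close>

definition conn :: "('a \<Rightarrow> 'a \<Rightarrow> real) \<Rightarrow> 'a \<Rightarrow> 'a set \<Rightarrow> 'a set \<Rightarrow> real" where
  "conn p a C \<sigma> = (\<Sum>N | N \<subseteq> C \<times> C \<and> cluster N a = C. \<Prod>e\<in>N. bond p e \<sigma>)"

definition cluster_weight :: "('a \<Rightarrow> 'a \<Rightarrow> real) \<Rightarrow> 'a \<Rightarrow> 'a \<Rightarrow> 'a set \<Rightarrow> real" where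
  "cluster_weight p a b C = avg C (\<lambda>\<sigma>. spin \<sigma> a * spin \<sigma> b * conn p a C \<sigma>)"

lemma cluster_self: "a \<in> cluster N a"
  by (auto simp: cluster_def)

lemma cluster_closed: "(u, v) \<in> N \<Longrightarrow> u \<in> cluster N a \<longleftrightarrow> v \<in> cluster N a"
  by (auto simp: cluster_def)

lemma cluster_minimal: "a \<in> X \<Longrightarrow> (\<And>u v. (u, v) \<in> N \<Longrightarrow> u \<in> X \<longleftrightarrow> v \<in> X) \<Longrightarrow> cluster N a \<subseteq> X"
  by (auto simp: cluster_def)

lemma cluster_Un:
  assumes N1: "N1 \<subseteq> C \<times> C" "cluster N1 a = C" and N2: "N2 \<subseteq> (- C) \<times> (- C)"
  shows "cluster (N1 \<union> N2) a = C"
proof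
  show "cluster (N1 \<union> N2) a \<subseteq> C"
    using assms cluster_self[of a N1] by (intro cluster_minimal) auto
  have "cluster N1 a \<subseteq> cluster (N1 \<union> N2) a"
    using cluster_closed[of _ _ "N1 \<union> N2" a] by (intro cluster_minimal cluster_self) auto
  then show "C \<subseteq> cluster (N1 \<union> N2) a"
    using N1 by simp
qed

lemma cluster_Int:
  assumes "cluster N a = C"
  shows "cluster (N \<inter> C \<times> C) a = C"
proof
  let ?D = "cluster (N \<inter> C \<times> C) a"
  have a: "a \<in> C"
    using cluster_self[of a N] assms by simp
  show D: "?D \<subseteq> C"
    using a by (intro cluster_minimal) auto
  have "cluster N a \<subseteq> ?D"
  proof (rule cluster_minimal)
    fix u v assume uv: "(u, v) \<in> N"
    then have "u \<in> C \<longleftrightarrow> v \<in> C"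
      using cluster_closed[of u v N a] assms by simp
    then show "u \<in> ?D \<longleftrightarrow> v \<in> ?D"
      using D uv cluster_closed[of u v "N \<inter> C \<times> C" a] by auto
  qed (rule cluster_self)
  then show "C \<subseteq> ?D"
    using assms by simp
qed

lemma prod_one_add:
  fixes u :: "'b \<Rightarrow> real"
  assumes "finite E"
  shows "(\<Prod>e\<in>E. 1 + u e) = (\<Sum>N\<in>Pow E. \<Prod>e\<in>N. u e)"
  using prod_add[OF assms, of u "\<lambda>_. 1"] by (simp add: add.commute)

text \<open>The edge sets in the expanded product are grouped by the component \<open>C\<close> of
  \<open>a\<close>: no edge links \<open>C\<close> to the rest, the edges in \<open>C\<close>
  connect it, and the edges outside are arbitrary and resum to a product. \<open>cluster_Un\<close>
  and \<open>cluster_Int\<close> are the two directions of this bijection.\<close>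

lemma cluster_expansion:
  fixes u :: "'a \<times> 'a \<Rightarrow> real"
  assumes "finite A" "a \<in> A"
  shows "(\<Prod>e\<in>A \<times> A. 1 + u e) = (\<Sum>C | C \<subseteq> A \<and> a \<in> C.
    (\<Sum>N | N \<subseteq> C \<times> C \<and> cluster N a = C. \<Prod>e\<in>N. u e) * (\<Prod>e\<in>(A - C) \<times> (A - C). 1 + u e))"
proof -
  let ?Cs = "{C. C \<subseteq> A \<and> a \<in> C}"
  let ?Ns = "\<lambda>C. {N. N \<subseteq> C \<times> C \<and> cluster N a = C}"
  let ?P = "\<lambda>N. \<Prod>e\<in>N. u e"
  have fin: "finite N" if "N \<subseteq> A \<times> A" for N
    using that assms(1) finite_subset by blast
  have fC: "finite (?Ns C)" if "C \<in> ?Cs" for C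
    using that finite_subset[OF _ assms(1), of C] by (auto intro!: finite_Collect_conjI disjI1)
  have "(\<Prod>e\<in>A \<times> A. 1 + u e) = (\<Sum>N\<in>Pow (A \<times> A). ?P N)"
    using assms(1) by (intro prod_one_add) simp
  also have "\<dots> = (\<Sum>(C, N1, N2)\<in>(SIGMA C:?Cs. ?Ns C \<times> Pow ((A - C) \<times> (A - C))). ?P N1 * ?P N2)"
  proof (rule sum.reindex_bij_witness[where i = "\<lambda>(C, N1, N2). N1 \<union> N2"
        and j = "\<lambda>N. (cluster N a, N \<inter> cluster N a \<times> cluster N a, N \<inter> (A - cluster N a) \<times> (A - cluster N a))"])
    fix N assume N: "N \<in> Pow (A \<times> A)"
    let ?C = "cluster N a"
    have un: "N = N \<inter> ?C \<times> ?C \<union> N \<inter> (A - ?C) \<times> (A - ?C)"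
    proof (rule set_eqI)
      fix e :: "'a \<times> 'a"
      obtain x y where e: "e = (x, y)" by force
      show "e \<in> N \<longleftrightarrow> e \<in> N \<inter> ?C \<times> ?C \<union> N \<inter> (A - ?C) \<times> (A - ?C)"
        using N cluster_closed[of x y N a] by (auto simp: e)
    qed
    show "(case (?C, N \<inter> ?C \<times> ?C, N \<inter> (A - ?C) \<times> (A - ?C)) of (C, N1, N2) \<Rightarrow> N1 \<union> N2) = N"
      unfolding prod.case by (rule un[symmetric])
    have "?C \<subseteq> A"
      using N assms(2) by (intro cluster_minimal) auto
    then show "(?C, N \<inter> ?C \<times> ?C, N \<inter> (A - ?C) \<times> (A - ?C))
        \<in> (SIGMA C:?Cs. ?Ns C \<times> Pow ((A - C) \<times> (A - C)))"
      using cluster_self[of a N] cluster_Int[of N a ?C] by auto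
    have "?P N = ?P (N \<inter> ?C \<times> ?C \<union> N \<inter> (A - ?C) \<times> (A - ?C))"
      by (rule arg_cong[OF un])
    also have "\<dots> = ?P (N \<inter> ?C \<times> ?C) * ?P (N \<inter> (A - ?C) \<times> (A - ?C))"
      using N by (intro prod.union_disjoint fin) auto
    finally show "(case (?C, N \<inter> ?C \<times> ?C, N \<inter> (A - ?C) \<times> (A - ?C)) of (C, N1, N2) \<Rightarrow> ?P N1 * ?P N2) = ?P N"
      by simp
  next
    fix x assume x: "x \<in> (SIGMA C:?Cs. ?Ns C \<times> Pow ((A - C) \<times> (A - C)))"
    obtain C N1 N2 where x_eq: "x = (C, N1, N2)"
      by (cases x) auto
    have N: "C \<subseteq> A" "a \<in> C" "N1 \<subseteq> C \<times> C" "cluster N1 a = C" "N2 \<subseteq> (A - C) \<times> (A - C)"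
      using x unfolding x_eq by auto
    have cl: "cluster (N1 \<union> N2) a = C"
      using N by (intro cluster_Un) auto
    have "(N1 \<union> N2) \<inter> C \<times> C = N1" "(N1 \<union> N2) \<inter> (A - C) \<times> (A - C) = N2"
      using N by auto
    then show "(cluster (case x of (C, N1, N2) \<Rightarrow> N1 \<union> N2) a,
        (case x of (C, N1, N2) \<Rightarrow> N1 \<union> N2) \<inter> cluster (case x of (C, N1, N2) \<Rightarrow> N1 \<union> N2) a \<times> cluster (case x of (C, N1, N2) \<Rightarrow> N1 \<union> N2) a,
        (case x of (C, N1, N2) \<Rightarrow> N1 \<union> N2) \<inter> (A - cluster (case x of (C, N1, N2) \<Rightarrow> N1 \<union> N2) a) \<times> (A - cluster (case x of (C, N1, N2) \<Rightarrow> N1 \<union> N2) a)) = x"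
      by (simp add: x_eq cl)
    show "(case x of (C, N1, N2) \<Rightarrow> N1 \<union> N2) \<in> Pow (A \<times> A)"
      using N by (auto simp: x_eq)
  qed
  also have "\<dots> = (\<Sum>C\<in>?Cs. \<Sum>(N1, N2)\<in>?Ns C \<times> Pow ((A - C) \<times> (A - C)). ?P N1 * ?P N2)"
    using fC assms(1) by (intro sum.Sigma[symmetric]) auto
  also have "\<dots> = (\<Sum>C\<in>?Cs. (\<Sum>N\<in>?Ns C. ?P N) * (\<Prod>e\<in>(A - C) \<times> (A - C). 1 + u e))"
    using assms(1) by (intro sum.cong refl) (simp add: prod_one_add sum_product sum.cartesian_product)
  finally show ?thesis .
qed

lemma exp_energy_bond: "finite A \<Longrightarrow> exp (energy A p \<sigma>) = (\<Prod>e\<in>A \<times> A. 1 + bond p e \<sigma>)"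
  by (simp add: energy_def exp_sum bond_def prod.cartesian_product case_prod_beta)

lemma conn_Int: "C \<subseteq> B \<Longrightarrow> conn p a C (\<sigma> \<inter> B) = conn p a C \<sigma>"
  unfolding conn_def bond_def by (intro sum.cong prod.cong refl) (auto simp: spin_def)

lemma conn_flip: "conn p a C (sym_diff \<sigma> C) = conn p a C \<sigma>"
  unfolding conn_def bond_def
  by (intro sum.cong prod.cong refl) (auto simp: spin_sym_diff subset_iff split_paired_all)

text \<open>Flipping all spins of \<open>C\<close> preserves every bond in \<open>C\<close> and
  reverses the spin at \<open>a\<close>. Hence a cluster of \<open>a\<close> that misses
  \<open>b\<close> contributes nothing in \<open>two_cluster\<close>.\<close>

lemma avg_spin_conn:
  assumes "a \<in> C"
  shows "avg C (\<lambda>\<sigma>. spin \<sigma> a * conn p a C \<sigma>) = 0"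
proof -
  have "avg C (\<lambda>\<sigma>. spin (sym_diff \<sigma> C) a * conn p a C (sym_diff \<sigma> C))
      = - avg C (\<lambda>\<sigma>. spin \<sigma> a * conn p a C \<sigma>)"
    unfolding conn_flip using assms avg_cmult[of C "- 1" "\<lambda>\<sigma>. spin \<sigma> a * conn p a C \<sigma>"]
    by (simp add: spin_sym_diff)
  then show ?thesis
    using avg_shift[of C C "\<lambda>\<sigma>. spin \<sigma> a * conn p a C \<sigma>"] by simp
qed

lemma cluster_weight_nonneg:
  assumes "finite C" "a \<in> C" "b \<in> C" "\<And>x y. x \<in> C \<Longrightarrow> y \<in> C \<Longrightarrow> 0 \<le> p x y"
  shows "0 \<le> cluster_weight p a b C"
proof -
  have "gcone C (bond p e)" if "e \<in> C \<times> C" for e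
  proof -
    have "bond p e = (\<lambda>\<sigma>. (cosh (p (fst e) (snd e)) - 1)
        + sinh (p (fst e) (snd e)) * (spin \<sigma> (fst e) * spin \<sigma> (snd e)))"
      by (intro ext) (simp add: bond_def exp_spin2)
    then show ?thesis
      using that assms cosh_real_ge_1 by (auto intro!: gcone_add gcone_mult gcone_const gcone_spin2)
  qed
  then have "gcone C (conn p a C)"
    unfolding conn_def using assms(1) by (intro gcone_sum gcone_prod) auto
  then show ?thesis
    unfolding cluster_weight_def using assms
    by (intro gcone_avg_nonneg gcone_mult gcone_spin2)
qed

text \<open>The weight of \<open>C\<close> depends on \<open>C\<close> and not on \<open>A\<close>,
  and the rest is the full model on \<open>A - C\<close>. This makes it possible to take the cluster
  out of the mixture before summing over \<open>A\<close>.\<close>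

lemma two_cluster:
  assumes "finite A" "a \<in> A" "b \<in> A"
  shows "two A p a b = (\<Sum>C | C \<subseteq> A \<and> a \<in> C \<and> b \<in> C. cluster_weight p a b C * zsum (A - C) p)"
proof -
  let ?t = "\<lambda>C \<sigma>. spin \<sigma> a * spin \<sigma> b * (conn p a C \<sigma> * exp (energy (A - C) p \<sigma>))"
  have finA: "finite {C. C \<subseteq> A \<and> P C}" for P
    using assms(1) by (auto intro!: finite_Collect_conjI disjI1)
  have "two A p a b = avg A (\<lambda>\<sigma>. \<Sum>C | C \<subseteq> A \<and> a \<in> C. ?t C \<sigma>)"
    unfolding two_def wavg_def
  proof (rule avg_cong)
    fix \<sigma> assume "\<sigma> \<subseteq> A"
    have "exp (energy A p \<sigma>) = (\<Sum>C | C \<subseteq> A \<and> a \<in> C. conn p a C \<sigma> * exp (energy (A - C) p \<sigma>))"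
      using cluster_expansion[OF assms(1,2), of "\<lambda>e. bond p e \<sigma>"] assms(1)
      by (simp add: exp_energy_bond conn_def)
    then show "spin \<sigma> a * spin \<sigma> b * exp (energy A p \<sigma>) = (\<Sum>C | C \<subseteq> A \<and> a \<in> C. ?t C \<sigma>)"
      by (simp add: sum_distrib_left)
  qed
  also have "\<dots> = (\<Sum>C | C \<subseteq> A \<and> a \<in> C. avg A (?t C))"
    by (rule avg_sum)
  also have "\<dots> = (\<Sum>C | C \<subseteq> A \<and> a \<in> C. if b \<in> C then cluster_weight p a b C * zsum (A - C) p else 0)"
  proof (rule sum.cong[OF refl])
    fix C assume "C \<in> {C. C \<subseteq> A \<and> a \<in> C}"
    then have C: "C \<subseteq> A" "a \<in> C" by auto
    show "avg A (?t C) = (if b \<in> C then cluster_weight p a b C * zsum (A - C) p else 0)"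
    proof (cases "b \<in> C")
      case True
      have "avg A (?t C) = avg A (\<lambda>\<sigma>. (spin (\<sigma> \<inter> C) a * spin (\<sigma> \<inter> C) b * conn p a C (\<sigma> \<inter> C))
          * exp (energy (A - C) p (\<sigma> \<inter> (A - C))))"
        using C True by (simp add: conn_Int energy_Int spin_Int mult.assoc)
      also have "\<dots> = cluster_weight p a b C * zsum (A - C) p"
        unfolding cluster_weight_def zsum_def wavg_def
        by (subst avg_indep[OF assms(1) C(1)]) simp
      finally show ?thesis
        using True by simp
    next
      case False
      have "avg A (?t C) = avg A (\<lambda>\<sigma>. (spin (\<sigma> \<inter> C) a * conn p a C (\<sigma> \<inter> C))
          * (spin (\<sigma> \<inter> (A - C)) b * exp (energy (A - C) p (\<sigma> \<inter> (A - C)))))"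
        using C False assms(3) by (simp add: conn_Int energy_Int spin_Int mult_ac)
      also have "\<dots> = avg C (\<lambda>\<sigma>. spin \<sigma> a * conn p a C \<sigma>)
          * avg (A - C) (\<lambda>\<sigma>. spin \<sigma> b * exp (energy (A - C) p \<sigma>))"
        by (rule avg_indep[OF assms(1) C(1)])
      finally show ?thesis
        using False C by (simp add: avg_spin_conn)
    qed
  qed
  also have "\<dots> = (\<Sum>C | C \<subseteq> A \<and> a \<in> C \<and> b \<in> C. cluster_weight p a b C * zsum (A - C) p)"
    using finA[of "\<lambda>C. a \<in> C"] by (simp add: sum.inter_filter[symmetric] conj_assoc)
  finally show ?thesis .
qed

text \<open>The sums over \<open>A\<close> and over \<open>C \<subseteq> A\<close> are exchanged;
  for fixed \<open>C\<close> the set \<open>A - C\<close> runs over all subsets of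
  \<open>V - C\<close> and has there the same kind of mixed law.\<close>

lemma mix_cluster:
  assumes "finite V" "a \<in> V" "b \<in> V"
  shows "mix V p m (\<lambda>A. corr0 A p a b * e A)
    = (\<Sum>C | C \<subseteq> V \<and> a \<in> C \<and> b \<in> C. cluster_weight p a b C * mix (V - C) p m (\<lambda>A. e (A \<union> C)))"
proof -
  let ?Cs = "\<lambda>A. {C. C \<subseteq> A \<and> a \<in> C \<and> b \<in> C}"
  let ?w = "\<lambda>A C. e A * (cluster_weight p a b C * (zsum (A - C) p * zsum (V - A) m))"
  have finV: "finite (?Cs A)" if "A \<subseteq> V" for A
    using finite_subset[OF that assms(1)] by (auto intro!: finite_Collect_conjI disjI1)
  have cr: "corr0 A p a b * zsum A p = (\<Sum>C\<in>?Cs A. cluster_weight p a b C * zsum (A - C) p)" if "A \<subseteq> V" for A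
  proof (cases "a \<in> A \<and> b \<in> A")
    case True
    have "finite A" using that assms(1) finite_subset by blast
    then show ?thesis
      using True two_eq_corr[of A p a b] two_cluster[of A a b p] by (simp add: corr0_def)
  next
    case False
    then have "?Cs A = {}" by auto
    then show ?thesis
      unfolding \<open>?Cs A = {}\<close> using False by (auto simp: corr0_def)
  qed
  have "mix V p m (\<lambda>A. corr0 A p a b * e A) = (\<Sum>A\<in>Pow V. \<Sum>C\<in>?Cs A. ?w A C)"
    unfolding mix_def
  proof (rule sum.cong[OF refl])
    fix A assume "A \<in> Pow V"
    then have "e A * (corr0 A p a b * zsum A p) * zsum (V - A) m = (\<Sum>C\<in>?Cs A. ?w A C)"
      using cr[of A] by (simp add: sum_distrib_left sum_distrib_right mult_ac)
    then show "corr0 A p a b * e A * (zsum A p * zsum (V - A) m) = (\<Sum>C\<in>?Cs A. ?w A C)"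
      by (simp add: mult_ac)
  qed
  also have "\<dots> = (\<Sum>(A, C)\<in>(SIGMA A:Pow V. ?Cs A). ?w A C)"
    using finV assms(1) by (intro sum.Sigma) auto
  also have "\<dots> = (\<Sum>(C, A)\<in>(SIGMA C:?Cs V. Pow (V - C)). ?w (A \<union> C) C)"
    by (rule sum.reindex_bij_witness[where i = "\<lambda>(C, A). (A \<union> C, C)" and j = "\<lambda>(A, C). (C, A - C)"])
      (auto simp: Un_absorb2 intro!: arg_cong2[of _ _ _ _ "\<lambda>A C. ?w A C"])
  also have "\<dots> = (\<Sum>C\<in>?Cs V. \<Sum>A\<in>Pow (V - C). ?w (A \<union> C) C)"
    using finV assms(1) by (intro sum.Sigma[symmetric]) auto
  also have "\<dots> = (\<Sum>C\<in>?Cs V. cluster_weight p a b C * mix (V - C) p m (\<lambda>A. e (A \<union> C)))"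
  proof (rule sum.cong[OF refl])
    fix C assume "C \<in> ?Cs V"
    have "?w (A \<union> C) C = cluster_weight p a b C * (e (A \<union> C) * (zsum A p * zsum (V - C - A) m))"
      if "A \<in> Pow (V - C)" for A
    proof -
      have "A \<union> C - C = A" "V - (A \<union> C) = V - C - A"
        using that by auto
      then show ?thesis by simp
    qed
    then show "(\<Sum>A\<in>Pow (V - C). ?w (A \<union> C) C) = cluster_weight p a b C * mix (V - C) p m (\<lambda>A. e (A \<union> C))"
      unfolding mix_def sum_distrib_left by (intro sum.cong refl) blast
  qed
  finally show ?thesis .
qed

text \<open>\<open>corr_remove_vertex\<close> is applied vertex by vertex; the correlations in its
  error terms belong to smaller graphs and are enlarged to those of \<open>V\<close>.\<close>

lemma corr_remove_set:
  assumes "finite V" and k: "\<And>a b. a \<in> V \<Longrightarrow> b \<in> V \<Longrightarrow> 0 \<le> k a b"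
    and "finite X" "X \<subseteq> V" "a \<in> V - X" "b \<in> V - X"
  shows "corr V k a b \<le> corr (V - X) k a b + (\<Sum>g\<in>X. corr V k a g * corr V k g b)"
  using assms(3-6)
proof (induction X)
  case (insert g X)
  let ?W = "V - X"
  have W: "finite ?W" "?W \<subseteq> V" "g \<in> ?W" "a \<in> ?W" "b \<in> ?W" "?W - {g} = V - insert g X"
    using insert assms(1) by auto
  have mono: "corr ?W k u v \<le> corr V k u v" "0 \<le> corr ?W k u v" if "u \<in> ?W" "v \<in> ?W" for u v
    using that W(2) k assms(1) corr_subset_mono[of V k ?W u v] by (auto intro!: corr_nonneg)
  have "corr V k a b \<le> corr ?W k a b + (\<Sum>g\<in>X. corr V k a g * corr V k g b)"
    using insert by auto
  also have "corr ?W k a b \<le> corr (?W - {g}) k a b + corr ?W k a g * corr ?W k g b"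
    using W k insert.prems by (intro corr_remove_vertex) auto
  also have "corr ?W k a g * corr ?W k g b \<le> corr V k a g * corr V k g b"
    using W mono by (intro mult_mono) (auto intro: order.trans[OF mono(2) mono(1)])
  finally show ?case
    unfolding W(6) using insert.hyps by simp
qed simp

section \<open>Comparison of a graph with its double cover\<close>

lemma mix_add: "mix V p m (\<lambda>A. f A + g A) = mix V p m f + mix V p m g"
  by (simp add: mix_def sum.distrib distrib_right)

(* The two conditions say that k0 and k1 are the couplings within and between the two sheets of
   the cover, so that k0 + k1 is the coupling of the base. *)
theorem corr_le_double_cover:
  assumes "finite V" and k: "\<And>x y. x \<in> V \<Longrightarrow> y \<in> V \<Longrightarrow> 0 \<le> k0 x y" "\<And>x y. x \<in> V \<Longrightarrow> y \<in> V \<Longrightarrow> 0 \<le> k1 x y"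
    and ab: "a \<in> V" "b \<in> V"
  shows "corr V (\<lambda>x y. k0 x y + k1 x y) a b
    \<le> (\<Sum>i\<in>UNIV. \<Sum>j\<in>UNIV. corr (V \<times> UNIV) (lift k0 k1) (a, i) (b, j)) / 2"
proof -
  define p where "p = (\<lambda>x y. 2 * (k0 x y + k1 x y))"
  define m where "m = (\<lambda>x y. 2 * (k0 x y - k1 x y))"
  have pm: "\<bar>m x y\<bar> \<le> p x y" "0 \<le> p x y" if "x \<in> V" "y \<in> V" for x y
    using k(1)[OF that] k(2)[OF that] by (auto simp: p_def m_def)
  have fin: "finite A" if "A \<subseteq> V" for A
    using that assms(1) finite_subset by blast
  have "mix V p p (\<lambda>A. corr0 A p a b) * mix V p m (\<lambda>_. 1)
      \<le> mix V p m (\<lambda>A. corr0 A p a b) * mix V p p (\<lambda>_. 1)"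
    using corr0_nonneg[of _ p] corr0_mono[of _ p] fin pm
    by (intro mix_fkg[OF assms(1) pm(1)]) (auto simp: subset_iff)
  then have "mix V p p (\<lambda>A. corr0 A p a b) / mix V p p (\<lambda>_. 1)
      \<le> mix V p m (\<lambda>A. corr0 A p a b) / mix V p m (\<lambda>_. 1)"
    using mix_one_pos[OF assms(1), of p p] mix_one_pos[OF assms(1), of p m] by (simp add: field_simps)
  then show ?thesis
    unfolding sum_corr_lift[OF assms(1) p_def m_def ab] corr_eq_mix[OF assms(1) p_def ab] by simp
qed


text \<open>Adding \<open>y\<close> to \<open>A\<close> multiplies its partition function by
  \<open>f A\<close>, which is increasing in \<open>A\<close>, so \<open>mix_fkg\<close> applies.
  For \<open>p\<close>, \<open>p\<close> the two sides are symmetric, and the total weight with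
  \<open>y\<close> is twice the sum of \<open>f\<close>. For \<open>p\<close>, \<open>m\<close> the
  vertex \<open>y\<close> lies in \<open>A\<close> with probability (1 + t) / 2, where t is the
  correlation of the two points over \<open>y\<close>, and t is at most
  \<open>\<theta>\<close>.\<close>

lemma mix_insert_ratio:
  assumes "finite V" and k: "\<And>x y. x \<in> V \<Longrightarrow> y \<in> V \<Longrightarrow> 0 \<le> k0 x y" "\<And>x y. x \<in> V \<Longrightarrow> y \<in> V \<Longrightarrow> 0 \<le> k1 x y"
    and p: "p = (\<lambda>x y. 2 * (k0 x y + k1 x y))" and m: "m = (\<lambda>x y. 2 * (k0 x y - k1 x y))"
    and U: "U \<subseteq> V" "y \<in> V" "y \<notin> U"
    and \<theta>: "corr (V \<times> UNIV) (lift k0 k1) (y, False) (y, True) \<le> \<theta>"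
  shows "mix (insert y U) p p (\<lambda>_. 1) * mix U p m (\<lambda>_. 1)
    \<le> (1 + \<theta>) * (mix (insert y U) p m (\<lambda>_. 1) * mix U p p (\<lambda>_. 1))"
proof -
  let ?W = "insert y U"
  have fin: "finite A" if "A \<subseteq> V" for A
    using that assms(1) finite_subset by blast
  have pm: "\<bar>m a b\<bar> \<le> p a b" "\<bar>p a b\<bar> \<le> p a b" if "a \<in> V" "b \<in> V" for a b
    using k(1)[OF that] k(2)[OF that] by (auto simp: p m)
  have W: "?W \<subseteq> V" "finite ?W" "finite U"
    using U fin by auto
  define f where "f A = zsum (insert y A) p / zsum A p" for A
  have Z: "0 < zsum A k" if "A \<subseteq> V" for A k
    using fin[OF that] by (rule zsum_pos)
  have fZ: "f A * (zsum A p * r) = zsum (insert y A) p * r" if "A \<subseteq> U" for A r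
    using Z[of A p] order.trans[OF that U(1)] by (simp add: f_def)
  have fkg: "mix U p p f * mix U p m (\<lambda>_. 1) \<le> mix U p m f * mix U p p (\<lambda>_. 1)"
  proof (rule mix_fkg[OF W(3)])
    show "\<bar>m a b\<bar> \<le> p a b" if "a \<in> U" "b \<in> U" for a b
      using pm(1) that U by blast
    show "0 \<le> f A" if "A \<subseteq> U" for A
      using Z[of A p] Z[of "insert y A" p] that U by (simp add: f_def subset_iff)
    show "f A \<le> f B" if "A \<subseteq> B" "B \<subseteq> U" for A B
    proof -
      have "zsum (insert y A) p * zsum B p \<le> zsum (insert y A \<union> B) p * zsum (insert y A \<inter> B) p"
        using that U pm(2) by (intro zsum_supermodular[OF assms(1)]) auto
      moreover have "insert y A \<union> B = insert y B" "insert y A \<inter> B = A"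
        using that U by auto
      ultimately show ?thesis
        using Z[of A p] Z[of B p] that U by (simp add: f_def field_simps subset_iff)
    qed
  qed
  have 1: "mix ?W p p (\<lambda>_. 1) = 2 * mix U p p f"
  proof -
    have "mix ?W p p (\<lambda>_. 1) = mix ?W p p (\<lambda>A. if y \<in> A then 2 else 0)"
      unfolding mix_split[OF W(2) insertI1, of p "\<lambda>_. 1"] by (simp cong: if_cong)
    also have "\<dots> = 2 * mix U p p f"
      unfolding mix_insert[OF W(3) U(3)] unfolding mix_def sum_distrib_left
      by (intro sum.cong refl) (simp add: fZ)
    finally show ?thesis .
  qed
  have 2: "2 * mix U p m f \<le> (1 + \<theta>) * mix ?W p m (\<lambda>_. 1)"
  proof -
    let ?M = "mix ?W p m (\<lambda>_. 1)"
    have M: "0 < ?M"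
      using W(2) by (rule mix_one_pos)
    have "2 * mix U p m f = mix ?W p m (\<lambda>A. if y \<in> A then 2 else 0)"
      unfolding mix_insert[OF W(3) U(3)] unfolding mix_def sum_distrib_left
      by (intro sum.cong refl) (simp add: fZ)
    also have "\<dots> = mix ?W p m (\<lambda>A. 1 + (if y \<in> A then 1 else - 1))"
      by (intro arg_cong[of _ _ "mix ?W p m"]) auto
    also have "\<dots> = (1 + corr (?W \<times> UNIV) (lift k0 k1) (y, False) (y, True)) * ?M"
      unfolding mix_add corr_lift_fibre[OF W(2) p m insertI1] using M by (simp add: field_simps)
    also have "\<dots> \<le> (1 + \<theta>) * ?M"
    proof (rule mult_right_mono)
      have "corr (?W \<times> UNIV) (lift k0 k1) (y, False) (y, True)
          \<le> corr (V \<times> UNIV) (lift k0 k1) (y, False) (y, True)"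
        using W assms(1) k by (intro corr_subset_mono) (auto simp: lift_def)
      then show "1 + corr (?W \<times> UNIV) (lift k0 k1) (y, False) (y, True) \<le> 1 + \<theta>"
        using \<theta> by linarith
    qed (use M in simp)
    finally show ?thesis .
  qed
  have "mix ?W p p (\<lambda>_. 1) * mix U p m (\<lambda>_. 1) \<le> (2 * mix U p m f) * mix U p p (\<lambda>_. 1)"
    using fkg by (simp add: 1)
  also have "\<dots> \<le> ((1 + \<theta>) * mix ?W p m (\<lambda>_. 1)) * mix U p p (\<lambda>_. 1)"
    using 2 mix_one_pos[OF W(3), of p p] by (intro mult_right_mono) auto
  finally show ?thesis
    by (simp add: mult.assoc)
qed

text \<open>Iterating \<open>mix_insert_ratio\<close>, each vertex of the cluster costs one factor
  \<open>1 + \<theta>\<close> when it is removed from the cover instead of the base.\<close>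

lemma mix_Diff_ratio:
  assumes "finite V" and k: "\<And>x y. x \<in> V \<Longrightarrow> y \<in> V \<Longrightarrow> 0 \<le> k0 x y" "\<And>x y. x \<in> V \<Longrightarrow> y \<in> V \<Longrightarrow> 0 \<le> k1 x y"
    and p: "p = (\<lambda>x y. 2 * (k0 x y + k1 x y))" and m: "m = (\<lambda>x y. 2 * (k0 x y - k1 x y))"
    and \<theta>: "\<And>y. y \<in> V \<Longrightarrow> corr (V \<times> UNIV) (lift k0 k1) (y, False) (y, True) \<le> \<theta>" "0 \<le> \<theta>"
    and "C \<subseteq> V"
  shows "mix (V - C) p m (\<lambda>_. 1) / mix V p m (\<lambda>_. 1)
    \<le> (1 + \<theta>) ^ card C * (mix (V - C) p p (\<lambda>_. 1) / mix V p p (\<lambda>_. 1))"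
  using finite_subset[OF \<open>C \<subseteq> V\<close> assms(1)] \<open>C \<subseteq> V\<close>
proof (induction C)
  case empty
  show ?case
    using mix_one_pos[OF assms(1), of p m] mix_one_pos[OF assms(1), of p p] by simp
next
  case (insert y C)
  let ?U = "V - insert y C"
  let ?h = "\<lambda>U. mix U p m (\<lambda>_. 1)" and ?g = "\<lambda>U. mix U p p (\<lambda>_. 1)"
  have pos: "0 < ?h U" "0 < ?g U" if "U \<subseteq> V" for U
    using finite_subset[OF that assms(1)] by (auto intro: mix_one_pos)
  have W: "V - C = insert y ?U" "?U \<subseteq> V" "y \<in> V" "y \<notin> ?U" "V - C \<subseteq> V"
    using insert by auto
  have "?g (V - C) * ?h ?U \<le> (1 + \<theta>) * (?h (V - C) * ?g ?U)"
    unfolding W(1) using W \<theta> by (intro mix_insert_ratio[OF assms(1) k p m]) auto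
  then have "?h ?U \<le> (1 + \<theta>) * (?h (V - C) * ?g ?U) / ?g (V - C)"
    using pos(2)[OF W(5)] by (simp add: field_simps)
  then have "?h ?U / ?h V \<le> (1 + \<theta>) * (?h (V - C) * ?g ?U) / ?g (V - C) / ?h V"
    using pos(1)[of V] by (intro divide_right_mono) auto
  also have "\<dots> = (1 + \<theta>) * (?h (V - C) / ?h V) * (?g ?U / ?g (V - C))"
    by (simp add: mult_ac)
  also have "\<dots> \<le> (1 + \<theta>) * ((1 + \<theta>) ^ card C * (?g (V - C) / ?g V)) * (?g ?U / ?g (V - C))"
    using insert \<theta>(2) pos(2)[OF W(2)] pos(2)[OF W(5)] by (intro mult_right_mono mult_left_mono) auto
  also have "\<dots> = (1 + \<theta>) ^ card (insert y C) * (?g ?U / ?g V)"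
    using insert.hyps pos(2)[OF W(5)] by simp
  finally show ?case .
qed

text \<open>Bernoulli's inequality for 1 - \<theta> / (1 + \<theta>). The linear form turns the
  defect into \<open>\<theta>\<close> times the mean cluster size.\<close>

lemma one_minus_le_inverse_power:
  assumes "0 \<le> (\<theta>::real)"
  shows "1 - of_nat n * \<theta> \<le> 1 / (1 + \<theta>) ^ n"
proof -
  have "\<theta> / (1 + \<theta>) \<le> \<theta>"
    using assms mult_left_mono[of 1 "1 + \<theta>" \<theta>] by (simp add: field_simps)
  then have "1 - of_nat n * \<theta> \<le> 1 + of_nat n * (- \<theta> / (1 + \<theta>))"
    using mult_left_mono[of "\<theta> / (1 + \<theta>)" \<theta> "of_nat n"] by simp
  also have "\<dots> \<le> (1 + (- \<theta> / (1 + \<theta>))) ^ n"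
    using assms by (intro Bernoulli_inequality) (simp add: field_simps)
  also have "1 + (- \<theta> / (1 + \<theta>)) = 1 / (1 + \<theta>)"
    using assms by (simp add: field_simps)
  finally show ?thesis
    by (simp add: power_one_over)
qed

(* R y is the weight of the clusters of a and b that contain y.  Lebowitz' inequality and the
   removal of the cluster bound R by the convolution SS plus a small multiple of R itself. *)
theorem double_cover_le_corr:
  assumes "finite V" and k: "\<And>x y. x \<in> V \<Longrightarrow> y \<in> V \<Longrightarrow> 0 \<le> k0 x y" "\<And>x y. x \<in> V \<Longrightarrow> y \<in> V \<Longrightarrow> 0 \<le> k1 x y"
    and ab: "a \<in> V" "b \<in> V"
    and T: "T = corr (V \<times> UNIV) (lift k0 k1)"
    and \<theta>: "\<And>y. y \<in> V \<Longrightarrow> T (y, False) (y, True) \<le> \<theta>"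
    and \<kappa>: "\<And>w. w \<in> V \<Longrightarrow> (\<Sum>y\<in>V. \<Sum>i\<in>UNIV. T (y, False) (w, i) * T (w, i) (y, True)) \<le> 1 / 2"
  shows "(\<Sum>i\<in>UNIV. \<Sum>j\<in>UNIV. T (a, i) (b, j)) / 2 - corr V (\<lambda>x y. k0 x y + k1 x y) a b
    \<le> \<theta> * (\<Sum>y\<in>V. \<Sum>i\<in>UNIV. \<Sum>j\<in>UNIV. T (a, i) (y, False) * T (b, j) (y, True)
                                + T (a, i) (y, True) * T (b, j) (y, False))"
proof -
  define p where "p = (\<lambda>x y. 2 * (k0 x y + k1 x y))"
  define m where "m = (\<lambda>x y. 2 * (k0 x y - k1 x y))"
  have pm: "\<bar>m x y\<bar> \<le> p x y" "0 \<le> p x y" if "x \<in> V" "y \<in> V" for x y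
    using k(1)[OF that] k(2)[OF that] by (auto simp: p_def m_def)
  have fin: "finite A" if "A \<subseteq> V" for A
    using that assms(1) finite_subset by blast
  let ?H = "V \<times> (UNIV :: bool set)"
  have H: "finite ?H"
    using assms(1) by simp
  have L: "0 \<le> lift k0 k1 u v" if "u \<in> ?H" "v \<in> ?H" for u v
    using that k by (auto simp: lift_def)
  have T0: "0 \<le> T u v" if "u \<in> ?H" "v \<in> ?H" for u v
    unfolding T using that by (intro corr_nonneg H L)
  have \<theta>0: "0 \<le> \<theta>"
    using \<theta>[OF ab(1)] T0[of "(a, False)" "(a, True)"] ab by simp
  let ?Cs = "{C. C \<subseteq> V \<and> a \<in> C \<and> b \<in> C}"
  let ?h = "\<lambda>U. mix U p m (\<lambda>_. 1)" and ?g = "\<lambda>U. mix U p p (\<lambda>_. 1)"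
  have finC: "finite ?Cs"
    using assms(1) by simp
  have hV: "0 < ?h V" "0 < ?g V"
    using assms(1) by (auto intro: mix_one_pos)
  \<comment> \<open>The share of the cluster \<open>C\<close> in the two-point function
    \<open>S\<close> of the cover.\<close>
  define q where "q C = 2 * cluster_weight p a b C * (?h (V - C) / ?h V)" for C
  have cw: "0 \<le> cluster_weight p a b C" if "C \<in> ?Cs" for C
    using that by (intro cluster_weight_nonneg fin pm(2)) auto
  have q0: "0 \<le> q C" if "C \<in> ?Cs" for C
    using cw[OF that] mix_one_pos[of "V - C" p m] assms(1) hV by (simp add: q_def)
  define S where "S = (\<Sum>i\<in>UNIV. \<Sum>j\<in>UNIV. T (a, i) (b, j)) / 2"
  have S: "S = (\<Sum>C\<in>?Cs. q C)"
    unfolding S_def T sum_corr_lift[OF assms(1) p_def m_def ab]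
    using mix_cluster[OF assms(1) ab, of p m "\<lambda>_. 1"]
    by (simp add: q_def sum_divide_distrib sum_distrib_left mult.assoc)
  have G: "corr V (\<lambda>x y. k0 x y + k1 x y) a b = (\<Sum>C\<in>?Cs. 2 * cluster_weight p a b C * (?g (V - C) / ?g V))"
    unfolding corr_eq_mix[OF assms(1) p_def ab]
    using mix_cluster[OF assms(1) ab, of p p "\<lambda>_. 1"]
    by (simp add: sum_divide_distrib sum_distrib_left mult.assoc)
  define R where "R y = (\<Sum>C\<in>?Cs. if y \<in> C then q C else 0)" for y
  have R0: "0 \<le> R y" for y
    unfolding R_def by (intro sum_nonneg) (use q0 in auto)
  have sumR: "(\<Sum>y\<in>V. f y * R y) = (\<Sum>C\<in>?Cs. q C * (\<Sum>y\<in>C. f y))" for f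
  proof -
    have "(\<Sum>y\<in>V. f y * R y) = (\<Sum>C\<in>?Cs. \<Sum>y\<in>V. if y \<in> C then f y * q C else 0)"
      unfolding R_def sum_distrib_left by (subst sum.swap) (intro sum.cong refl, simp)
    also have "\<dots> = (\<Sum>C\<in>?Cs. \<Sum>y\<in>C. f y * q C)"
    proof (rule sum.cong[OF refl])
      fix C assume "C \<in> ?Cs"
      then have "V \<inter> C = C" by auto
      then show "(\<Sum>y\<in>V. if y \<in> C then f y * q C else 0) = (\<Sum>y\<in>C. f y * q C)"
        using sum.inter_restrict[OF assms(1), of "\<lambda>y. f y * q C" C] by simp
    qed
    finally show ?thesis
      by (simp add: sum_distrib_left mult.commute)
  qed
  have first: "S - corr V (\<lambda>x y. k0 x y + k1 x y) a b \<le> \<theta> * (\<Sum>y\<in>V. R y)"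
  proof -
    have "q C - 2 * cluster_weight p a b C * (?g (V - C) / ?g V) \<le> \<theta> * (q C * card C)" if C: "C \<in> ?Cs" for C
    proof -
      have "q C \<le> (1 + \<theta>) ^ card C * (2 * cluster_weight p a b C * (?g (V - C) / ?g V))"
        using mult_left_mono[OF mix_Diff_ratio[OF assms(1) k p_def m_def \<theta>[unfolded T] \<theta>0, of C], of "2 * cluster_weight p a b C"]
          cw[OF C] C by (simp add: q_def mult_ac)
      then have "q C * (1 / (1 + \<theta>) ^ card C) \<le> 2 * cluster_weight p a b C * (?g (V - C) / ?g V)"
        using \<theta>0 by (simp add: pos_divide_le_eq mult_ac)
      moreover have "q C * (1 - card C * \<theta>) \<le> q C * (1 / (1 + \<theta>) ^ card C)"
        using one_minus_le_inverse_power[OF \<theta>0] q0[OF C] by (intro mult_left_mono)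
      ultimately show ?thesis
        by (simp add: algebra_simps)
    qed
    then have "S - corr V (\<lambda>x y. k0 x y + k1 x y) a b \<le> (\<Sum>C\<in>?Cs. \<theta> * (q C * card C))"
      unfolding S G sum_subtractf[symmetric] by (rule sum_mono)
    also have "\<dots> = \<theta> * (\<Sum>y\<in>V. R y)"
      using sumR[of "\<lambda>_. 1"] by (simp add: sum_distrib_left)
    finally show ?thesis .
  qed
  \<comment> \<open>Bounds what the correlation between the two points over \<open>y\<close> loses
    when the fibre over \<open>w\<close> is removed.\<close>
  define c where "c y w = (\<Sum>i\<in>UNIV. T (y, False) (w, i) * T (w, i) (y, True))" for y w
  have c0: "0 \<le> c y w" if "y \<in> V" "w \<in> V" for y w
    unfolding c_def using that by (intro sum_nonneg mult_nonneg_nonneg T0) auto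
  define SS where "SS y = (\<Sum>i\<in>UNIV. \<Sum>j\<in>UNIV. T (a, i) (y, False) * T (b, j) (y, True)
                                + T (a, i) (y, True) * T (b, j) (y, False)) / 2" for y
  \<comment> \<open>The sign of \<open>y\<close> has mean 1 given a cluster through
    \<open>y\<close>, and otherwise at least the fibre correlation minus the loss due to the
    cluster. Lebowitz' inequality bounds the total by \<open>S\<close> times the fibre correlation
    plus \<open>SS y\<close>; the main terms cancel and a bound on \<open>R y\<close> is
    left.\<close>
  have second: "R y \<le> SS y + (\<Sum>w\<in>V. c y w * R w)" if y: "y \<in> V" for y
  proof -
    let ?e = "\<lambda>A. if y \<in> A then 1 else - 1 :: real"
    let ?X = "2 * mix V p m (\<lambda>A. corr0 A p a b * ?e A) / ?h V"
    let ?T = "T (y, False) (y, True)"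
    have "?X = (\<Sum>i\<in>UNIV. \<Sum>j\<in>UNIV. wavg ?H (lift k0 k1)
      (\<lambda>\<Omega>. spin \<Omega> (a, i) * spin \<Omega> (b, j) * spin \<Omega> (y, False) * spin \<Omega> (y, True)) / zsum ?H (lift k0 k1)) / 2"
      unfolding sum_divide_distrib[symmetric] sum_four_lift[OF assms(1) p_def m_def ab y]
        zsum_lift[OF assms(1) p_def m_def] by simp
    also have "\<dots> \<le> (\<Sum>i\<in>UNIV. \<Sum>j\<in>UNIV. T (a, i) (b, j) * ?T
        + (T (a, i) (y, False) * T (b, j) (y, True) + T (a, i) (y, True) * T (b, j) (y, False))) / 2"
      using ab y lebowitz[OF H L] unfolding T
      by (intro divide_right_mono sum_mono) (simp_all add: add.assoc[symmetric])
    also have "\<dots> = S * ?T + SS y"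
      unfolding S_def SS_def sum.distrib by (simp add: sum_distrib_right add_divide_distrib)
    finally have X_le: "?X \<le> S * ?T + SS y" .
    have "?X = (\<Sum>C\<in>?Cs. 2 * cluster_weight p a b C * (mix (V - C) p m (\<lambda>A. ?e (A \<union> C)) / ?h V))"
      unfolding mix_cluster[OF assms(1) ab] by (simp add: sum_distrib_left sum_divide_distrib mult.assoc)
    moreover have "(if y \<in> C then q C else 0) + q C * ?T - q C * (\<Sum>w\<in>C. c y w)
        \<le> 2 * cluster_weight p a b C * (mix (V - C) p m (\<lambda>A. ?e (A \<union> C)) / ?h V)" if C: "C \<in> ?Cs" for C
    proof (cases "y \<in> C")
      case True
      \<comment> \<open>Here the sign of \<open>y\<close> is always 1, so the additional fibre
        correlation must be absorbed by the removal terms; the term of \<open>y\<close> itself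
        suffices.\<close>
      have "?T \<le> c y y"
      proof -
        have "T (y, False) (y, False) = 1"
          unfolding T using H by (rule corr_refl)
        then show ?thesis
          unfolding c_def using T0[of "(y, False)" "(y, True)"] T0[of "(y, True)" "(y, True)"] y
          by (simp add: UNIV_bool)
      qed
      also have "c y y \<le> (\<Sum>w\<in>C. c y w)"
        using True C c0[OF y] fin[of C] by (intro member_le_sum) auto
      finally have "q C * ?T \<le> q C * (\<Sum>w\<in>C. c y w)"
        using q0[OF C] by (intro mult_left_mono)
      then show ?thesis
        using True by (simp add: q_def)
    next
      case False
      let ?W = "(V - C) \<times> (UNIV :: bool set)"
      let ?t = "corr ?W (lift k0 k1) (y, False) (y, True)"
      have W: "?W = ?H - C \<times> UNIV"
        by auto
      have "?T \<le> corr (?H - C \<times> UNIV) (lift k0 k1) (y, False) (y, True)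
          + (\<Sum>g\<in>C \<times> UNIV. corr ?H (lift k0 k1) (y, False) g * corr ?H (lift k0 k1) g (y, True))"
        unfolding T using C False y fin[of C] by (intro corr_remove_set[OF H L]) auto
      also have "\<dots> = ?t + (\<Sum>w\<in>C. c y w)"
        unfolding W c_def T using sum.cartesian_product[of "\<lambda>w i. corr ?H (lift k0 k1) (y, False) (w, i) * corr ?H (lift k0 k1) (w, i) (y, True)" UNIV C]
        by (simp add: case_prod_beta)
      finally have "q C * ?T \<le> q C * (?t + (\<Sum>w\<in>C. c y w))"
        using q0[OF C] by (intro mult_left_mono)
      moreover have "mix (V - C) p m (\<lambda>A. ?e (A \<union> C)) = ?t * ?h (V - C)"
        using corr_lift_fibre[OF _ p_def m_def, of "V - C" y] assms(1) False y mix_one_pos[of "V - C" p m]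
        by simp
      then have "2 * cluster_weight p a b C * (mix (V - C) p m (\<lambda>A. ?e (A \<union> C)) / ?h V) = q C * ?t"
        by (simp add: q_def)
      ultimately show ?thesis
        using False by (simp add: algebra_simps)
    qed
    ultimately have "(\<Sum>C\<in>?Cs. (if y \<in> C then q C else 0) + q C * ?T - q C * (\<Sum>w\<in>C. c y w)) \<le> ?X"
      by (metis (no_types, lifting) sum_mono)
    then have "R y + S * ?T - (\<Sum>w\<in>V. c y w * R w) \<le> ?X"
      unfolding sumR sum_subtractf sum.distrib R_def[symmetric] S sum_distrib_right .
    then show ?thesis
      using X_le by linarith
  qed
  have "(\<Sum>y\<in>V. R y) \<le> (\<Sum>y\<in>V. SS y) + (\<Sum>y\<in>V. \<Sum>w\<in>V. c y w * R w)"
    unfolding sum.distrib[symmetric] by (intro sum_mono second)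
  also have "(\<Sum>y\<in>V. \<Sum>w\<in>V. c y w * R w) = (\<Sum>w\<in>V. (\<Sum>y\<in>V. c y w) * R w)"
    by (subst sum.swap) (simp add: sum_distrib_right)
  \<comment> \<open>The total weight has been bounded by itself; the factor 1 / 2 leaves half of it
    on the left and produces the factor 2 in front of \<open>SS\<close>.\<close>
  also have "\<dots> \<le> (\<Sum>w\<in>V. 1 / 2 * R w)"
    using \<kappa> R0 unfolding c_def by (intro sum_mono mult_right_mono) auto
  finally have "(\<Sum>y\<in>V. R y) \<le> 2 * (\<Sum>y\<in>V. SS y)"
    by (simp add: sum_divide_distrib[symmetric])
  then have "\<theta> * (\<Sum>y\<in>V. R y) \<le> \<theta> * (2 * (\<Sum>y\<in>V. SS y))"
    using \<theta>0 by (rule mult_left_mono)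
  then show ?thesis
    using first unfolding S_def SS_def by (simp add: sum_divide_distrib[symmetric])
qed

section \<open>Embeddings and quotients of graphs\<close>

lemma avg_image:
  assumes "inj_on \<phi> V"
  shows "avg (\<phi> ` V) f = avg V (\<lambda>\<sigma>. f (\<phi> ` \<sigma>))"
proof -
  have "inj_on ((`) \<phi>) (Pow V)"
    using assms by (rule inj_on_image_Pow)
  then show ?thesis
    using assms by (simp add: avg_def image_Pow_surj[OF refl, symmetric] sum.reindex card_image)
qed

lemma spin_image: "inj_on \<phi> V \<Longrightarrow> \<sigma> \<subseteq> V \<Longrightarrow> a \<in> V \<Longrightarrow> spin (\<phi> ` \<sigma>) (\<phi> a) = spin \<sigma> a"
  by (auto simp: spin_def inj_on_def)

lemma corr_image:
  assumes "inj_on \<phi> V" "a \<in> V" "b \<in> V"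
  shows "corr (\<phi> ` V) k (\<phi> a) (\<phi> b) = corr V (\<lambda>a b. k (\<phi> a) (\<phi> b)) a b"
proof -
  have E: "energy (\<phi> ` V) k (\<phi> ` \<sigma>) = energy V (\<lambda>a b. k (\<phi> a) (\<phi> b)) \<sigma>" if "\<sigma> \<subseteq> V" for \<sigma>
    unfolding energy_def sum.reindex[OF assms(1)] comp_def
    by (intro sum.cong refl) (simp add: spin_image[OF assms(1) that])
  show ?thesis
    unfolding corr_def two_def zsum_def wavg_def avg_image[OF assms(1)]
    using E assms by (intro arg_cong2[of _ _ _ _ "(/)"] avg_cong) (simp_all add: spin_image)
qed

lemma corr_embed:
  assumes "finite W" "inj_on \<phi> V" "\<phi> ` V \<subseteq> W" "a \<in> V" "b \<in> V"
    and "\<And>x y. x \<in> V \<Longrightarrow> y \<in> V \<Longrightarrow> 0 \<le> k x y"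
    and "\<And>x y. x \<in> V \<Longrightarrow> y \<in> V \<Longrightarrow> k x y \<le> l (\<phi> x) (\<phi> y)"
    and "\<And>x y. x \<in> W \<Longrightarrow> y \<in> W \<Longrightarrow> 0 \<le> l x y"
  shows "corr V k a b \<le> corr W l (\<phi> a) (\<phi> b)"
proof -
  have "finite V"
    using assms(1-3) by (metis finite_imageD finite_subset)
  then have "corr V k a b \<le> corr V (\<lambda>a b. l (\<phi> a) (\<phi> b)) a b"
    using assms by (intro corr_mono) auto
  also have "\<dots> = corr (\<phi> ` V) l (\<phi> a) (\<phi> b)"
    using assms by (simp add: corr_image)
  also have "\<dots> \<le> corr W l (\<phi> a) (\<phi> b)"
    using assms by (intro corr_subset_mono) auto
  finally show ?thesis .
qed

lemma avg_split:
  assumes "finite V" "W \<subseteq> V"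
  shows "avg V f = avg W (\<lambda>\<sigma>. avg (V - W) (\<lambda>\<eta>. f (\<sigma> \<union> \<eta>)))"
proof -
  have "(\<Sum>\<sigma>\<in>Pow V. f \<sigma>) = (\<Sum>(\<sigma>, \<eta>)\<in>Pow W \<times> Pow (V - W). f (\<sigma> \<union> \<eta>))"
    by (rule sum.reindex_bij_witness[where i = "\<lambda>(\<sigma>, \<eta>). \<sigma> \<union> \<eta>" and j = "\<lambda>\<sigma>. (\<sigma> \<inter> W, \<sigma> \<inter> (V - W))"])
      (use assms(2) in \<open>auto intro!: arg_cong[of _ _ f]\<close>)
  also have "\<dots> = (\<Sum>\<sigma>\<in>Pow W. \<Sum>\<eta>\<in>Pow (V - W). f (\<sigma> \<union> \<eta>))"
    by (simp add: sum.cartesian_product)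
  moreover have "(2::real) ^ card V = 2 ^ card (V - W) * 2 ^ card W"
    using assms by (metis card_Diff_subset card_mono le_add_diff_inverse2 power_add finite_subset)
  ultimately show ?thesis
    by (simp add: avg_def sum_divide_distrib)
qed

(* Identifying each v with \<pi> v corresponds to infinitely strong couplings, so correlations increase.
   Conditionally on the relative spins \<eta> of v and \<pi> v the model on V is a model on W. *)
lemma corr_quotient:
  assumes "finite V" and k: "\<And>a b. a \<in> V \<Longrightarrow> b \<in> V \<Longrightarrow> 0 \<le> k a b"
    and W: "W \<subseteq> V" "\<And>v. v \<in> V \<Longrightarrow> \<pi> v \<in> W" "\<And>w. w \<in> W \<Longrightarrow> \<pi> w = w"
    and ab: "a \<in> W" "b \<in> W"
  shows "corr V k a b
    \<le> corr W (\<lambda>x y. \<Sum>u | u \<in> V \<and> \<pi> u = x. \<Sum>v | v \<in> V \<and> \<pi> v = y. k u v) a b"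
proof -
  define e where "e \<eta> v = (if v \<in> W then 1 else spin \<eta> v)" for \<eta> v
  define l where "l \<eta> x y = (\<Sum>u | u \<in> V \<and> \<pi> u = x. \<Sum>v | v \<in> V \<and> \<pi> v = y. k u v * (e \<eta> u * e \<eta> v))" for \<eta> x y
  let ?l = "\<lambda>x y. \<Sum>u | u \<in> V \<and> \<pi> u = x. \<Sum>v | v \<in> V \<and> \<pi> v = y. k u v"
  \<comment> \<open>The spin of \<open>v\<close> becomes its relative spin in \<open>\<eta>\<close>
    times the spin of \<open>\<pi> v\<close>, so the spins outside \<open>W\<close> flip along with
    their representatives.\<close>
  define J where "J \<sigma> \<eta> = \<sigma> \<union> sym_diff \<eta> {v \<in> V - W. \<pi> v \<notin> \<sigma>}" for \<sigma> \<eta>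
  have fin: "finite W"
    using W(1) assms(1) finite_subset by blast
  have spinJ: "spin (J \<sigma> \<eta>) v = e \<eta> v * spin \<sigma> (\<pi> v)" if "\<sigma> \<subseteq> W" "\<eta> \<subseteq> V - W" "v \<in> V" for \<sigma> \<eta> v
    using that W by (auto simp: J_def spin_def e_def)
  have avgJ: "avg V f = avg (V - W) (\<lambda>\<eta>. avg W (\<lambda>\<sigma>. f (J \<sigma> \<eta>)))" for f :: "'a set \<Rightarrow> real"
  proof -
    have "avg V f = avg W (\<lambda>\<sigma>. avg (V - W) (\<lambda>\<eta>. f (\<sigma> \<union> \<eta>)))"
      by (rule avg_split[OF assms(1) W(1)])
    also have "\<dots> = avg W (\<lambda>\<sigma>. avg (V - W) (\<lambda>\<eta>. f (J \<sigma> \<eta>)))"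
      unfolding J_def by (intro avg_cong avg_shift[symmetric]) auto
    also have "\<dots> = avg (V - W) (\<lambda>\<eta>. avg W (\<lambda>\<sigma>. f (J \<sigma> \<eta>)))"
      by (rule avg_swap)
    finally show ?thesis .
  qed
  have group: "(\<Sum>u\<in>V. f u) = (\<Sum>x\<in>W. \<Sum>u | u \<in> V \<and> \<pi> u = x. f u)" for f :: "'a \<Rightarrow> real"
    using sum.group[OF assms(1) fin, of \<pi> f] W(2) by (simp add: image_subset_iff)
  have energyJ: "energy V k (J \<sigma> \<eta>) = energy W (l \<eta>) \<sigma>" if "\<sigma> \<subseteq> W" "\<eta> \<subseteq> V - W" for \<sigma> \<eta>
  proof -
    have "energy V k (J \<sigma> \<eta>)
        = (\<Sum>u\<in>V. \<Sum>v\<in>V. k u v * (e \<eta> u * e \<eta> v) * (spin \<sigma> (\<pi> u) * spin \<sigma> (\<pi> v)))"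
      unfolding energy_def by (intro sum.cong refl) (simp add: spinJ[OF that] mult_ac)
    also have "\<dots> = (\<Sum>u\<in>V. \<Sum>y\<in>W. \<Sum>v | v \<in> V \<and> \<pi> v = y.
        k u v * (e \<eta> u * e \<eta> v) * (spin \<sigma> (\<pi> u) * spin \<sigma> (\<pi> v)))"
      by (intro sum.cong refl group)
    also have "\<dots> = (\<Sum>x\<in>W. \<Sum>u | u \<in> V \<and> \<pi> u = x. \<Sum>y\<in>W. \<Sum>v | v \<in> V \<and> \<pi> v = y.
        k u v * (e \<eta> u * e \<eta> v) * (spin \<sigma> (\<pi> u) * spin \<sigma> (\<pi> v)))"
      by (rule group)
    also have "\<dots> = (\<Sum>x\<in>W. \<Sum>y\<in>W. \<Sum>u | u \<in> V \<and> \<pi> u = x. \<Sum>v | v \<in> V \<and> \<pi> v = y.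
        k u v * (e \<eta> u * e \<eta> v) * (spin \<sigma> (\<pi> u) * spin \<sigma> (\<pi> v)))"
      by (rule sum.cong[OF refl]) (rule sum.swap)
    also have "\<dots> = energy W (l \<eta>) \<sigma>"
      unfolding energy_def l_def sum_distrib_right by (intro sum.cong refl) auto
    finally show ?thesis .
  qed
  have Z: "zsum V k = avg (V - W) (\<lambda>\<eta>. zsum W (l \<eta>))"
    unfolding zsum_def wavg_def avgJ by (intro avg_cong) (simp add: energyJ)
  have abs_l: "\<bar>l \<eta> x y\<bar> \<le> ?l x y" for \<eta> x y
  proof -
    have "\<bar>k u v * (e \<eta> u * e \<eta> v)\<bar> \<le> k u v" if "u \<in> V" "v \<in> V" for u v
      using k[OF that] by (simp add: abs_mult e_def)
    then show ?thesis
      unfolding l_def by (intro order.trans[OF sum_abs] sum_mono order.trans[OF sum_abs]) auto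
  qed
  have "two V k a b = avg (V - W) (\<lambda>\<eta>. two W (l \<eta>) a b)"
    unfolding two_def wavg_def avgJ using ab W
    by (intro avg_cong) (auto simp: energyJ spinJ e_def subset_iff)
  also have "\<dots> \<le> avg (V - W) (\<lambda>\<eta>. corr W ?l a b * zsum W (l \<eta>))"
  proof (rule avg_mono)
    fix \<eta>
    have "corr W (l \<eta>) a b \<le> corr W ?l a b"
      by (rule order.trans[OF abs_ge_self abs_corr_le[OF fin abs_l ab]])
    then show "two W (l \<eta>) a b \<le> corr W ?l a b * zsum W (l \<eta>)"
      using zsum_pos[OF fin, of "l \<eta>"] by (simp add: two_eq_corr[OF fin])
  qed
  also have "\<dots> = corr W ?l a b * zsum V k"
    by (simp add: Z avg_cmult)
  finally show ?thesis
    unfolding corr_def using zsum_pos[OF assms(1), of k] by (simp add: pos_divide_le_eq corr_def)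
qed

lemma corr_energy_shift:
  assumes "\<And>\<sigma>. energy V k \<sigma> = energy V l \<sigma> + c"
  shows "corr V k a b = corr V l a b"
proof -
  have "wavg V k f = exp c * wavg V l f" for f
    unfolding wavg_def avg_cmult[symmetric] assms exp_add by (simp add: mult_ac)
  then show ?thesis
    by (simp add: corr_def two_def zsum_def)
qed

section \<open>Comparison with a subgraph\<close>

lemma sinh_le_mult_cosh:
  assumes "0 \<le> (x::real)"
  shows "sinh x \<le> x * cosh x"
proof -
  have "0 * cosh 0 - sinh 0 \<le> x * cosh x - sinh (x::real)"
  proof (rule DERIV_nonneg_imp_nondecreasing[OF assms])
    fix y :: real assume "0 \<le> y" "y \<le> x"
    then show "\<exists>d. ((\<lambda>x. x * cosh x - sinh x) has_real_derivative d) (at y) \<and> 0 \<le> d"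
      by (intro exI[of _ "y * sinh y"]) (auto intro!: derivative_eq_intros)
  qed
  then show ?thesis by simp
qed

(* A wired boundary: all couplings from S to its complement are attached to the vertex g. *)
lemma corr_star:
  assumes "finite S" "g \<notin> S" "a \<in> S"
    and k: "\<And>x y. x \<in> S \<Longrightarrow> y \<in> S \<Longrightarrow> 0 \<le> k x y" and h: "\<And>x. x \<in> S \<Longrightarrow> 0 \<le> h x"
  shows "corr (insert g S) (\<lambda>x y. if x \<in> S \<and> y \<in> S then k x y else if x \<in> S \<and> y = g then h x else 0) a g
    \<le> (\<Sum>u\<in>S. h u * corr S k a u)"
proof -
  let ?W = "insert g S"
  define K where "K X x y = (if x \<in> S \<and> y \<in> S then k x y else if x \<in> X \<and> y = g then h x else 0)" for X x y
  have W: "finite ?W"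
    using assms(1) by simp
  have K0: "0 \<le> K X x y" if "X \<subseteq> S" "x \<in> ?W" "y \<in> ?W" for X x y
    using that k h by (auto simp: K_def)
  have c0: "0 \<le> corr S k a u" if "u \<in> S" for u
    using that assms by (intro corr_nonneg) auto
  have "corr ?W (K X) a g \<le> (\<Sum>u\<in>X. h u * corr S k a u)" if "X \<subseteq> S" for X
    using finite_subset[OF that assms(1)] that
  proof (induction X)
    case empty
    \<comment> \<open>Nothing is attached to \<open>g\<close> yet, so flipping \<open>g\<close>
      alone preserves the energy and reverses the sign of the correlation.\<close>
    have "energy ?W (K {}) (sym_diff \<sigma> {g}) = energy ?W (K {}) \<sigma>" for \<sigma>
      unfolding energy_def using assms(2) by (intro sum.cong refl) (auto simp: K_def spin_sym_diff)
    then have "avg ?W (\<lambda>\<sigma>. spin (sym_diff \<sigma> {g}) a * spin (sym_diff \<sigma> {g}) g * exp (energy ?W (K {}) (sym_diff \<sigma> {g})))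
        = - two ?W (K {}) a g"
      using assms(2,3) avg_cmult[of ?W "- 1" "\<lambda>\<sigma>. spin \<sigma> a * spin \<sigma> g * exp (energy ?W (K {}) \<sigma>)"]
      by (auto simp: spin_sym_diff two_def wavg_def)
    then have "two ?W (K {}) a g = 0"
      using avg_shift[of "{g}" ?W "\<lambda>\<sigma>. spin \<sigma> a * spin \<sigma> g * exp (energy ?W (K {}) \<sigma>)"]
      by (simp add: two_def wavg_def)
    then show ?case
      by (simp add: corr_def)
  next
    case (insert u X)
    then have X: "X \<subseteq> S" "u \<in> S" "u \<notin> X" by auto
    have "K (insert u X) = (\<lambda>x y. K X x y + (if (x, y) = (u, g) then h u else 0))"
      using X assms(2) by (auto simp: K_def intro!: ext)
    note add = wavg_add_pair[OF W, of u g "K X" "h u", folded this]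
    define c s where "c = cosh (h u)" and "s = sinh (h u)"
    have two: "two ?W (K (insert u X)) a g = c * two ?W (K X) a g + s * two ?W (K X) a u"
    proof -
      have "(\<lambda>\<sigma>. spin \<sigma> u * spin \<sigma> g * (spin \<sigma> a * spin \<sigma> g)) = (\<lambda>\<sigma>. spin \<sigma> a * spin \<sigma> u)"
        by (intro ext) (simp add: spin_def)
      then show ?thesis
        using add[of "\<lambda>\<sigma>. spin \<sigma> a * spin \<sigma> g"] X by (simp add: two_def c_def s_def)
    qed
    have z: "zsum ?W (K (insert u X)) = c * zsum ?W (K X) + s * two ?W (K X) u g"
      using add[of "\<lambda>_. 1"] X by (simp add: two_def zsum_def c_def s_def)
    define ag ug au t where "ag = corr ?W (K X) a g" and "ug = corr ?W (K X) u g"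
      and "au = corr ?W (K X) a u" and "t = corr S k a u"
    have nn: "0 \<le> ag" "0 \<le> ug" "0 \<le> t"
      unfolding ag_def ug_def t_def using X K0 W assms(3) c0 by (auto intro!: corr_nonneg)
    have s: "0 \<le> s" "s \<le> h u * c" and c: "1 \<le> c"
      using h[OF X(2)] sinh_le_mult_cosh[OF h[OF X(2)]] by (auto simp: c_def s_def cosh_real_ge_1)
    \<comment> \<open>GHS with \<open>g\<close> itself removed: the truncated correlation is bounded
      by the correlation in \<open>S\<close>, no matter how many vertices are already attached to
      \<open>g\<close>.\<close>
    have "au \<le> corr (?W - {g}) (K X) a u + corr ?W (K X) a g * corr ?W (K X) g u"
      unfolding au_def using W K0 X assms(2,3) by (intro corr_remove_vertex) auto
    also have "corr (?W - {g}) (K X) a u = t"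
      unfolding t_def Diff_insert_absorb[OF assms(2)] by (rule corr_cong) (simp add: K_def)
    finally have au: "au - ag * ug \<le> t"
      by (simp add: ag_def ug_def corr_commute)
    have "corr ?W (K (insert u X)) a g
        = (zsum ?W (K X) * (c * ag + s * au)) / (zsum ?W (K X) * (c + s * ug))"
      unfolding corr_def[of ?W "K (insert u X)"] two z
      unfolding two_eq_corr[OF W] ag_def au_def ug_def
      by (simp add: algebra_simps)
    also have "\<dots> = (c * ag + s * au) / (c + s * ug)"
      using W by simp
    also have "(c * ag + s * au) / (c + s * ug) \<le> ag + h u * t"
    proof -
      have "s * (au - ag * ug) \<le> s * t"
        using au s by (intro mult_left_mono)
      also have "\<dots> \<le> h u * c * t"
        using s nn by (intro mult_right_mono)
      also have "\<dots> \<le> h u * t * (c + s * ug)"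
        using h[OF X(2)] nn s by (simp add: algebra_simps)
      finally have "c * ag + s * au \<le> (ag + h u * t) * (c + s * ug)"
        by (simp add: algebra_simps)
      moreover have "0 < c + s * ug"
        using c s nn by (simp add: add_pos_nonneg)
      ultimately show ?thesis
        by (simp add: pos_divide_le_eq)
    qed
    also have "ag \<le> (\<Sum>u\<in>X. h u * corr S k a u)"
      unfolding ag_def using insert by auto
    finally show ?case
      using insert.hyps by (simp add: t_def)
  qed
  from this[of S] show ?thesis
    unfolding K_def[abs_def] by simp
qed

text \<open>All vertices outside \<open>S\<close> are identified with \<open>g\<close>, which only
  increases correlations. \<open>corr_star\<close> bounds the correlation from \<open>a\<close> to
  \<open>g\<close>, and removing \<open>g\<close> by GHS leaves the model on \<open>S\<close>. The
  result resembles the Simon-Lieb inequality with the outer correlation bounded by 1.\<close>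

theorem corr_le_subgraph:
  assumes "finite V" and k: "\<And>x y. x \<in> V \<Longrightarrow> y \<in> V \<Longrightarrow> 0 \<le> k x y"
    and S: "S \<subseteq> V" "a \<in> S" "b \<in> V"
  shows "corr V k a b \<le> corr0 S k a b + (\<Sum>u\<in>S. (\<Sum>v\<in>V - S. k u v + k v u) * corr S k a u)"
proof (cases "V = S")
  case True
  then show ?thesis
    using S by (simp add: corr0_def)
next
  case False
  \<comment> \<open>If \<open>b\<close> lies outside \<open>S\<close>, it becomes the representative
    itself, so that its correlation with \<open>a\<close> is the one to \<open>g\<close>.\<close>
  define g where "g = (if b \<in> S then SOME g. g \<in> V - S else b)"
  have "\<exists>g. g \<in> V - S"
    using False S by blast
  then have g: "g \<in> V - S"
    using someI_ex[of "\<lambda>g. g \<in> V - S"] S by (auto simp: g_def)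
  have gS: "g \<notin> S"
    using g by simp
  have fin: "finite S"
    using S assms(1) finite_subset by blast
  let ?W = "insert g S"
  define \<pi> where "\<pi> v = (if v \<in> S then v else g)" for v
  define h where "h u = (\<Sum>v\<in>V - S. k u v + k v u)" for u
  let ?l = "\<lambda>x y. \<Sum>u | u \<in> V \<and> \<pi> u = x. \<Sum>v | v \<in> V \<and> \<pi> v = y. k u v"
  let ?K = "\<lambda>x y. if x \<in> S \<and> y \<in> S then k x y else if x \<in> S \<and> y = g then h x else 0"
  have fib: "{u \<in> V. \<pi> u = x} = (if x \<in> S then {x} else V - S)" if "x \<in> ?W" for x
    using that g S by (auto simp: \<pi>_def split: if_splits)
  have h0: "0 \<le> h u" if "u \<in> S" for u
    unfolding h_def using that S k by (intro sum_nonneg add_nonneg_nonneg) auto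
  \<comment> \<open>Pairs outside \<open>S\<close> contribute the constant \<open>?l g g\<close>,
    and the two orders of a boundary pair merge into \<open>h\<close>; this changes no
    correlation.\<close>
  have eq: "corr ?W ?l x y = corr ?W ?K x y" for x y
  proof (rule corr_energy_shift)
    fix \<sigma>
    have "energy ?W ?l \<sigma> = energy S k \<sigma> + (\<Sum>x\<in>S. (\<Sum>v\<in>V - S. k x v) * (spin \<sigma> x * spin \<sigma> g))
        + (\<Sum>x\<in>S. (\<Sum>v\<in>V - S. k v x) * (spin \<sigma> x * spin \<sigma> g)) + ?l g g"
      using g fin by (simp add: energy_def fib sum.distrib mult_ac)
    moreover have "energy ?W ?K \<sigma> = energy S k \<sigma> + (\<Sum>x\<in>S. h x * (spin \<sigma> x * spin \<sigma> g))"
      using g fin by (simp add: energy_def sum.distrib)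
    ultimately show "energy ?W ?l \<sigma> = energy ?W ?K \<sigma> + ?l g g"
      by (simp add: h_def sum.distrib distrib_right)
  qed
  have K0: "0 \<le> ?K x y" if "x \<in> ?W" "y \<in> ?W" for x y
    using that S(1) by (auto intro!: k h0)
  have star: "corr ?W ?K a g \<le> (\<Sum>u\<in>S. h u * corr S k a u)"
    using fin g S(1,2) by (intro corr_star k h0) auto
  have le: "corr V k a y \<le> corr ?W ?K a y" if "y \<in> ?W" for y
    unfolding eq[symmetric] using that S g by (intro corr_quotient[OF assms(1) k]) (auto simp: \<pi>_def)
  show ?thesis
  proof (cases "b \<in> S")
    case False
    then have "g = b"
      by (simp add: g_def)
    then show ?thesis
      using le[of g] star False by (simp add: corr0_def h_def)
  next
    case True
    have "corr V k a b \<le> corr ?W ?K a b"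
      using True by (intro le) simp
    also have "\<dots> \<le> corr (?W - {g}) ?K a b + corr ?W ?K a g * corr ?W ?K g b"
      using fin K0 True S g by (intro corr_remove_vertex) auto
    also have "corr (?W - {g}) ?K a b = corr S k a b"
      unfolding Diff_insert_absorb[OF gS] by (rule corr_cong) simp
    also have "corr ?W ?K a g * corr ?W ?K g b \<le> corr ?W ?K a g * 1"
      using fin S K0 by (intro mult_left_mono corr_le_1 corr_nonneg) auto
    finally show ?thesis
      using star True S by (simp add: corr0_def h_def)
  qed
qed

section \<open>Discrete tori\<close>

definition latt :: "('d::finite \<Rightarrow> nat) \<Rightarrow> (int ^ 'd) set" where
  "latt L = {z. \<forall>i. int (L i) dvd z $ i}"

definition cell :: "('d::finite \<Rightarrow> nat) \<Rightarrow> (int ^ 'd) set" where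
  "cell L = {x. \<forall>i. 0 \<le> x $ i \<and> x $ i < int (L i)}"

definition red :: "('d::finite \<Rightarrow> nat) \<Rightarrow> int ^ 'd \<Rightarrow> int ^ 'd" where
  "red L x = (\<chi> i. x $ i mod int (L i))"

text \<open>A count rather than a truth value: for periods 1 and 2 different unit steps coincide
  modulo \<open>L\<close>, and with multiplicities the coupling still splits exactly over the fibres
  of a cover.\<close>

definition steps :: "('d::finite \<Rightarrow> nat) \<Rightarrow> int ^ 'd \<Rightarrow> real" where
  "steps L z = (\<Sum>i\<in>UNIV. of_bool (z - axis i 1 \<in> latt L) + of_bool (z + axis i 1 \<in> latt L))"

definition torus_coupling :: "('d::finite \<Rightarrow> nat) \<Rightarrow> real \<Rightarrow> int ^ 'd \<Rightarrow> int ^ 'd \<Rightarrow> real" where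
  "torus_coupling L \<beta> a b = \<beta> / 2 * steps L (b - a)"

definition torus_corr :: "('d::finite \<Rightarrow> nat) \<Rightarrow> real \<Rightarrow> int ^ 'd \<Rightarrow> real" where
  "torus_corr L \<beta> x = corr (cell L) (torus_coupling L \<beta>) 0 (red L x)"

section \<open>Period lattices, reduction to a cell and translation invariance\<close>

lemma latt_add: "u \<in> latt L \<Longrightarrow> v \<in> latt L \<Longrightarrow> u + v \<in> latt L"
  by (simp add: latt_def)

lemma latt_diff: "u \<in> latt L \<Longrightarrow> v \<in> latt L \<Longrightarrow> u - v \<in> latt L"
  by (simp add: latt_def)

lemma latt_trans: "u - v \<in> latt L \<Longrightarrow> v - w \<in> latt L \<Longrightarrow> u - w \<in> latt L"
  using latt_add[of "u - v" L "v - w"] by simp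

lemma latt_uminus_iff [simp]: "- u \<in> latt L \<longleftrightarrow> u \<in> latt L"
  by (simp add: latt_def)

lemma latt_reflect: "u - v \<in> latt L \<Longrightarrow> (c - u) - (c - v) \<in> latt L"
  using latt_uminus_iff[of "u - v" L] by (simp del: latt_uminus_iff)

lemma latt_0 [simp]: "0 \<in> latt L"
  by (simp add: latt_def)

lemma latt_add_iff: "u \<in> latt L \<Longrightarrow> v + u \<in> latt L \<longleftrightarrow> v \<in> latt L"
  using latt_add[of v L u] latt_diff[of "v + u" L u] by auto

lemma latt_cong:
  assumes "u - v \<in> latt L"
  shows "u \<in> latt L \<longleftrightarrow> v \<in> latt L"
  using latt_add_iff[OF assms, of v] by simp

lemma steps_cong:
  assumes "u - v \<in> latt L"
  shows "steps L u = steps L v"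
  unfolding steps_def using assms
  by (intro sum.cong refl arg_cong2[of _ _ _ _ "(+)"] arg_cong[of _ _ of_bool] latt_cong) simp_all

lemma steps_uminus: "steps L (- z) = steps L z"
proof -
  have "- z - axis i 1 \<in> latt L \<longleftrightarrow> z + axis i 1 \<in> latt L" "- z + axis i 1 \<in> latt L \<longleftrightarrow> z - axis i 1 \<in> latt L" for i
    using latt_uminus_iff[of "z + axis i 1" L] latt_uminus_iff[of "z - axis i 1" L]
    by (simp_all del: latt_uminus_iff)
  then show ?thesis
    by (simp add: steps_def add.commute)
qed

lemma steps_nonneg: "0 \<le> steps L z"
  by (simp add: steps_def sum_nonneg)

lemma torus_coupling_nonneg: "0 \<le> \<beta> \<Longrightarrow> 0 \<le> torus_coupling L \<beta> a b"
  by (simp add: torus_coupling_def steps_nonneg)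

lemma torus_coupling_cong:
  assumes "a - a' \<in> latt L" "b - b' \<in> latt L"
  shows "torus_coupling L \<beta> a b = torus_coupling L \<beta> a' b'"
  unfolding torus_coupling_def using latt_diff[OF assms(2,1)]
  by (intro arg_cong2[of _ _ _ _ "(*)"] refl steps_cong) (simp add: algebra_simps)

lemma red_diff_latt: "red L x - x \<in> latt L"
  by (simp add: latt_def red_def) (metis dvd_minus_mod minus_diff_eq dvd_minus_iff)

lemma red_eq_iff: "red L x = red L y \<longleftrightarrow> x - y \<in> latt L"
  by (simp add: red_def latt_def vec_eq_iff mod_eq_dvd_iff)

lemma red_cell:
  assumes "\<And>i. 0 < L i"
  shows "red L x \<in> cell L"
  using assms by (simp add: red_def cell_def)

lemma red_id: "x \<in> cell L \<Longrightarrow> red L x = x"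
  by (simp add: red_def cell_def vec_eq_iff)

lemma finite_cell: "finite (cell L)"
proof -
  have "cell L \<subseteq> vec_lambda ` (UNIV \<rightarrow>\<^sub>E {0..<Max (range (int \<circ> L))})"
  proof
    fix x assume "x \<in> cell L"
    then have "vec_nth x \<in> UNIV \<rightarrow>\<^sub>E {0..<Max (range (int \<circ> L))}"
      by (auto simp: cell_def PiE_def intro!: order.strict_trans2[OF _ Max_ge])
    then show "x \<in> vec_lambda ` (UNIV \<rightarrow>\<^sub>E {0..<Max (range (int \<circ> L))})"
      by (metis image_eqI vec_nth_inverse)
  qed
  then show ?thesis
    by (rule finite_subset) (simp add: finite_PiE)
qed

lemma bij_betw_shift_cell:
  assumes "\<And>i. 0 < L i"
  shows "bij_betw (\<lambda>x. red L (x + c)) (cell L) (cell L)"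
proof (rule bij_betw_byWitness[where f' = "\<lambda>x. red L (x - c)"])
  have "red L (red L (x + c) - c) = red L x" "red L (red L (x - c) + c) = red L x" for x
    using red_diff_latt[of L "x + c"] red_diff_latt[of L "x - c"]
    by (simp_all add: red_eq_iff algebra_simps)
  then show "\<forall>x\<in>cell L. red L (red L (x + c) - c) = x" "\<forall>x\<in>cell L. red L (red L (x - c) + c) = x"
    by (simp_all add: red_id)
qed (use red_cell[OF assms] in auto)

lemma bij_betw_reflect_cell:
  assumes "\<And>i. 0 < L i"
  shows "bij_betw (\<lambda>x. red L (c - x)) (cell L) (cell L)"
proof (rule bij_betw_byWitness[where f' = "\<lambda>x. red L (c - x)"])
  have "red L (c - red L (c - x)) = red L x" for x
    using latt_uminus_iff[of "red L (c - x) - (c - x)" L] red_diff_latt[of L "c - x"]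
    by (simp add: red_eq_iff algebra_simps del: latt_uminus_iff)
  then show "\<forall>x\<in>cell L. red L (c - red L (c - x)) = x" "\<forall>x\<in>cell L. red L (c - red L (c - x)) = x"
    by (simp_all add: red_id)
qed (use red_cell[OF assms] in auto)

lemma torus_corr_cong: "x - y \<in> latt L \<Longrightarrow> torus_corr L \<beta> x = torus_corr L \<beta> y"
  using red_eq_iff[of L x y] by (simp add: torus_corr_def)

lemma zero_cell: "(\<And>i. 0 < L i) \<Longrightarrow> 0 \<in> cell L"
  by (simp add: cell_def)

text \<open>The reduced translation by \<open>a\<close> permutes the cell and preserves the
  couplings.\<close>

lemma corr_torus:
  assumes "\<And>i. 0 < L i"
  shows "corr (cell L) (torus_coupling L \<beta>) (red L a) (red L b) = torus_corr L \<beta> (b - a)"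
proof -
  let ?\<phi> = "\<lambda>x. red L (x + a)" and ?k = "torus_coupling L \<beta>"
  have bij: "bij_betw ?\<phi> (cell L) (cell L)"
    by (rule bij_betw_shift_cell[OF assms])
  have "corr (?\<phi> ` cell L) ?k (?\<phi> 0) (?\<phi> (red L (b - a))) = corr (cell L) (\<lambda>x y. ?k (?\<phi> x) (?\<phi> y)) 0 (red L (b - a))"
    using bij assms by (intro corr_image) (auto simp: bij_betw_def red_cell zero_cell)
  moreover have "?\<phi> ` cell L = cell L"
    using bij by (simp add: bij_betw_def)
  moreover have "?\<phi> (red L (b - a)) = red L b"
    using red_diff_latt[of L "b - a"] by (simp add: red_eq_iff algebra_simps)
  moreover have "?k (?\<phi> x) (?\<phi> y) = ?k x y" for x y
  proof -
    have "?k (?\<phi> x) (?\<phi> y) = ?k (x + a) (y + a)"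
      by (intro torus_coupling_cong red_diff_latt)
    then show ?thesis
      by (simp add: torus_coupling_def)
  qed
  ultimately show ?thesis
    by (simp add: torus_corr_def)
qed

lemma torus_corr_uminus:
  assumes "\<And>i. 0 < L i"
  shows "torus_corr L \<beta> (- x) = torus_corr L \<beta> x"
  using corr_torus[of L \<beta> 0 x] corr_torus[of L \<beta> x 0] assms by (simp add: corr_commute)

lemma torus_corr_nonneg:
  assumes "\<And>i. 0 < L i" "0 \<le> \<beta>"
  shows "0 \<le> torus_corr L \<beta> x"
  unfolding torus_corr_def using assms
  by (intro corr_nonneg finite_cell torus_coupling_nonneg red_cell zero_cell)

text \<open>The translation by \<open>\<gamma>\<close>, which is a period of \<open>L\<close> but
  not of \<open>L'\<close>, exchanges the two sheets of the cover: \<open>latt L\<close> is the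
  disjoint union of \<open>latt L'\<close> and its translate by \<open>\<gamma>\<close>.\<close>

locale torus_double =
  fixes L L' :: "'d::finite \<Rightarrow> nat" and j :: 'd and \<gamma> :: "int ^ 'd" and \<beta> :: real
  assumes L_pos: "\<And>i. 0 < L i" and \<beta>: "0 \<le> \<beta>"
    and L': "L' = L(j := 2 * L j)" and \<gamma>: "\<gamma> = axis j (int (L j))"
begin

lemma L'_pos: "0 < L' i"
  using L_pos by (simp add: L')

lemma cell_L: "0 \<in> cell L" "red L x \<in> cell L"
  using zero_cell[of L] red_cell[of L x] L_pos by auto

lemma cell_L': "red L' x \<in> cell L'"
  using red_cell[of L' x] L'_pos by auto

lemma latt_split: "z \<in> latt L \<longleftrightarrow> z \<in> latt L' \<or> z + \<gamma> \<in> latt L'"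
proof -
  have *: "int (L j) dvd t \<longleftrightarrow> int (2 * L j) dvd t \<or> int (2 * L j) dvd t + int (L j)" for t
  proof
    assume "int (L j) dvd t"
    then obtain s where s: "t = int (L j) * s" ..
    show "int (2 * L j) dvd t \<or> int (2 * L j) dvd t + int (L j)"
    proof (cases "even s")
      case True
      then show ?thesis
        unfolding s by (auto elim!: evenE)
    next
      case False
      then obtain u where "s = 2 * u + 1" by (rule oddE)
      then have "t + int (L j) = int (2 * L j) * (u + 1)"
        by (simp add: s algebra_simps)
      then show ?thesis by simp
    qed
  next
    assume "int (2 * L j) dvd t \<or> int (2 * L j) dvd t + int (L j)"
    moreover have "int (L j) dvd int (2 * L j)" by simp
    ultimately have "int (L j) dvd t \<or> int (L j) dvd t + int (L j)"
      using dvd_trans by blast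
    then show "int (L j) dvd t" by simp
  qed
  show ?thesis
    using *[of "z $ j"] by (auto simp: latt_def L' \<gamma> axis_def split: if_splits)
qed

lemma latt_disjoint: "z \<in> latt L' \<Longrightarrow> z + \<gamma> \<notin> latt L'"
proof
  assume "z \<in> latt L'" "z + \<gamma> \<in> latt L'"
  then have "\<gamma> \<in> latt L'"
    using latt_diff[of "z + \<gamma>" L' z] by simp
  then have "int (2 * L j) dvd int (L j)"
    by (auto simp: latt_def L' \<gamma> axis_def split: if_splits)
  then show False
    using L_pos[of j] by (simp only: of_nat_dvd_iff) (auto dest: dvd_imp_le)
qed

lemma latt_double: "\<gamma> + \<gamma> \<in> latt L'"
  by (simp add: latt_def L' \<gamma> axis_def)

lemma latt_sub: "z \<in> latt L' \<Longrightarrow> z \<in> latt L"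
  using latt_split by blast

lemma of_bool_latt: "of_bool (z \<in> latt L) = (of_bool (z \<in> latt L') + of_bool (z + \<gamma> \<in> latt L') :: real)"
  using latt_split[of z] latt_disjoint[of z] by auto

text \<open>Each vector of \<open>latt L\<close> lies in \<open>latt L'\<close> either as it stands
  or after adding \<open>\<gamma>\<close>, never both. The two parts are the couplings within and
  between the sheets.\<close>

lemma torus_coupling_split:
  "torus_coupling L \<beta> a b = torus_coupling L' \<beta> a b + torus_coupling L' \<beta> a (b + \<gamma>)"
proof -
  have "steps L z = steps L' z + steps L' (z + \<gamma>)" for z
    unfolding steps_def of_bool_latt by (simp add: sum.distrib[symmetric] algebra_simps)
  then show ?thesis
    by (simp add: torus_coupling_def algebra_simps)
qed

text \<open>Each point of the smaller torus has the two lifts \<open>x\<close> and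
  \<open>x + \<gamma>\<close>; this identifies the abstract cover on
  \<open>cell L \<times> UNIV\<close> with the larger torus.\<close>

definition \<psi> :: "(int ^ 'd) \<times> bool \<Rightarrow> int ^ 'd" where
  "\<psi> = (\<lambda>(x, i). red L' (x + (if i then \<gamma> else 0)))"

lemma bij_\<psi>: "bij_betw \<psi> (cell L \<times> UNIV) (cell L')"
proof (rule bij_betw_imageI)
  show "inj_on \<psi> (cell L \<times> UNIV)"
  proof (rule inj_onI, clarify)
    fix x y i i' assume xy: "x \<in> cell L" "y \<in> cell L" and eq: "\<psi> (x, i) = \<psi> (y, i')"
    let ?g = "\<lambda>i. if i then \<gamma> else 0"
    have l: "x + ?g i - (y + ?g i') \<in> latt L'"
      using eq by (simp add: \<psi>_def red_eq_iff)
    moreover have "x + ?g i - (y + ?g i') - (x - y) \<in> latt L"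
      using latt_split[of \<gamma>] latt_double by auto
    ultimately have "x - y \<in> latt L"
      using latt_sub latt_cong by blast
    then have "x = y"
      using xy red_id red_eq_iff by metis
    moreover have "i = i'"
    proof (rule ccontr)
      assume "i \<noteq> i'"
      then have "\<gamma> \<in> latt L'"
        using l \<open>x = y\<close> latt_uminus_iff[of \<gamma> L'] by (auto split: if_splits)
      then show False
        using latt_disjoint[of 0] by simp
    qed
    ultimately show "x = y \<and> i = i'" ..
  qed
  show "\<psi> ` (cell L \<times> UNIV) = cell L'"
  proof
    show "\<psi> ` (cell L \<times> UNIV) \<subseteq> cell L'"
      using cell_L' by (auto simp: \<psi>_def)
    show "cell L' \<subseteq> \<psi> ` (cell L \<times> UNIV)"
    proof
      fix y assume y: "y \<in> cell L'"
      have "y - red L y \<in> latt L"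
        using red_diff_latt[of L y] latt_uminus_iff[of "red L y - y" L] by simp
      then consider "y - red L y \<in> latt L'" | "y - red L y + \<gamma> \<in> latt L'"
        using latt_split by blast
      then have "\<exists>i. red L' (red L y + (if i then \<gamma> else 0)) = red L' y"
      proof cases
        case 1
        then have "red L' (red L y) = red L' y"
          using latt_uminus_iff[of "y - red L y" L'] by (simp add: red_eq_iff)
        then show ?thesis
          by (intro exI[of _ False]) simp
      next
        case 2
        then have "red L y + \<gamma> - y \<in> latt L'"
          using latt_diff[OF latt_double 2] by (simp add: algebra_simps)
        then show ?thesis
          by (intro exI[of _ True]) (simp add: red_eq_iff)
      qed
      then obtain i where "red L' (red L y + (if i then \<gamma> else 0)) = red L' y" ..
      then have "y = \<psi> (red L y, i)"
        unfolding \<psi>_def prod.case red_id[OF y] by (rule sym)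
      then show "y \<in> \<psi> ` (cell L \<times> UNIV)"
        using cell_L(2)[of y] by blast
    qed
  qed
qed

abbreviation "k0 \<equiv> torus_coupling L' \<beta>"
abbreviation "k1 \<equiv> (\<lambda>a b. torus_coupling L' \<beta> a (b + \<gamma>))"
abbreviation "T \<equiv> corr (cell L \<times> UNIV) (lift k0 k1)"

lemma corr_cover:
  assumes "a \<in> cell L" "b \<in> cell L"
  shows "T (a, i) (b, i') = torus_corr L' \<beta> (b - a + (if i = i' then 0 else \<gamma>))"
proof -
  let ?g = "\<lambda>i. if i then \<gamma> else 0"
  have "T (a, i) (b, i') = corr (cell L \<times> UNIV) (\<lambda>u v. torus_coupling L' \<beta> (\<psi> u) (\<psi> v)) (a, i) (b, i')"
  proof (rule corr_cong)
    fix u v :: "(int ^ 'd) \<times> bool"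
    obtain x s where u: "u = (x, s)" by force
    obtain y t where v: "v = (y, t)" by force
    have "torus_coupling L' \<beta> (\<psi> u) (\<psi> v) = torus_coupling L' \<beta> (x + ?g s) (y + ?g t)"
      unfolding u v \<psi>_def prod.case by (intro torus_coupling_cong red_diff_latt)
    also have "\<dots> = torus_coupling L' \<beta> x (y + (if s = t then 0 else \<gamma>))"
      unfolding torus_coupling_def using latt_double latt_uminus_iff[of "\<gamma> + \<gamma>" L']
      by (intro arg_cong2[of _ _ _ _ "(*)"] refl steps_cong) (auto simp: algebra_simps)
    finally show "lift k0 k1 u v = torus_coupling L' \<beta> (\<psi> u) (\<psi> v)"
      by (simp add: lift_def u v)
  qed
  also have "\<dots> = corr (\<psi> ` (cell L \<times> UNIV)) (torus_coupling L' \<beta>) (\<psi> (a, i)) (\<psi> (b, i'))"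
    using bij_\<psi> assms by (intro corr_image[symmetric]) (auto simp: bij_betw_def)
  also have "\<psi> ` (cell L \<times> UNIV) = cell L'"
    using bij_\<psi> by (simp add: bij_betw_def)
  also have "corr (cell L') (torus_coupling L' \<beta>) (\<psi> (a, i)) (\<psi> (b, i')) = torus_corr L' \<beta> (b + ?g i' - (a + ?g i))"
    unfolding \<psi>_def prod.case by (rule corr_torus) (rule L'_pos)
  also have "\<dots> = torus_corr L' \<beta> (b - a + (if i = i' then 0 else \<gamma>))"
    using latt_double latt_uminus_iff[of "\<gamma> + \<gamma>" L'] by (intro torus_corr_cong) (auto simp: algebra_simps)
  finally show ?thesis .
qed

text \<open>Summation over a fibre; since twice \<open>\<gamma>\<close> is a period of
  \<open>L'\<close>, the result descends to the smaller torus.\<close>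

definition P :: "int ^ 'd \<Rightarrow> real" where
  "P z = torus_corr L' \<beta> z + torus_corr L' \<beta> (z + \<gamma>)"

lemma P_cong:
  assumes "x - y \<in> latt L"
  shows "P x = P y"
proof -
  from assms consider "x - y \<in> latt L'" | "x - y + \<gamma> \<in> latt L'"
    using latt_split by blast
  then show ?thesis
  proof cases
    case 1
    then show ?thesis
      using torus_corr_cong[of x y L' \<beta>] torus_corr_cong[of "x + \<gamma>" "y + \<gamma>" L' \<beta>] by (simp add: P_def)
  next
    case 2
    then have "x - (y + \<gamma>) \<in> latt L'"
      using latt_diff[OF 2 latt_double] by (simp add: algebra_simps)
    then show ?thesis
      using 2 torus_corr_cong[of x "y + \<gamma>" L' \<beta>] torus_corr_cong[of "x + \<gamma>" y L' \<beta>]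
      by (simp add: P_def algebra_simps)
  qed
qed

lemma P_uminus: "P (- z) = P z"
proof -
  have "torus_corr L' \<beta> (- z + \<gamma>) = torus_corr L' \<beta> (z - \<gamma>)"
    using torus_corr_uminus[of L' \<beta> "z - \<gamma>"] L'_pos by simp
  also have "\<dots> = torus_corr L' \<beta> (z + \<gamma>)"
    using latt_double latt_uminus_iff[of "\<gamma> + \<gamma>" L'] by (intro torus_corr_cong) (simp add: algebra_simps)
  finally show ?thesis
    using torus_corr_uminus[of L' \<beta> z] L'_pos by (simp add: P_def)
qed

lemma sum_bool: "(\<Sum>i\<in>(UNIV :: bool set). f i) = f False + f True"
  by (simp add: UNIV_bool add.commute)

lemma sum_T: "a \<in> cell L \<Longrightarrow> b \<in> cell L \<Longrightarrow> (\<Sum>i\<in>UNIV. T (a, i) (b, i')) = P (b - a)"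
  by (cases i') (simp_all add: sum_bool corr_cover P_def add.commute)

lemma coupling_sum: "(\<lambda>x y. k0 x y + k1 x y) = torus_coupling L \<beta>"
  by (intro ext) (simp add: torus_coupling_split)

lemma base_corr: "b = red L x \<Longrightarrow> corr (cell L) (\<lambda>x y. k0 x y + k1 x y) 0 b = torus_corr L \<beta> x"
  unfolding coupling_sum by (simp add: torus_corr_def)

lemma sum_sum_T: "b = red L x \<Longrightarrow> (\<Sum>i\<in>UNIV. \<Sum>i'\<in>UNIV. T (0, i) (b, i')) / 2 = P x"
proof -
  assume b: "b = red L x"
  have "(\<Sum>i\<in>UNIV. \<Sum>i'\<in>UNIV. T (0, i) (b, i')) = (\<Sum>i'\<in>(UNIV :: bool set). P (b - 0))"
    by (subst sum.swap) (simp only: b sum_T cell_L)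
  also have "\<dots> = 2 * P x"
    using P_cong[of b x] red_diff_latt[of L x] by (simp add: b)
  finally show ?thesis by simp
qed

theorem torus_corr_le: "torus_corr L \<beta> x \<le> torus_corr L' \<beta> x + torus_corr L' \<beta> (x + \<gamma>)"
proof -
  have "corr (cell L) (\<lambda>x y. k0 x y + k1 x y) 0 (red L x)
      \<le> (\<Sum>i\<in>UNIV. \<Sum>i'\<in>UNIV. T (0, i) (red L x, i')) / 2"
    using torus_coupling_nonneg[OF \<beta>] by (intro corr_le_double_cover finite_cell cell_L)
  then show ?thesis
    unfolding base_corr[OF refl] sum_sum_T[OF refl] P_def .
qed

text \<open>By translation invariance all fibres have the same correlation
  \<open>torus_corr L' \<beta> \<gamma>\<close>, and the sum required to be at most 1 / 2 does not
  depend on \<open>w\<close>: it is a convolution on the larger torus. The error term becomes a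
  convolution on the smaller torus after summation over the fibres.\<close>

theorem le_torus_corr:
  assumes \<kappa>: "(\<Sum>z\<in>cell L'. torus_corr L' \<beta> z * torus_corr L' \<beta> (\<gamma> - z)) \<le> 1 / 2"
  shows "torus_corr L' \<beta> x + torus_corr L' \<beta> (x + \<gamma>) - torus_corr L \<beta> x
    \<le> torus_corr L' \<beta> \<gamma> * (2 * (\<Sum>y\<in>cell L. P y * P (x - y)))"
proof -
  let ?b = "red L x"
  have b: "0 \<in> cell L" "?b \<in> cell L"
    by (rule cell_L)+
  have "(\<Sum>i\<in>UNIV. \<Sum>i'\<in>UNIV. T (0, i) (?b, i')) / 2 - corr (cell L) (\<lambda>x y. k0 x y + k1 x y) 0 ?b
    \<le> torus_corr L' \<beta> \<gamma> * (\<Sum>y\<in>cell L. \<Sum>i\<in>UNIV. \<Sum>i'\<in>UNIV. T (0, i) (y, False) * T (?b, i') (y, True)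
                                + T (0, i) (y, True) * T (?b, i') (y, False))"
  proof (rule double_cover_le_corr[OF finite_cell _ _ b refl])
    show "T (y, False) (y, True) \<le> torus_corr L' \<beta> \<gamma>" if "y \<in> cell L" for y
      using corr_cover[OF that that, of False True] by simp
    fix w assume w: "w \<in> cell L"
    have "(\<Sum>y\<in>cell L. \<Sum>i\<in>UNIV. T (y, False) (w, i) * T (w, i) (y, True))
        = (\<Sum>(y, i)\<in>cell L \<times> UNIV. T (y, False) (w, i) * T (w, i) (y, True))"
      by (rule sum.cartesian_product)
    also have "\<dots> = (\<Sum>u\<in>cell L \<times> UNIV. torus_corr L' \<beta> (red L' (w - \<psi> u)) * torus_corr L' \<beta> (\<gamma> - red L' (w - \<psi> u)))"
    proof (rule sum.cong[OF refl], clarify)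
      fix y i assume y: "y \<in> cell L"
      let ?z = "w - y + (if i then \<gamma> else 0)"
      have "w - \<psi> (y, i) - ?z \<in> latt L'"
        using red_diff_latt[of L' "y + (if i then \<gamma> else 0)"] latt_uminus_iff[of "\<psi> (y, i) - (y + (if i then \<gamma> else 0))" L']
          latt_diff[OF _ latt_double, of "w - \<psi> (y, i) - (w - (y + \<gamma>))"]
        by (auto simp: \<psi>_def algebra_simps split: if_splits)
      then have z: "red L' (w - \<psi> (y, i)) - ?z \<in> latt L'"
        by (rule latt_trans[OF red_diff_latt])
      then have z': "(\<gamma> - red L' (w - \<psi> (y, i))) - (\<gamma> - ?z) \<in> latt L'"
        by (rule latt_reflect)
      have "T (w, i) (y, True) = torus_corr L' \<beta> (\<gamma> - ?z)"
        unfolding corr_cover[OF w y] using latt_double latt_uminus_iff[of "\<gamma> + \<gamma>" L']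
        by (intro torus_corr_cong) (auto simp: algebra_simps)
      then show "T (y, False) (w, i) * T (w, i) (y, True)
          = torus_corr L' \<beta> (red L' (w - \<psi> (y, i))) * torus_corr L' \<beta> (\<gamma> - red L' (w - \<psi> (y, i)))"
        unfolding torus_corr_cong[OF z] torus_corr_cong[OF z'] corr_cover[OF y w] by simp
    qed
    also have "\<dots> = (\<Sum>v\<in>cell L'. torus_corr L' \<beta> (red L' (w - v)) * torus_corr L' \<beta> (\<gamma> - red L' (w - v)))"
      by (rule sum.reindex_bij_betw[OF bij_\<psi>])
    also have "\<dots> = (\<Sum>z\<in>cell L'. torus_corr L' \<beta> z * torus_corr L' \<beta> (\<gamma> - z))"
      by (rule sum.reindex_bij_betw[OF bij_betw_reflect_cell]) (rule L'_pos)
    finally show "(\<Sum>y\<in>cell L. \<Sum>i\<in>UNIV. T (y, False) (w, i) * T (w, i) (y, True)) \<le> 1 / 2"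
      using \<kappa> by simp
  qed (rule torus_coupling_nonneg[OF \<beta>])+
  also have "(\<Sum>y\<in>cell L. \<Sum>i\<in>UNIV. \<Sum>i'\<in>UNIV. T (0, i) (y, False) * T (?b, i') (y, True)
                                + T (0, i) (y, True) * T (?b, i') (y, False))
      = (\<Sum>y\<in>cell L. 2 * (P y * P (x - y)))"
  proof (rule sum.cong[OF refl])
    fix y assume y: "y \<in> cell L"
    have "P (y - ?b) = P (?b - y)"
      using P_uminus[of "y - ?b"] by simp
    also have "\<dots> = P (x - y)"
      using red_diff_latt[of L x] by (intro P_cong) (simp add: algebra_simps)
    finally show "(\<Sum>i\<in>UNIV. \<Sum>i'\<in>UNIV. T (0, i) (y, False) * T (?b, i') (y, True)
                                + T (0, i) (y, True) * T (?b, i') (y, False)) = 2 * (P y * P (x - y))"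
      using sum_T[OF b(1) y] sum_T[OF b(2) y] by (simp add: sum.distrib sum_product[symmetric])
  qed
  finally show ?thesis
    unfolding base_corr[OF refl] sum_sum_T[OF refl] sum_distrib_left[symmetric] P_def .
qed

end

section \<open>The Ising model on boxes and tori\<close>

text \<open>Each edge corresponds to two ordered pairs, which is also why the couplings below carry
  the factor \<open>\<beta> / 2\<close>.\<close>

lemma sum_edges:
  fixes f :: "'a set \<Rightarrow> real"
  assumes "finite V" and E: "\<And>e. e \<in> E \<Longrightarrow> \<exists>a\<in>V. \<exists>b\<in>V. a \<noteq> b \<and> e = {a, b}"
  shows "2 * (\<Sum>e\<in>E. f e) = (\<Sum>a\<in>V. \<Sum>b\<in>V. if a \<noteq> b \<and> {a, b} \<in> E then f {a, b} else 0)"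
proof -
  define P where "P = {(a, b) \<in> V \<times> V. a \<noteq> b \<and> {a, b} \<in> E}"
  let ?g = "\<lambda>(a, b). {a, b}"
  have finP: "finite P"
    using assms(1) by (auto simp: P_def intro: finite_subset[of _ "V \<times> V"])
  have "E \<subseteq> Pow V"
    using E by fastforce
  then have finE: "finite E"
    using assms(1) finite_subset by blast
  have "(\<Sum>a\<in>V. \<Sum>b\<in>V. if a \<noteq> b \<and> {a, b} \<in> E then f {a, b} else 0)
      = (\<Sum>x\<in>V \<times> V. if x \<in> P then f (?g x) else 0)"
    unfolding sum.cartesian_product by (intro sum.cong) (auto simp: P_def split: if_splits)
  also have "\<dots> = (\<Sum>x\<in>P. f (?g x))"
    using assms(1) by (subst sum.inter_restrict[symmetric]) (auto simp: P_def intro!: sum.cong)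
  also have "\<dots> = (\<Sum>e\<in>E. \<Sum>x | x \<in> P \<and> ?g x = e. f (?g x))"
    by (rule sum.group[OF finP finE, symmetric]) (auto simp: P_def)
  also have "\<dots> = (\<Sum>e\<in>E. 2 * f e)"
  proof (rule sum.cong[OF refl])
    fix e assume e: "e \<in> E"
    then obtain a b where ab: "a \<in> V" "b \<in> V" "a \<noteq> b" "e = {a, b}"
      using E by blast
    have "{x. x \<in> P \<and> ?g x = e} = {(a, b), (b, a)}"
      using ab e by (auto simp: P_def doubleton_eq_iff insert_commute)
    then show "(\<Sum>x | x \<in> P \<and> ?g x = e. f (?g x)) = 2 * f e"
      using ab by (simp add: insert_commute)
  qed
  finally show ?thesis
    by (simp add: sum_distrib_left)
qed

lemma ising_two_point:
  assumes "finite V" and E: "\<And>e. e \<in> E \<Longrightarrow> \<exists>a\<in>V. \<exists>b\<in>V. a \<noteq> b \<and> e = {a, b}"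
    and xy: "x \<in> V" "y \<in> V"
  shows "ising_expectation V E \<beta> (\<lambda>\<sigma>. \<sigma> x * \<sigma> y)
    = corr V (\<lambda>a b. \<beta> / 2 * of_bool (a \<noteq> b \<and> {a, b} \<in> E)) x y"
proof -
  let ?k = "\<lambda>a b. \<beta> / 2 * of_bool (a \<noteq> b \<and> {a, b} \<in> E)"
  let ?r = "\<lambda>A. restrict (spin A) V"
  have w: "ising_weight E \<beta> (?r A) = exp (energy V ?k A)" for A
  proof -
    have "(\<Prod>x\<in>e. ?r A x) = (\<Prod>x\<in>e. spin A x)" if "e \<in> E" for e
      using E[OF that] by auto
    then have "\<beta> * (\<Sum>e\<in>E. \<Prod>x\<in>e. ?r A x) = \<beta> / 2 * (2 * (\<Sum>e\<in>E. \<Prod>x\<in>e. spin A x))"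
      by simp
    also have "2 * (\<Sum>e\<in>E. \<Prod>x\<in>e. spin A x)
        = (\<Sum>a\<in>V. \<Sum>b\<in>V. if a \<noteq> b \<and> {a, b} \<in> E then (\<Prod>x\<in>{a, b}. spin A x) else 0)"
      by (rule sum_edges[OF assms(1) E])
    also have "\<beta> / 2 * \<dots> = energy V ?k A"
      unfolding energy_def sum_distrib_left
      by (intro sum.cong refl) auto
    finally show ?thesis
      by (simp add: ising_weight_def)
  qed
  have bij: "bij_betw ?r (Pow V) (V \<rightarrow>\<^sub>E {- 1, 1})"
  proof (rule bij_betw_byWitness[where f' = "\<lambda>\<sigma>. {v \<in> V. \<sigma> v = 1}"])
    show "\<forall>A\<in>Pow V. {v \<in> V. ?r A v = 1} = A"
      by (auto simp: spin_def split: if_splits)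
    show "\<forall>\<sigma>\<in>V \<rightarrow>\<^sub>E {- 1, 1}. ?r {v \<in> V. \<sigma> v = 1} = \<sigma>"
    proof (intro ballI ext)
      fix \<sigma> v assume \<sigma>: "\<sigma> \<in> V \<rightarrow>\<^sub>E {- 1, 1 :: real}"
      show "?r {v \<in> V. \<sigma> v = 1} v = \<sigma> v"
        using PiE_mem[OF \<sigma>, of v] PiE_arb[OF \<sigma>, of v] by (cases "v \<in> V") (auto simp: spin_def)
    qed
    show "?r ` Pow V \<subseteq> V \<rightarrow>\<^sub>E {- 1, 1}"
      by (auto simp: spin_def split: if_splits)
  qed auto
  have S: "(\<Sum>\<sigma>\<in>V \<rightarrow>\<^sub>E {- 1, 1}. F \<sigma> * ising_weight E \<beta> \<sigma>) = (\<Sum>A\<in>Pow V. F (?r A) * exp (energy V ?k A))" for F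
    using sum.reindex_bij_betw[OF bij, of "\<lambda>\<sigma>. F \<sigma> * ising_weight E \<beta> \<sigma>"] by (simp add: w)
  show ?thesis
    using S[of "\<lambda>\<sigma>. \<sigma> x * \<sigma> y"] S[of "\<lambda>_. 1"] xy
    by (simp add: ising_expectation_def corr_def two_def zsum_def wavg_def avg_def)
qed

section \<open>Nearest-neighbour couplings, boxes and their reduction to cells\<close>

definition nn_steps :: "int ^ 'd::finite \<Rightarrow> real" where
  "nn_steps z = (\<Sum>i\<in>UNIV. of_bool (z = axis i 1) + of_bool (z = - axis i 1))"

definition nn_coupling :: "real \<Rightarrow> int ^ 'd::finite \<Rightarrow> int ^ 'd \<Rightarrow> real" where
  "nn_coupling \<beta> a b = \<beta> / 2 * nn_steps (b - a)"

lemma sum_of_bool_exclusive: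
  fixes A B :: "'i::finite \<Rightarrow> bool"
  assumes "\<And>i i'. A i \<Longrightarrow> A i' \<Longrightarrow> i = i'" "\<And>i i'. B i \<Longrightarrow> B i' \<Longrightarrow> i = i'" "\<And>i i'. A i \<Longrightarrow> \<not> B i'"
  shows "(\<Sum>i\<in>UNIV. of_bool (A i) + of_bool (B i) :: real) = of_bool (\<exists>i. A i \<or> B i)"
proof (cases "\<exists>i. A i \<or> B i")
  case True
  then obtain i where i: "A i \<or> B i" ..
  have "of_bool (A i') + of_bool (B i') = (if i' = i then 1 else 0 :: real)" for i'
    using i assms by (cases "A i'"; cases "B i'") auto
  then show ?thesis
    using True by simp
qed simp

lemma axis_eq_iff: "axis i (1::int) = axis i' 1 \<longleftrightarrow> i = i'"
  by (simp add: axis_eq_axis)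

lemma axis_neq_uminus: "axis i (1::int) \<noteq> - axis i' 1"
proof
  assume "axis i (1::int) = - axis i' 1"
  then have "axis i (1::int) $ i = (- axis i' 1) $ i" by simp
  then show False
    by (auto simp: axis_def split: if_splits)
qed

lemma nn_steps_eq: "nn_steps z = of_bool (\<exists>i. z = axis i 1 \<or> z = - axis i 1)"
  unfolding nn_steps_def
  by (rule sum_of_bool_exclusive) (auto simp: axis_eq_iff axis_neq_uminus)

lemma nn_steps_nonneg: "0 \<le> nn_steps z"
  by (simp add: nn_steps_eq)

lemma nn_coupling_nonneg: "0 \<le> \<beta> \<Longrightarrow> 0 \<le> nn_coupling \<beta> a b"
  by (simp add: nn_coupling_def nn_steps_nonneg)

lemma nn_steps_uminus: "nn_steps (- z) = nn_steps z"
proof -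
  have "- z = axis i 1 \<longleftrightarrow> z = - axis i 1" for i
    using minus_equation_iff[of z "axis i 1"] by (simp only: eq_commute[of z])
  then show ?thesis
    by (simp add: nn_steps_def add.commute)
qed

lemma nn_coupling_uminus: "nn_coupling \<beta> (- a) (- b) = nn_coupling \<beta> a b"
  using nn_steps_uminus[of "b - a"] by (simp add: nn_coupling_def)

lemma box_iff: "x \<in> box_vertices r \<longleftrightarrow> (\<forall>i. - int r \<le> 2 * x $ i \<and> 2 * x $ i < int r)"
proof -
  have "- (real r / 2) \<le> real_of_int t \<and> real_of_int t < real r / 2 \<longleftrightarrow> - int r \<le> 2 * t \<and> 2 * t < int r" for t
    by linarith
  then show ?thesis
    by (simp add: box_vertices_def)
qed

lemma zero_box: "0 < r \<Longrightarrow> 0 \<in> box_vertices r"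
  by (simp add: box_iff)

lemma box_mono: "r \<le> s \<Longrightarrow> box_vertices r \<subseteq> box_vertices s"
proof
  fix x assume rs: "r \<le> s" and x: "x \<in> box_vertices r"
  show "x \<in> box_vertices s"
    unfolding box_iff
  proof
    fix i
    show "- int s \<le> 2 * x $ i \<and> 2 * x $ i < int s"
      using x[unfolded box_iff, rule_format, of i] rs by linarith
  qed
qed

lemma centered_mod:
  assumes "- r \<le> 2 * t" "2 * t < (r :: int)"
  shows "(if 2 * (t mod r) < r then t mod r else t mod r - r) = t"
proof (cases "0 \<le> t")
  case True
  then have "t mod r = t"
    using assms by (intro mod_pos_pos_trivial) linarith+
  then show ?thesis
    using assms by simp
next
  case False
  then have "(t + r) mod r = t + r"
    using assms by (intro mod_pos_pos_trivial) linarith+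
  then have "t mod r = t + r"
    by simp
  then show ?thesis
    using assms by simp
qed

lemma red_box_cell:
  assumes "0 < r"
  shows "bij_betw (red (\<lambda>_ :: 'd::finite. r)) (box_vertices r) (cell (\<lambda>_. r))"
proof (rule bij_betw_byWitness[where f' = "\<lambda>z. \<chi> i. if 2 * z $ i < int r then z $ i else z $ i - int r"])
  show "\<forall>x\<in>box_vertices r :: (int ^ 'd) set. (\<chi> i. if 2 * red (\<lambda>_. r) x $ i < int r then red (\<lambda>_. r) x $ i else red (\<lambda>_. r) x $ i - int r) = x"
  proof
    fix x :: "int ^ 'd" assume x: "x \<in> box_vertices r"
    have "(if 2 * (x $ i mod int r) < int r then x $ i mod int r else x $ i mod int r - int r) = x $ i" for i
      using x by (intro centered_mod) (auto simp: box_iff)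
    then show "(\<chi> i. if 2 * red (\<lambda>_. r) x $ i < int r then red (\<lambda>_. r) x $ i else red (\<lambda>_. r) x $ i - int r) = x"
      unfolding red_def vec_eq_iff vec_lambda_beta by blast
  qed
  show "\<forall>z\<in>cell (\<lambda>_ :: 'd. r). red (\<lambda>_. r) (\<chi> i. if 2 * z $ i < int r then z $ i else z $ i - int r) = z"
    by (auto simp: cell_def red_def vec_eq_iff minus_mod_self2)
  show "red (\<lambda>_ :: 'd. r) ` box_vertices r \<subseteq> cell (\<lambda>_. r)"
    using assms by (auto intro: red_cell)
  show "(\<lambda>z. \<chi> i. if 2 * z $ i < int r then z $ i else z $ i - int r) ` cell (\<lambda>_ :: 'd. r) \<subseteq> box_vertices r"
  proof (rule image_subsetI)
    fix z assume z: "z \<in> cell (\<lambda>_ :: 'd. r)"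
    have "- int r \<le> 2 * (if 2 * z $ i < int r then z $ i else z $ i - int r)
        \<and> 2 * (if 2 * z $ i < int r then z $ i else z $ i - int r) < int r" for i
    proof -
      have "0 \<le> z $ i" "z $ i < int r"
        using z by (auto simp: cell_def)
      then show ?thesis by auto
    qed
    then show "(\<chi> i. if 2 * z $ i < int r then z $ i else z $ i - int r) \<in> box_vertices r"
      unfolding box_iff vec_lambda_beta by blast
  qed
qed

lemma finite_box: "finite (box_vertices r :: (int ^ 'd::finite) set)"
proof (cases "r = 0")
  case True
  have "x \<notin> box_vertices 0" for x :: "int ^ 'd"
    unfolding box_iff by (auto intro!: exI[of _ undefined])
  then have "box_vertices r = ({} :: (int ^ 'd) set)"
    using True by blast
  then show ?thesis by simp
next
  case False
  then show ?thesis
    using bij_betw_finite[OF red_box_cell[of r]] finite_cell by blast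
qed

lemma tau_box_eq_corr:
  assumes "x \<in> box_vertices r" "y \<in> box_vertices r"
  shows "tau_box r \<beta> x y = corr (box_vertices r) (nn_coupling \<beta>) x y"
proof -
  have adj: "a \<noteq> b \<and> {a, b} \<in> box_edges r \<longleftrightarrow> (\<exists>i. b - a = axis i 1 \<or> b - a = - axis i 1)"
    if "a \<in> box_vertices r" "b \<in> box_vertices r" for a b :: "int ^ 'a"
  proof -
    have "{a, b} \<in> box_edges r \<longleftrightarrow> (\<exists>i. b = a + axis i 1 \<or> a = b + axis i 1)"
      using that by (auto simp: box_edges_def doubleton_eq_iff)
    moreover have "b = a + axis i 1 \<longleftrightarrow> b - a = axis i 1" "a = b + axis i 1 \<longleftrightarrow> b - a = - axis i 1" for i
      by (auto simp: algebra_simps)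
    moreover have "axis i (1::int) \<noteq> 0" for i :: 'a
      by (simp add: axis_eq_0_iff)
    ultimately show ?thesis by auto
  qed
  have "tau_box r \<beta> x y = corr (box_vertices r) (\<lambda>a b. \<beta> / 2 * of_bool (a \<noteq> b \<and> {a, b} \<in> box_edges r)) x y"
    unfolding tau_box_def using assms
  proof (intro ising_two_point finite_box)
    fix e :: "(int ^ 'a) set" assume "e \<in> box_edges r"
    then obtain a i where "a \<in> box_vertices r" "a + axis i 1 \<in> box_vertices r" "e = {a, a + axis i 1}"
      by (auto simp: box_edges_def)
    then show "\<exists>a\<in>box_vertices r. \<exists>b\<in>box_vertices r. a \<noteq> b \<and> e = {a, b}"
      by (intro bexI[of _ a] bexI[of _ "a + axis i 1"]) (auto simp: axis_eq_0_iff)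
  qed auto
  also have "\<dots> = corr (box_vertices r) (nn_coupling \<beta>) x y"
    by (rule corr_cong) (simp only: adj nn_coupling_def nn_steps_eq)
  finally show ?thesis .
qed

text \<open>A period of at least 3 divides neither 1 nor 2, so the torus has no loops and its 2d
  unit steps are distinct modulo \<open>L\<close>.\<close>

lemma axis_not_latt:
  assumes "\<And>i. 3 \<le> L i"
  shows "axis i 1 \<notin> latt L" "i \<noteq> i' \<Longrightarrow> axis i 1 - axis i' 1 \<notin> latt L" "axis i 1 + axis i' 1 \<notin> latt L"
proof -
  have 1: "\<not> int (L i) dvd 1" and 2: "\<not> int (L i) dvd 2"
    using assms[of i] by (auto dest!: zdvd_imp_le)
  then show "axis i 1 \<notin> latt L" "i \<noteq> i' \<Longrightarrow> axis i 1 - axis i' 1 \<notin> latt L" "axis i 1 + axis i' 1 \<notin> latt L"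
    by (auto simp: latt_def axis_def intro!: exI[of _ i])
qed

lemma steps_eq:
  assumes "\<And>i. 3 \<le> L i"
  shows "steps L z = of_bool (\<exists>i. z - axis i 1 \<in> latt L \<or> z + axis i 1 \<in> latt L)"
  unfolding steps_def
proof (rule sum_of_bool_exclusive)
  show "i = i'" if "z - axis i 1 \<in> latt L" "z - axis i' 1 \<in> latt L" for i i'
    using latt_diff[OF that(2,1)] axis_not_latt(2)[of L i i', OF assms] by auto
  show "i = i'" if "z + axis i 1 \<in> latt L" "z + axis i' 1 \<in> latt L" for i i'
    using latt_diff[OF that] axis_not_latt(2)[of L i i', OF assms] by auto
  show "z + axis i' 1 \<notin> latt L" if "z - axis i 1 \<in> latt L" for i i'
    using latt_diff[OF _ that, of "z + axis i' 1"] axis_not_latt(3)[of L i' i, OF assms] by (auto simp: algebra_simps)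
qed

lemma tau_torus_eq:
  assumes "3 \<le> r" "x \<in> box_vertices r"
  shows "tau_torus r \<beta> 0 x = torus_corr (\<lambda>_. r) \<beta> x"
proof -
  let ?L = "\<lambda>_ :: 'a. r"
  have bij: "bij_betw (red ?L) (box_vertices r) (cell ?L)"
    using assms by (intro red_box_cell) simp
  have L3: "3 \<le> ?L i" for i
    using assms by simp
  have c: "(\<forall>j. [b $ j = (a + axis i 1) $ j] (mod int r)) \<longleftrightarrow> b - a - axis i 1 \<in> latt ?L" for a b :: "int ^ 'a" and i
    by (simp add: latt_def cong_iff_dvd_diff diff_diff_eq)
  have c': "a - b - axis i 1 \<in> latt ?L \<longleftrightarrow> b - a + axis i 1 \<in> latt ?L" for a b :: "int ^ 'a" and i
    using latt_uminus_iff[of "b - a + axis i 1" ?L] by (simp add: algebra_simps del: latt_uminus_iff)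
  have adj: "a \<noteq> b \<and> {a, b} \<in> torus_edges r \<longleftrightarrow> (\<exists>i. b - a - axis i 1 \<in> latt ?L \<or> b - a + axis i 1 \<in> latt ?L)"
    if "a \<in> box_vertices r" "b \<in> box_vertices r" for a b :: "int ^ 'a"
  proof -
    have "{a, b} \<in> torus_edges r \<longleftrightarrow> (\<exists>i. b - a - axis i 1 \<in> latt ?L \<or> a - b - axis i 1 \<in> latt ?L)"
      unfolding torus_edges_def c using that by (auto simp: doubleton_eq_iff)
    moreover have "\<not> (\<exists>i. a - a - axis i 1 \<in> latt ?L \<or> a - a + axis i 1 \<in> latt ?L)"
      using axis_not_latt(1)[of ?L] L3 latt_uminus_iff[of "axis _ 1" ?L] by auto
    ultimately show ?thesis
      unfolding c' by auto
  qed
  have "tau_torus r \<beta> 0 x = corr (box_vertices r) (\<lambda>a b. \<beta> / 2 * of_bool (a \<noteq> b \<and> {a, b} \<in> torus_edges r)) 0 x"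
    unfolding tau_torus_def using assms zero_box[of r]
  proof (intro ising_two_point finite_box)
    fix e :: "(int ^ 'a) set" assume "e \<in> torus_edges r"
    then obtain a b i where ab: "a \<in> box_vertices r" "b \<in> box_vertices r" "e = {a, b}" "b - a - axis i 1 \<in> latt ?L"
      unfolding torus_edges_def c by blast
    moreover have "a \<noteq> b"
      using ab(4) axis_not_latt(1)[of ?L i] L3 by auto
    ultimately show "\<exists>a\<in>box_vertices r. \<exists>b\<in>box_vertices r. a \<noteq> b \<and> e = {a, b}"
      by blast
  qed auto
  also have "\<dots> = corr (box_vertices r) (\<lambda>a b. torus_coupling ?L \<beta> (red ?L a) (red ?L b)) 0 x"
  proof (rule corr_cong)
    fix a b :: "int ^ 'a" assume ab: "a \<in> box_vertices r" "b \<in> box_vertices r"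
    have "torus_coupling ?L \<beta> (red ?L a) (red ?L b) = torus_coupling ?L \<beta> a b"
      by (intro torus_coupling_cong red_diff_latt)
    then show "\<beta> / 2 * of_bool (a \<noteq> b \<and> {a, b} \<in> torus_edges r) = torus_coupling ?L \<beta> (red ?L a) (red ?L b)"
      by (simp only: adj[OF ab] torus_coupling_def steps_eq[OF L3])
  qed
  also have "\<dots> = corr (red ?L ` box_vertices r) (torus_coupling ?L \<beta>) (red ?L 0) (red ?L x)"
    using bij assms zero_box[of r] by (intro corr_image[symmetric]) (auto simp: bij_betw_def)
  also have "red ?L ` box_vertices r = cell ?L"
    using bij by (simp add: bij_betw_def)
  also have "red ?L 0 = 0"
    by (simp add: red_def vec_eq_iff)
  finally show ?thesis
    by (simp add: torus_corr_def)
qed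

section \<open>The infinite-volume two-point function\<close>

lemma tau_box_mono:
  assumes "0 \<le> \<beta>" "r \<le> s" "x \<in> box_vertices r" "y \<in> box_vertices r"
  shows "tau_box r \<beta> x y \<le> tau_box s \<beta> x y"
proof -
  have "x \<in> box_vertices s" "y \<in> box_vertices s"
    using box_mono[OF assms(2)] assms(3,4) by auto
  then show ?thesis
    unfolding tau_box_eq_corr[OF assms(3,4)] tau_box_eq_corr[OF \<open>x \<in> box_vertices s\<close> \<open>y \<in> box_vertices s\<close>]
    using assms by (intro corr_subset_mono finite_box nn_coupling_nonneg box_mono)
qed

lemma ex_box: "\<exists>r>0. x \<in> box_vertices r"
proof -
  define m where "m = Max (range (\<lambda>i. \<bar>x $ i\<bar>))"
  have m: "\<bar>x $ i\<bar> \<le> m" for i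
    by (simp add: m_def)
  have "0 \<le> m"
    using m[of undefined] by linarith
  have "- int (nat (2 * m + 1)) \<le> 2 * x $ i \<and> 2 * x $ i < int (nat (2 * m + 1))" for i
    using m[of i] \<open>0 \<le> m\<close> by linarith
  then have "x \<in> box_vertices (nat (2 * m + 1))"
    by (simp only: box_iff) simp
  then show ?thesis
    using \<open>0 \<le> m\<close> by (intro exI[of _ "nat (2 * m + 1)"]) simp
qed

lemma tau_box_tendsto_tau:
  assumes "0 \<le> \<beta>"
  shows "(\<lambda>r. tau_box r \<beta> 0 x) \<longlonglongrightarrow> tau \<beta> 0 x"
proof -
  \<comment> \<open>For smaller boxes the value refers to a spin outside the box and carries no
    information, so monotonicity is used only from \<open>r0\<close> on.\<close>
  obtain r0 where r0: "0 < r0" "x \<in> box_vertices r0"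
    using ex_box by blast
  have inb: "0 \<in> box_vertices (n + r0)" "x \<in> box_vertices (n + r0)" for n
    using r0 zero_box[of "n + r0"] box_mono[of r0 "n + r0"] by auto
  have "incseq (\<lambda>n. tau_box (n + r0) \<beta> 0 x)"
    using assms inb by (intro incseq_SucI tau_box_mono) auto
  moreover have "tau_box (n + r0) \<beta> 0 x \<le> 1" for n
    by (simp add: tau_box_eq_corr inb corr_le_1 finite_box)
  ultimately obtain l where "(\<lambda>n. tau_box (n + r0) \<beta> 0 x) \<longlonglongrightarrow> l"
    using incseq_convergent by blast
  then have "(\<lambda>n. tau_box n \<beta> 0 x) \<longlonglongrightarrow> l"
    by (rule LIMSEQ_offset)
  then show ?thesis
    unfolding tau_def using limI by metis
qed

lemma tau_box_le_tau:
  assumes "0 \<le> \<beta>" "x \<in> box_vertices r" "0 < r"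
  shows "tau_box r \<beta> 0 x \<le> tau \<beta> 0 x"
proof (rule LIMSEQ_le_const[OF tau_box_tendsto_tau[OF assms(1)]])
  show "\<exists>N. \<forall>n\<ge>N. tau_box r \<beta> 0 x \<le> tau_box n \<beta> 0 x"
    using assms zero_box[of r] tau_box_mono by blast
qed

lemma tau_le:
  assumes "0 \<le> \<beta>" "\<And>r. 0 < r \<Longrightarrow> x \<in> box_vertices r \<Longrightarrow> tau_box r \<beta> 0 x \<le> c"
  shows "tau \<beta> 0 x \<le> c"
proof (rule LIMSEQ_le_const2[OF tau_box_tendsto_tau[OF assms(1)]])
  obtain r where "0 < r" "x \<in> box_vertices r"
    using ex_box by blast
  then have "0 < n \<and> x \<in> box_vertices n" if "r \<le> n" for n
    using box_mono[OF that] that by auto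
  then show "\<exists>N. \<forall>n\<ge>N. tau_box n \<beta> 0 x \<le> c"
    using assms(2) by blast
qed

lemma tau_le_1: "0 \<le> \<beta> \<Longrightarrow> tau \<beta> 0 x \<le> 1"
  by (rule tau_le) (auto simp: tau_box_eq_corr zero_box corr_le_1 finite_box)

lemma tau_nonneg:
  assumes "0 \<le> \<beta>"
  shows "0 \<le> tau \<beta> 0 x"
proof -
  obtain r where r: "0 < r" "x \<in> box_vertices r"
    using ex_box by blast
  then have "0 \<le> tau_box r \<beta> 0 x"
    using assms by (simp add: tau_box_eq_corr zero_box corr_nonneg finite_box nn_coupling_nonneg)
  then show ?thesis
    using tau_box_le_tau[OF assms r(2,1)] by linarith
qed

lemma tau_0:
  assumes "0 \<le> \<beta>"
  shows "tau \<beta> 0 0 = 1"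
proof (rule antisym)
  have "1 = tau_box 1 \<beta> 0 (0 :: int ^ 'a)"
    by (simp add: tau_box_eq_corr zero_box corr_refl finite_box)
  also have "\<dots> \<le> tau \<beta> 0 (0 :: int ^ 'a)"
    by (intro tau_box_le_tau assms zero_box) simp_all
  finally show "1 \<le> tau \<beta> 0 (0 :: int ^ 'a)" .
qed (rule tau_le_1[OF assms])

lemma tau_uminus:
  assumes "0 \<le> \<beta>"
  shows "tau \<beta> 0 (- x) = tau \<beta> 0 x"
proof -
  have le: "tau \<beta> 0 x \<le> tau \<beta> 0 (- x)" for x :: "int ^ 'a"
  proof (rule tau_le[OF assms])
    fix r assume r: "0 < r" "x \<in> box_vertices r"
    \<comment> \<open>The boxes are half-open, so for even \<open>r\<close> the reflection needs the
      next larger box.\<close>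
    have sub: "uminus ` box_vertices r \<subseteq> (box_vertices (Suc r) :: (int ^ 'a) set)"
      by (auto simp: box_iff) (smt (verit))+
    have "corr (box_vertices r) (nn_coupling \<beta>) 0 x \<le> corr (box_vertices (Suc r)) (nn_coupling \<beta>) (- 0) (- x)"
      using r sub assms
      by (intro corr_embed finite_box) (auto simp: nn_coupling_nonneg nn_coupling_uminus zero_box)
    then have "tau_box r \<beta> 0 x \<le> tau_box (Suc r) \<beta> 0 (- x)"
      using r sub by (auto simp: tau_box_eq_corr zero_box)
    also have "\<dots> \<le> tau \<beta> 0 (- x)"
      using r sub by (intro tau_box_le_tau assms) auto
    finally show "tau_box r \<beta> 0 x \<le> tau \<beta> 0 (- x)" .
  qed
  from le[of x] le[of "- x"] show ?thesis by simp
qed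

section \<open>Tori and the infinite-volume model\<close>

lemma nn_steps_le_steps: "nn_steps z \<le> steps L z"
  unfolding nn_steps_def steps_def by (intro sum_mono add_mono) auto

lemma box_latt_eq:
  assumes "\<And>i. M \<le> L i" "x \<in> box_vertices M" "y \<in> box_vertices M" "x - y \<in> latt L"
  shows "x = y"
proof -
  have "x $ i = y $ i" for i
  proof (rule ccontr)
    assume ne: "x $ i \<noteq> y $ i"
    have "int (L i) dvd x $ i - y $ i"
      using assms(4) by (simp add: latt_def)
    then have "int (L i) \<le> \<bar>x $ i - y $ i\<bar>"
      using ne dvd_imp_le_int[of "x $ i - y $ i" "int (L i)"] by auto
    moreover have "int M \<le> int (L i)"
      using assms(1) by simp
    moreover have "\<bar>x $ i - y $ i\<bar> < int M"
      using assms(2,3) unfolding box_iff by (smt (verit))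
    ultimately show False by linarith
  qed
  then show ?thesis
    by (simp add: vec_eq_iff)
qed

lemma inj_on_red_box:
  assumes "\<And>i. M \<le> L i"
  shows "inj_on (red L) (box_vertices M)"
proof (rule inj_onI)
  fix x y assume "x \<in> box_vertices M" "y \<in> box_vertices M" "red L x = red L y"
  then show "x = y"
    using box_latt_eq[of M L x y, OF assms] by (simp add: red_eq_iff)
qed

lemma tau_box_le_torus_corr:
  assumes "0 \<le> \<beta>" "0 < M" "\<And>i. M \<le> L i" "x \<in> box_vertices M"
  shows "tau_box M \<beta> 0 x \<le> torus_corr L \<beta> x"
proof -
  have L: "0 < L i" for i
    using assms(2) assms(3)[of i] by linarith
  have le: "nn_coupling \<beta> a b \<le> torus_coupling L \<beta> (red L a) (red L b)" for a b
  proof -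
    have "torus_coupling L \<beta> (red L a) (red L b) = torus_coupling L \<beta> a b"
      by (intro torus_coupling_cong red_diff_latt)
    then show ?thesis
      unfolding nn_coupling_def torus_coupling_def[of L \<beta> a b]
      using assms(1) nn_steps_le_steps[of "b - a" L] by (auto intro!: mult_left_mono)
  qed
  have "corr (box_vertices M) (nn_coupling \<beta>) 0 x \<le> corr (cell L) (torus_coupling L \<beta>) (red L 0) (red L x)"
    using assms le L red_cell[of L]
    by (intro corr_embed finite_cell inj_on_red_box) (auto simp: nn_coupling_nonneg torus_coupling_nonneg zero_box)
  moreover have "red L 0 = 0"
    by (simp add: red_def vec_eq_iff)
  ultimately show ?thesis
    using assms by (simp add: tau_box_eq_corr zero_box torus_corr_def)
qed

lemma sum_steps:
  fixes L :: "'d::finite \<Rightarrow> nat"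
  assumes "\<And>i. 0 < L i"
  shows "(\<Sum>v\<in>cell L. steps L (v - u)) = 2 * real CARD('d)"
proof -
  have one: "(\<Sum>v\<in>cell L. of_bool (v - w \<in> latt L) :: real) = 1" for w :: "int ^ 'd"
  proof -
    have "v - w \<in> latt L \<longleftrightarrow> v = red L w" if "v \<in> cell L" for v
      using red_id[OF that] red_eq_iff[of L v w] by auto
    then have "(\<Sum>v\<in>cell L. of_bool (v - w \<in> latt L) :: real) = (\<Sum>v\<in>cell L. if v = red L w then 1 else 0)"
      by (intro sum.cong) auto
    then show ?thesis
      using red_cell[of L w] assms by (simp add: finite_cell)
  qed
  have "(\<Sum>v\<in>cell L. steps L (v - u))
      = (\<Sum>i\<in>UNIV. (\<Sum>v\<in>cell L. of_bool (v - (u + axis i 1) \<in> latt L)) + (\<Sum>v\<in>cell L. of_bool (v - (u - axis i 1) \<in> latt L)))"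
    unfolding steps_def sum.distrib[symmetric] by (subst sum.swap) (simp add: algebra_simps)
  then show ?thesis
    by (simp add: one)
qed

lemma sup_norm_ge: "real_of_int \<bar>x $ i\<bar> \<le> sup_norm x"
  unfolding sup_norm_def of_int_le_iff by (rule Max_ge) auto

text \<open>This is \<open>corr_le_subgraph\<close> with \<open>S\<close> the image of a box that
  embeds in the torus. Inside the box \<open>tau\<close> takes over; the error lives on the boundary
  layer, which contains all points with neighbours outside. The first sum has at most one term and
  is empty if \<open>y\<close> has no representative in the box.\<close>

theorem torus_corr_le_tau:
  fixes L :: "'d::finite \<Rightarrow> nat"
  assumes "0 \<le> \<beta>" "0 < M" "\<And>i. M < L i"
  shows "torus_corr L \<beta> y \<le> (\<Sum>z | z \<in> box_vertices M \<and> y - z \<in> latt L. tau \<beta> 0 z)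
    + 2 * real CARD('d) * \<beta> * (\<Sum>u :: int ^ 'd | u \<in> box_vertices M \<and> real M / 2 - 1 \<le> sup_norm u. tau \<beta> 0 u)"
proof -
  let ?B = "box_vertices M :: (int ^ 'd) set" and ?k = "torus_coupling L \<beta>"
  let ?S = "red L ` ?B"
  have L: "0 < L i" "M \<le> L i" for i
    using assms(2) assms(3)[of i] by linarith+
  have red0: "red L 0 = 0"
    by (simp add: red_def vec_eq_iff)
  have inj: "inj_on (red L) ?B"
    by (rule inj_on_red_box[OF L(2)])
  have k_red: "?k (red L a) (red L b) = ?k a b" for a b
    by (intro torus_coupling_cong red_diff_latt)
  \<comment> \<open>Coordinates of differences in the box are at most M - 1 in absolute value and a
    unit step adds at most 1. Since \<open>M\<close> is strictly below every period, no neighbour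
    relation wraps around the torus.\<close>
  have steps: "steps L (b - a) = nn_steps (b - a)" if "a \<in> ?B" "b \<in> ?B" for a b
  proof -
    have zero: "w = 0" if w: "w \<in> latt L" "\<And>j. \<bar>w $ j\<bar> \<le> int M" for w
    proof -
      have "w $ j = 0" for j
      proof (rule ccontr)
        assume "w $ j \<noteq> 0"
        moreover have "int (L j) dvd w $ j"
          using w(1) by (simp add: latt_def)
        ultimately have "int (L j) \<le> \<bar>w $ j\<bar>"
          using dvd_imp_le_int[of "w $ j" "int (L j)"] by auto
        then show False
          using w(2)[of j] assms(3)[of j] by linarith
      qed
      then show ?thesis by (simp add: vec_eq_iff)
    qed
    have bd: "\<bar>(b - a) $ j\<bar> \<le> int M - 1" for j
      using that unfolding box_iff by (simp) (smt (verit))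
    have "b - a - axis i 1 \<in> latt L \<longleftrightarrow> b - a = axis i 1" for i
    proof
      assume "b - a - axis i 1 \<in> latt L"
      moreover have "\<bar>(b - a - axis i 1) $ j\<bar> \<le> int M" for j
        using bd[of j] by (auto simp: axis_def)
      ultimately show "b - a = axis i 1"
        using zero by fastforce
    qed simp
    moreover have "b - a + axis i 1 \<in> latt L \<longleftrightarrow> b - a = - axis i 1" for i
    proof
      assume "b - a + axis i 1 \<in> latt L"
      moreover have "\<bar>(b - a + axis i 1) $ j\<bar> \<le> int M" for j
        using bd[of j] by (auto simp: axis_def)
      ultimately have "b - a + axis i 1 = 0"
        using zero by blast
      then show "b - a = - axis i 1"
        by (simp add: eq_neg_iff_add_eq_0)
    qed simp
    ultimately show ?thesis
      by (simp add: steps_def nn_steps_def)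
  qed
  have corrS: "corr ?S ?k 0 (red L u) = tau_box M \<beta> 0 u" if "u \<in> ?B" for u
  proof -
    have "corr ?S ?k (red L 0) (red L u) = corr ?B (\<lambda>a b. ?k (red L a) (red L b)) 0 u"
      using inj zero_box[OF assms(2)] that by (rule corr_image)
    also have "\<dots> = corr ?B (nn_coupling \<beta>) 0 u"
      unfolding k_red by (rule corr_cong) (simp add: torus_coupling_def nn_coupling_def steps)
    finally show ?thesis
      using that assms(2) by (simp add: red0 tau_box_eq_corr zero_box)
  qed
  have corrS_le: "corr ?S ?k 0 (red L u) \<le> tau \<beta> 0 u" if "u \<in> ?B" for u
    using corrS[OF that] tau_box_le_tau[OF assms(1) that assms(2)] by simp
  have S: "?S \<subseteq> cell L"
    using red_cell[of L] L by auto
  let ?h = "\<lambda>u. \<Sum>v\<in>cell L - ?S. ?k u v + ?k v u"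
  \<comment> \<open>A vertex has 2d steps, and each of the two orders of a pair carries
    \<open>\<beta> / 2\<close>.\<close>
  have h_le: "?h (red L u) \<le> 2 * real CARD('d) * \<beta>" for u
  proof -
    have "?h (red L u) \<le> (\<Sum>v\<in>cell L. ?k (red L u) v + ?k v (red L u))"
      using assms(1) by (intro sum_mono2 finite_cell) (auto simp: torus_coupling_nonneg)
    also have "\<dots> = \<beta> * (\<Sum>v\<in>cell L. steps L (v - red L u))"
      unfolding sum_distrib_left using steps_uminus[of L "_ - red L u"]
      by (intro sum.cong refl) (simp add: torus_coupling_def)
    finally show ?thesis
      using L by (simp add: sum_steps mult.commute)
  qed
  have h_0: "?h (red L u) = 0" if u: "u \<in> ?B" "sup_norm u < real M / 2 - 1" for u
  proof (rule sum.neutral, clarify)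
    fix v assume v: "v \<in> cell L" "v \<notin> ?S"
    have "w \<in> ?B" if "\<And>j. \<bar>(w - u) $ j\<bar> \<le> 1" for w
      unfolding box_iff
    proof
      fix j
      show "- int M \<le> 2 * w $ j \<and> 2 * w $ j < int M"
        using sup_norm_ge[of u j] u(2) that[of j] by (auto; linarith)
    qed
    then have nb: "u + axis i 1 \<in> ?B" "u - axis i 1 \<in> ?B" for i
      by (auto simp: axis_def)
    have "v - u - axis i 1 \<notin> latt L" "v - u + axis i 1 \<notin> latt L" for i
      using v(2) nb[of i] red_id[OF v(1)] red_eq_iff[of L v "u + axis i 1"] red_eq_iff[of L v "u - axis i 1"]
      by (auto simp: algebra_simps image_iff)
    then have "steps L (v - u) = 0"
      by (simp add: steps_def)
    then have "?k u v = 0" "?k v u = 0"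
      using steps_uminus[of L "v - u"] by (simp_all add: torus_coupling_def)
    then show "?k (red L u) v + ?k v (red L u) = 0"
      using k_red[of u v] k_red[of v u] red_id[OF v(1)] by simp
  qed
  have "torus_corr L \<beta> y \<le> corr0 ?S ?k 0 (red L y) + (\<Sum>u\<in>?S. ?h u * corr ?S ?k 0 u)"
    unfolding torus_corr_def
  proof (rule corr_le_subgraph[OF finite_cell _ S])
    show "0 \<in> ?S"
      using zero_box[OF assms(2)] red0 by (metis imageI)
  qed (use L red_cell[of L y] torus_coupling_nonneg[OF assms(1)] in auto)
  also have "corr0 ?S ?k 0 (red L y) \<le> (\<Sum>z | z \<in> ?B \<and> y - z \<in> latt L. tau \<beta> 0 z)"
  proof (cases "red L y \<in> ?S")
    case True
    then obtain z where z: "z \<in> ?B" "red L y = red L z" by blast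
    have "corr0 ?S ?k 0 (red L y) \<le> tau \<beta> 0 z"
      using corrS_le[OF z(1)] tau_nonneg[OF assms(1), of z] by (simp add: corr0_def z(2))
    also have "\<dots> \<le> (\<Sum>z | z \<in> ?B \<and> y - z \<in> latt L. tau \<beta> 0 z)"
    proof (rule member_le_sum)
      show "finite {z. z \<in> ?B \<and> y - z \<in> latt L}"
        by (rule finite_subset[OF _ finite_box[of M]]) auto
    qed (use z tau_nonneg[OF assms(1)] in \<open>auto simp: red_eq_iff\<close>)
    finally show ?thesis .
  next
    case False
    then show ?thesis
      using tau_nonneg[OF assms(1)] by (auto simp: corr0_def intro!: sum_nonneg)
  qed
  also have "(\<Sum>u\<in>?S. ?h u * corr ?S ?k 0 u) = (\<Sum>u\<in>?B. ?h (red L u) * corr ?S ?k 0 (red L u))"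
    by (rule sum.reindex_cong[OF inj]) auto
  also have "\<dots> \<le> (\<Sum>u\<in>?B. if real M / 2 - 1 \<le> sup_norm u then 2 * real CARD('d) * \<beta> * tau \<beta> 0 u else 0)"
  proof (rule sum_mono)
    fix u assume u: "u \<in> ?B"
    have nn: "0 \<le> corr ?S ?k 0 (red L u)"
      unfolding corrS[OF u] using u assms
      by (simp add: tau_box_eq_corr zero_box corr_nonneg finite_box nn_coupling_nonneg)
    show "?h (red L u) * corr ?S ?k 0 (red L u)
        \<le> (if real M / 2 - 1 \<le> sup_norm u then 2 * real CARD('d) * \<beta> * tau \<beta> 0 u else 0)"
      using mult_mono[OF h_le[of u] corrS_le[OF u] _ nn] h_0[OF u] assms(1) by (simp split: if_splits)
  qed
  also have "\<dots> = 2 * real CARD('d) * \<beta> * (\<Sum>u :: int ^ 'd | u \<in> box_vertices M \<and> real M / 2 - 1 \<le> sup_norm u. tau \<beta> 0 u)"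
    unfolding sum_distrib_left by (rule sum.inter_filter[OF finite_box, symmetric])
  finally show ?thesis
    by simp
qed

section \<open>Periodisation\<close>

definition periodise :: "('d::finite \<Rightarrow> nat) \<Rightarrow> (int ^ 'd \<Rightarrow> real) \<Rightarrow> int ^ 'd \<Rightarrow> real" where
  "periodise L f z = infsum (\<lambda>v. f (z + v)) (latt L)"

definition latt_scale :: "('d::finite \<Rightarrow> nat) \<Rightarrow> int ^ 'd \<Rightarrow> int ^ 'd" where
  "latt_scale L c = (\<chi> i. int (L i) * c $ i)"

lemma summable_shift:
  fixes f :: "int ^ 'd::finite \<Rightarrow> real"
  assumes "f summable_on UNIV"
  shows "(\<lambda>v. f (z + v)) summable_on A"
proof -
  have "bij_betw (\<lambda>v. z + v) UNIV UNIV"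
    by (rule bij_betw_byWitness[where f' = "\<lambda>v. v - z"]) auto
  then have "(\<lambda>v. f (z + v)) summable_on UNIV"
    using assms summable_on_reindex_bij_betw by blast
  then show ?thesis
    by (rule summable_on_subset_banach) simp
qed

lemma sum_le_periodise:
  assumes "f summable_on UNIV" "\<And>x. 0 \<le> f x" "finite A" "A \<subseteq> latt L"
  shows "(\<Sum>v\<in>A. f (z + v)) \<le> periodise L f z"
  unfolding periodise_def using assms by (intro finite_sum_le_infsum summable_shift) auto

lemma le_periodise:
  assumes "f summable_on UNIV" "\<And>x. 0 \<le> f x"
  shows "f z \<le> periodise L f z"
  using sum_le_periodise[OF assms, of "{0}" L z] by simp

lemma periodise_nonneg: "(\<And>x. 0 \<le> f x) \<Longrightarrow> 0 \<le> periodise L f z"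
  unfolding periodise_def by (rule infsum_nonneg)

lemma periodise_cong:
  assumes "u - v \<in> latt L"
  shows "periodise L f u = periodise L f v"
proof -
  have "bij_betw (\<lambda>w. u - v + w) (latt L) (latt L)"
    using assms latt_add latt_diff[OF _ assms]
    by (intro bij_betw_byWitness[where f' = "\<lambda>w. w - (u - v)"]) auto
  from infsum_reindex_bij_betw[OF this, of "\<lambda>w. f (v + w)"] show ?thesis
    by (simp add: periodise_def add.assoc[symmetric])
qed

lemma periodise_uminus:
  assumes "\<And>x. f (- x) = f x"
  shows "periodise L f (- z) = periodise L f z"
proof -
  have "bij_betw uminus (latt L) (latt L)"
    by (rule bij_betw_byWitness[where f' = uminus]) auto
  from infsum_reindex_bij_betw[OF this, of "\<lambda>w. f (- z + w)"] show ?thesis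
    using assms[of "z + _"] by (simp add: periodise_def)
qed

context torus_double
begin

lemma periodise_split:
  assumes "f summable_on UNIV"
  shows "periodise L f z = periodise L' f z + periodise L' f (z + \<gamma>)"
proof -
  have "v \<in> (\<lambda>w. \<gamma> + w) ` latt L'" if "v \<in> latt L" "v \<notin> latt L'" for v
  proof -
    have "v + \<gamma> \<in> latt L'"
      using that latt_split by blast
    then have "v - \<gamma> \<in> latt L'"
      using latt_diff[OF _ latt_double, of "v + \<gamma>"] by (simp add: algebra_simps)
    then show ?thesis
      by (intro image_eqI[of _ _ "v - \<gamma>"]) auto
  qed
  moreover have "\<gamma> + w \<in> latt L" if "w \<in> latt L'" for w
    using latt_add[OF _ latt_sub[OF that], of \<gamma>] latt_split[of \<gamma>] latt_double by auto
  ultimately have U: "latt L = latt L' \<union> (\<lambda>w. \<gamma> + w) ` latt L'"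
    using latt_sub by blast
  have D: "latt L' \<inter> (\<lambda>w. \<gamma> + w) ` latt L' = {}"
    using latt_disjoint by (auto simp: add.commute)
  have "periodise L f z = infsum (\<lambda>v. f (z + v)) (latt L') + infsum (\<lambda>v. f (z + v)) ((\<lambda>w. \<gamma> + w) ` latt L')"
    unfolding periodise_def U by (intro infsum_Un_disjoint summable_shift assms D)
  also have "infsum (\<lambda>v. f (z + v)) ((\<lambda>w. \<gamma> + w) ` latt L') = infsum (\<lambda>w. f (z + (\<gamma> + w))) (latt L')"
    by (rule infsum_reindex_bij_betw[symmetric]) (auto simp: bij_betw_def inj_on_def)
  finally show ?thesis
    by (simp add: periodise_def add.assoc)
qed

end

text \<open>The factors of the periods that are reached by doubling one coordinate at a time, as the
  comparison with a double cover requires. The constant powers of 2 are among them and suffice for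
  the limit.\<close>

inductive doubling :: "('d::finite \<Rightarrow> nat) \<Rightarrow> bool" where
  doubling_one: "doubling (\<lambda>_. 1)"
| doubling_step: "doubling m \<Longrightarrow> doubling (m(j := 2 * m j))"

lemma doubling_pos: "doubling m \<Longrightarrow> 0 < m i"
  by (induction rule: doubling.induct) auto

lemma doubling_all:
  assumes "doubling m"
  shows "doubling (\<lambda>i. 2 * m i)"
proof -
  have "doubling (\<lambda>i. if i \<in> I then 2 * m i else m i)" for I
    using finite[of I]
  proof (induction I)
    case empty
    then show ?case using assms by simp
  next
    case (insert j I)
    have "(\<lambda>i. if i \<in> insert j I then 2 * m i else m i)
        = (\<lambda>i. if i \<in> I then 2 * m i else m i)(j := 2 * (if j \<in> I then 2 * m j else m j))"
      using insert.hyps by auto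
    then show ?case
      using doubling_step[OF insert.IH, of j] by simp
  qed
  from this[of UNIV] show ?thesis by simp
qed

lemma doubling_power: "doubling (\<lambda>_. 2 ^ k)"
proof (induction k)
  case 0
  then show ?case using doubling_one by simp
next
  case (Suc k)
  then show ?case using doubling_all[OF Suc] by simp
qed

lemma cell_one: "cell (\<lambda>_ :: 'd::finite. 1) = {0}"
proof -
  have "x = 0" if "x \<in> cell (\<lambda>_ :: 'd. 1)" for x
  proof -
    have "0 \<le> x $ i \<and> x $ i < 1" for i
      using that by (simp add: cell_def)
    then have "x $ i = 0" for i
      by (meson antisym zle_diff1_eq[of _ 1, simplified])
    then show ?thesis
      by (simp add: vec_eq_iff)
  qed
  then show ?thesis
    by (auto simp: cell_def)
qed

lemma sum_cell_double:
  fixes g :: "int ^ 'd::finite \<Rightarrow> real"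
  assumes "0 < m j"
  shows "(\<Sum>c\<in>cell (m(j := 2 * m j)). g c) = (\<Sum>c\<in>cell m. g c + g (c + axis j (int (m j))))"
proof -
  let ?s = "\<lambda>c. c + axis j (int (m j))"
  have ax: "axis j (int (m j)) $ i = (if i = j then int (m j) else 0)" for i
    by (simp add: axis_def)
  have "c \<in> ?s ` cell m" if c: "c \<in> cell (m(j := 2 * m j))" "c \<notin> cell m" for c
  proof -
    have c1: "0 \<le> c $ i" "i \<noteq> j \<Longrightarrow> c $ i < int (m i)" "c $ j < 2 * int (m j)" for i
      using c(1) by (auto simp: cell_def split: if_splits)
    then have "int (m j) \<le> c $ j"
      using c(2) by (auto simp: cell_def) (metis not_le)
    then have "c - axis j (int (m j)) \<in> cell m"
      using c1 by (auto simp: cell_def ax)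
    then show ?thesis
      by (intro image_eqI[of _ _ "c - axis j (int (m j))"]) auto
  qed
  moreover have "c \<in> cell (m(j := 2 * m j))" "?s c \<in> cell (m(j := 2 * m j))" if "c \<in> cell m" for c
  proof -
    have ci: "0 \<le> c $ i" "c $ i < int (m i)" for i
      using that by (auto simp: cell_def)
    have "0 \<le> c $ i \<and> c $ i < int ((m(j := 2 * m j)) i)"
      "0 \<le> ?s c $ i \<and> ?s c $ i < int ((m(j := 2 * m j)) i)" for i
      using ci(1)[of i] ci(2)[of i] by (cases "i = j"; simp add: ax)+
    then show "c \<in> cell (m(j := 2 * m j))" "?s c \<in> cell (m(j := 2 * m j))"
      unfolding cell_def by blast+
  qed
  ultimately have U: "cell (m(j := 2 * m j)) = cell m \<union> ?s ` cell m"
    by blast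
  have "?s c \<notin> cell m" if "c \<in> cell m" for c
  proof
    assume "?s c \<in> cell m"
    then have "c $ j + int (m j) < int (m j)"
      by (auto simp: cell_def ax dest: spec[of _ j])
    moreover have "0 \<le> c $ j"
      using that by (simp add: cell_def)
    ultimately show False by simp
  qed
  then have D: "cell m \<inter> ?s ` cell m = {}"
    by auto
  have "inj_on ?s (cell m)"
    by (auto simp: inj_on_def)
  then show ?thesis
    unfolding U using D finite_cell[of m] by (simp add: sum.union_disjoint sum.reindex sum.distrib)
qed

lemma latt_scale_latt: "latt_scale L c \<in> latt L"
  by (simp add: latt_scale_def latt_def)

lemma latt_scale_add: "latt_scale L (c + c') = latt_scale L c + latt_scale L c'"
  by (simp add: latt_scale_def vec_eq_iff algebra_simps)

lemma latt_scale_axis: "latt_scale L (axis j t) = axis j (int (L j) * t)"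
  by (simp add: latt_scale_def vec_eq_iff axis_def)

lemma latt_scale_0: "latt_scale L 0 = 0"
  by (simp add: latt_scale_def vec_eq_iff)

lemma latt_scale_div: "z \<in> latt L \<Longrightarrow> z = latt_scale L (\<chi> i. z $ i div int (L i))"
  by (simp add: latt_scale_def latt_def vec_eq_iff)

lemma card_cell_power: "card (cell (\<lambda>_ :: 'd::finite. n)) = n ^ CARD('d)"
proof -
  have "bij_betw vec_nth (cell (\<lambda>_ :: 'd. n)) (UNIV \<rightarrow>\<^sub>E {0..<int n})"
    by (rule bij_betw_byWitness[where f' = vec_lambda]) (auto simp: cell_def)
  then have "card (cell (\<lambda>_ :: 'd. n)) = card ((UNIV :: 'd set) \<rightarrow>\<^sub>E {0..<int n})"
    by (rule bij_betw_same_card)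
  then show ?thesis
    by (simp add: card_PiE)
qed

lemma finite_le_sup_norm:
  assumes "finite (F :: (int ^ 'd::finite) set)"
  shows "\<exists>N. \<forall>u\<in>F. sup_norm u < real N"
proof (cases "F = {}")
  case False
  have "\<forall>u\<in>F. sup_norm u < real (nat \<lfloor>Max (sup_norm ` F)\<rfloor> + 1)"
  proof
    fix u assume "u \<in> F"
    then have "sup_norm u \<le> Max (sup_norm ` F)"
      using assms by simp
    then show "sup_norm u < real (nat \<lfloor>Max (sup_norm ` F)\<rfloor> + 1)"
      by linarith
  qed
  then show ?thesis by blast
qed simp

lemma small_tail:
  assumes "0 < \<epsilon>" and g: "g summable_on (UNIV :: (int ^ 'd::finite) set)" "\<And>x. 0 \<le> (g x :: real)"
  shows "\<exists>N. \<forall>G :: (int ^ 'd) set. finite G \<longrightarrow> (\<forall>u\<in>G. real N \<le> sup_norm u) \<longrightarrow> sum g G < \<epsilon>"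
proof -
  obtain F where F: "finite F" "infsum g UNIV - \<epsilon> < sum g F"
  proof -
    have "\<exists>F. finite F \<and> infsum g UNIV - \<epsilon> < sum g F"
    proof (rule ccontr)
      assume "\<not> ?thesis"
      then have "infsum g UNIV \<le> infsum g UNIV - \<epsilon>"
        using g(1) by (intro infsum_le_finite_sums) (auto simp: not_less)
      then show False
        using assms(1) by simp
    qed
    then show thesis using that by blast
  qed
  obtain N where N: "\<forall>u\<in>F. sup_norm u < real N"
    using finite_le_sup_norm[OF F(1)] by blast
  show ?thesis
  proof (intro exI[of _ N] allI impI)
    fix G :: "(int ^ 'd) set" assume G: "finite G" "\<forall>u\<in>G. real N \<le> sup_norm u"
    then have "F \<inter> G = {}"
      using N by fastforce
    then have "sum g F + sum g G = sum g (F \<union> G)"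
      using F(1) G(1) by (simp add: sum.union_disjoint)
    also have "\<dots> \<le> infsum g UNIV"
      using F(1) G(1) g by (intro finite_sum_le_infsum) auto
    finally show "sum g G < \<epsilon>"
      using F(2) by linarith
  qed
qed

text \<open>Unrolling \<open>M\<close> times in each direction produces \<open>M ^ CARD('d)\<close>
  copies, each with a boundary error supported where \<open>M \<le> 2 * sup_norm x + 2\<close>. The
  moment condition makes the total error vanish in the limit.\<close>

locale torus_sequence =
  fixes L :: "'d::finite \<Rightarrow> nat" and \<beta> :: real
  assumes L3: "\<And>i. 3 \<le> L i" and \<beta>0: "0 \<le> \<beta>"
    and tau_summable: "(\<lambda>x :: int ^ 'd. tau \<beta> 0 x) summable_on UNIV"
    and moment_summable: "(\<lambda>x :: int ^ 'd. (2 * sup_norm x + 2) ^ CARD('d) * tau \<beta> 0 x) summable_on UNIV"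
begin

section \<open>The upper bound: unrolling the torus by repeated doubling\<close>

lemma L_pos': "0 < L i"
  using L3[of i] by linarith

abbreviation mL :: "('d \<Rightarrow> nat) \<Rightarrow> 'd \<Rightarrow> nat" where
  "mL m \<equiv> (\<lambda>i. m i * L i)"

abbreviation f :: "int ^ 'd \<Rightarrow> real" where
  "f \<equiv> tau \<beta> 0"

lemma f_nonneg: "0 \<le> f x"
  by (rule tau_nonneg[OF \<beta>0])

lemma doubling_locale:
  assumes "doubling m"
  shows "torus_double (mL m) (mL (m(j := 2 * m j))) j (axis j (int (m j * L j))) \<beta>"
proof
  show "0 < m i * L i" for i
    using doubling_pos[OF assms] L_pos' by simp
  show "mL (m(j := 2 * m j)) = (mL m)(j := 2 * (m j * L j))"
    by auto
qed (rule \<beta>0, rule refl)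

lemma shift_axis: "latt_scale L (c + axis j (int (m j))) = latt_scale L c + axis j (int (m j * L j))"
  by (simp add: latt_scale_add latt_scale_axis mult.commute)

lemma torus_corr_le_sum:
  assumes "doubling m"
  shows "torus_corr L \<beta> x \<le> (\<Sum>c\<in>cell m. torus_corr (mL m) \<beta> (x + latt_scale L c))"
  using assms
proof induction
  case doubling_one
  show ?case
    unfolding cell_one by (simp add: latt_scale_0)
next
  case (doubling_step m j)
  interpret torus_double "mL m" "mL (m(j := 2 * m j))" j "axis j (int (m j * L j))" \<beta>
    by (rule doubling_locale[OF doubling_step.hyps])
  note doubling_step.IH
  also have "(\<Sum>c\<in>cell m. torus_corr (mL m) \<beta> (x + latt_scale L c))
      \<le> (\<Sum>c\<in>cell m. torus_corr (mL (m(j := 2 * m j))) \<beta> (x + latt_scale L c)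
          + torus_corr (mL (m(j := 2 * m j))) \<beta> (x + latt_scale L (c + axis j (int (m j)))))"
    unfolding shift_axis add.assoc[symmetric] by (intro sum_mono torus_corr_le)
  also have "\<dots> = (\<Sum>c\<in>cell (m(j := 2 * m j)). torus_corr (mL (m(j := 2 * m j))) \<beta> (x + latt_scale L c))"
    using doubling_pos[OF doubling_step.hyps] by (intro sum_cell_double[symmetric])
  finally show ?case .
qed

lemma periodise_sum:
  assumes "doubling m"
  shows "periodise L f z = (\<Sum>c\<in>cell m. periodise (mL m) f (z + latt_scale L c))"
  using assms
proof induction
  case doubling_one
  show ?case
    unfolding cell_one by (simp add: latt_scale_0)
next
  case (doubling_step m j)
  interpret torus_double "mL m" "mL (m(j := 2 * m j))" j "axis j (int (m j * L j))" \<beta>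
    by (rule doubling_locale[OF doubling_step.hyps])
  note doubling_step.IH
  also have "(\<Sum>c\<in>cell m. periodise (mL m) f (z + latt_scale L c))
      = (\<Sum>c\<in>cell m. periodise (mL (m(j := 2 * m j))) f (z + latt_scale L c)
          + periodise (mL (m(j := 2 * m j))) f (z + latt_scale L (c + axis j (int (m j)))))"
    unfolding shift_axis add.assoc[symmetric] by (intro sum.cong refl periodise_split tau_summable)
  also have "\<dots> = (\<Sum>c\<in>cell (m(j := 2 * m j)). periodise (mL (m(j := 2 * m j))) f (z + latt_scale L c))"
    using doubling_pos[OF doubling_step.hyps] by (intro sum_cell_double[symmetric])
  finally show ?case .
qed

lemma sum_cell_mL:
  fixes g :: "int ^ 'd \<Rightarrow> real"
  assumes "doubling m"
  shows "(\<Sum>y\<in>cell (mL m). g y) = (\<Sum>y\<in>cell L. \<Sum>c\<in>cell m. g (y + latt_scale L c))"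
  using assms
proof (induction arbitrary: g)
  case doubling_one
  show ?case
    unfolding cell_one by (simp add: latt_scale_0)
next
  case (doubling_step m j)
  have eq: "mL (m(j := 2 * m j)) = (mL m)(j := 2 * mL m j)"
    by auto
  have pos: "0 < mL m j" "0 < m j"
    using doubling_pos[OF doubling_step.hyps] L_pos' by auto
  have "(\<Sum>y\<in>cell (mL (m(j := 2 * m j))). g y)
      = (\<Sum>y\<in>cell (mL m). g y + g (y + axis j (int (m j * L j))))"
    unfolding eq using pos(1) sum_cell_double[of "mL m" j g] by simp
  also have "\<dots> = (\<Sum>y\<in>cell L. \<Sum>c\<in>cell m. g (y + latt_scale L c) + g (y + latt_scale L c + axis j (int (m j * L j))))"
    by (rule doubling_step.IH)
  also have "\<dots> = (\<Sum>y\<in>cell L. \<Sum>c\<in>cell (m(j := 2 * m j)). g (y + latt_scale L c))"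
    unfolding sum_cell_double[where m = m, OF pos(2)] shift_axis by (simp add: add.assoc)
  finally show ?case .
qed

text \<open>On the torus enlarged by the factor \<open>M = 2 ^ k\<close>, each copy of
  \<open>x\<close> is compared with a box of side \<open>M\<close>. Points of that box that are
  congruent to different copies are different, so the main terms form a part of the
  periodisation.\<close>

theorem torus_corr_le_periodise: "torus_corr L \<beta> x \<le> periodise L f x"
proof (rule field_le_epsilon)
  fix \<epsilon> :: real assume \<epsilon>: "0 < \<epsilon>"
  define C where "C = 2 * real CARD('d) * \<beta>"
  have C: "0 \<le> C"
    using \<beta>0 by (simp add: C_def)
  let ?g = "\<lambda>x :: int ^ 'd. (2 * sup_norm x + 2) ^ CARD('d) * f x"
  have sn: "0 \<le> sup_norm u" for u :: "int ^ 'd"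
    using sup_norm_ge[of u undefined] by linarith
  have "0 < \<epsilon> / (C + 1)"
    using \<epsilon> C by simp
  then obtain N where N: "\<And>G. finite G \<Longrightarrow> \<forall>u\<in>G. real N \<le> sup_norm u \<Longrightarrow> sum ?g G < \<epsilon> / (C + 1)"
    using small_tail[OF _ moment_summable] sn f_nonneg by (metis (no_types, lifting) add_nonneg_nonneg mult_nonneg_nonneg zero_le_numeral zero_le_power)
  obtain k where k: "2 * (real N + 1) < 2 ^ k"
    using real_arch_pow[of 2 "2 * (real N + 1)"] by auto
  define M :: nat where "M = 2 ^ k"
  let ?m = "\<lambda>_ :: 'd. M"
  let ?B = "box_vertices M :: (int ^ 'd) set"
  have dm: "doubling ?m"
    unfolding M_def by (rule doubling_power)
  have M: "0 < M" "2 * (real N + 1) < real M"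
    using k by (simp_all add: M_def)
  have M_less: "M < mL ?m i" for i
    using M(1) L3[of i] by (simp add: less_le_trans[of _ "M * 2"])
  let ?G = "{u \<in> ?B. real M / 2 - 1 \<le> sup_norm u}"
  \<comment> \<open>On the boundary layer the number of copies is at most the weight in the moment
    sum.\<close>
  have tail: "real M ^ CARD('d) * (\<Sum>u\<in>?G. f u) \<le> sum ?g ?G"
    unfolding sum_distrib_left
  proof (intro sum_mono mult_right_mono f_nonneg power_mono)
    fix u assume "u \<in> ?G"
    then show "real M \<le> 2 * sup_norm u + 2" by simp
  qed simp
  have small: "sum ?g ?G < \<epsilon> / (C + 1)"
  proof (rule N)
    show "finite ?G"
      by (rule finite_subset[OF _ finite_box[of M]]) auto
    show "\<forall>u\<in>?G. real N \<le> sup_norm u"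
      using M(2) by auto
  qed
  have err: "real M ^ CARD('d) * (C * (\<Sum>u\<in>?G. f u)) \<le> \<epsilon>"
  proof -
    have "real M ^ CARD('d) * (C * (\<Sum>u\<in>?G. f u)) = C * (real M ^ CARD('d) * (\<Sum>u\<in>?G. f u))"
      by simp
    also have "\<dots> \<le> C * (\<epsilon> / (C + 1))"
      using tail small C by (intro mult_left_mono) auto
    also have "\<dots> \<le> \<epsilon>"
      using C \<epsilon> by (simp add: field_simps)
    finally show ?thesis .
  qed
  have "torus_corr L \<beta> x \<le> (\<Sum>c\<in>cell ?m. torus_corr (mL ?m) \<beta> (x + latt_scale L c))"
    by (rule torus_corr_le_sum[OF dm])
  also have "\<dots> \<le> (\<Sum>c\<in>cell ?m. (\<Sum>z | z \<in> ?B \<and> x + latt_scale L c - z \<in> latt (mL ?m). f z) + C * (\<Sum>u\<in>?G. f u))"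
    unfolding C_def by (intro sum_mono torus_corr_le_tau \<beta>0 M(1) M_less)
  also have "\<dots> = (\<Sum>c\<in>cell ?m. \<Sum>z | z \<in> ?B \<and> x + latt_scale L c - z \<in> latt (mL ?m). f z)
      + real M ^ CARD('d) * (C * (\<Sum>u\<in>?G. f u))"
    by (simp add: sum.distrib card_cell_power)
  also have "(\<Sum>c\<in>cell ?m. \<Sum>z | z \<in> ?B \<and> x + latt_scale L c - z \<in> latt (mL ?m). f z) \<le> periodise L f x"
  proof -
    let ?P = "\<lambda>z c. x + latt_scale L c - z \<in> latt (mL ?m)"
    have sub: "w \<in> latt L" if "w \<in> latt (mL ?m)" for w
      using that by (auto simp: latt_def intro: dvd_mult_right)
    have uniq: "c = c'" if cc: "c \<in> cell ?m" "c' \<in> cell ?m" "?P z c" "?P z c'" for z c c'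
    proof -
      have "latt_scale L c - latt_scale L c' \<in> latt (mL ?m)"
        using latt_diff[OF cc(3,4)] by simp
      then have d: "int M * int (L i) dvd (c $ i - c' $ i) * int (L i)" for i
        by (simp add: latt_def latt_scale_def right_diff_distrib[symmetric] mult.commute[of "int (L i)"])
      have "int M dvd c $ i - c' $ i" for i
        using d[of i] L_pos'[of i] by simp
      then have "c - c' \<in> latt ?m"
        by (simp add: latt_def)
      then show ?thesis
        using red_eq_iff[of ?m c c'] red_id cc(1,2) by metis
    qed
    have "(\<Sum>c\<in>cell ?m. \<Sum>z | z \<in> ?B \<and> ?P z c. f z) = (\<Sum>c\<in>cell ?m. \<Sum>z\<in>?B. if ?P z c then f z else 0)"
      by (intro sum.cong refl sum.inter_filter finite_box)
    also have "\<dots> = (\<Sum>z\<in>?B. \<Sum>c\<in>cell ?m. if ?P z c then f z else 0)"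
      by (rule sum.swap)
    also have "\<dots> \<le> (\<Sum>z\<in>?B. if z - x \<in> latt L then f z else 0)"
    proof (rule sum_mono)
      fix z assume "z \<in> ?B"
      show "(\<Sum>c\<in>cell ?m. if ?P z c then f z else 0) \<le> (if z - x \<in> latt L then f z else 0)"
      proof (cases "\<exists>c\<in>cell ?m. ?P z c")
        case True
        then obtain c where c: "c \<in> cell ?m" "?P z c" ..
        have "(\<Sum>c\<in>cell ?m. if ?P z c then f z else 0) = (\<Sum>c'\<in>cell ?m. if c' = c then f z else 0)"
          using c uniq by (intro sum.cong refl) auto
        also have "\<dots> = f z"
          using c finite_cell[of ?m] by simp
        also have "latt_scale L c - (x + latt_scale L c - z) \<in> latt L"
          by (rule latt_diff[OF latt_scale_latt sub[OF c(2)]])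
        then have "f z = (if z - x \<in> latt L then f z else 0)"
          by simp
        finally show ?thesis by simp
      next
        case False
        then show ?thesis
          using f_nonneg[of z] by simp
      qed
    qed
    also have "\<dots> = (\<Sum>z | z \<in> ?B \<and> z - x \<in> latt L. f z)"
      by (rule sum.inter_filter[OF finite_box, symmetric])
    also have "\<dots> = (\<Sum>v\<in>(\<lambda>z. z - x) ` {z \<in> ?B. z - x \<in> latt L}. f (x + v))"
      by (subst sum.reindex) (auto simp: inj_on_def)
    also have "\<dots> \<le> periodise L f x"
    proof (rule sum_le_periodise[OF tau_summable f_nonneg])
      show "finite ((\<lambda>z. z - x) ` {z \<in> ?B. z - x \<in> latt L})"
        by (intro finite_imageI finite_subset[OF _ finite_box[of M]]) auto
    qed auto
    finally show ?thesis .
  qed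
  finally show "torus_corr L \<beta> x \<le> periodise L f x + \<epsilon>"
    using err by linarith
qed


section \<open>The lower bound: accumulating the defects of the doublings\<close>

lemma mL_ge_3: "doubling m \<Longrightarrow> 3 \<le> mL m i"
  using doubling_pos[of m i] L3[of i] mult_le_mono[of 1 "m i" 3 "L i"] by simp

text \<open>The enlarged torus satisfies the assumptions of the locale again, so the upper bound
  holds at every stage; this controls the error terms of the lower bound.\<close>

lemma torus_corr_mL_le:
  assumes "doubling m"
  shows "torus_corr (mL m) \<beta> x \<le> periodise (mL m) f x"
  by (rule torus_sequence.torus_corr_le_periodise, unfold_locales)
    (use mL_ge_3[OF assms] \<beta>0 tau_summable moment_summable in auto)

definition B :: "int ^ 'd \<Rightarrow> real" where
  "B x = (\<Sum>y\<in>cell L. periodise L f y * periodise L f (x - y))"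

text \<open>As a function of \<open>y\<close>, \<open>periodise L f (x - y)\<close> has the periods
  \<open>L\<close>, so summing the other factor over the copies of \<open>y\<close> turns its
  periodisation over the sparser lattice into the one over \<open>latt L\<close>.\<close>

lemma B_mL:
  assumes "doubling m"
  shows "(\<Sum>y\<in>cell (mL m). periodise (mL m) f y * periodise L f (x - y)) = B x"
proof -
  have "(\<Sum>y\<in>cell (mL m). periodise (mL m) f y * periodise L f (x - y))
      = (\<Sum>y\<in>cell L. \<Sum>c\<in>cell m. periodise (mL m) f (y + latt_scale L c) * periodise L f (x - (y + latt_scale L c)))"
    by (rule sum_cell_mL[OF assms])
  also have "\<dots> = (\<Sum>y\<in>cell L. \<Sum>c\<in>cell m. periodise (mL m) f (y + latt_scale L c) * periodise L f (x - y))"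
    using latt_scale_latt[of L] by (intro sum.cong refl arg_cong2[of _ _ _ _ "(*)"] periodise_cong) (simp add: algebra_simps)
  also have "\<dots> = B x"
    unfolding B_def periodise_sum[OF assms, of "_ :: int ^ 'd"] sum_distrib_right[symmetric]
    by (simp add: periodise_sum[OF assms])
  finally show ?thesis .
qed

text \<open>Summing over the copies of \<open>x\<close> collapses the second factor and
  \<open>B_mL\<close> the first. This is why the error terms of all stages carry the same factor
  \<open>B x\<close>.\<close>

lemma B_conv:
  assumes "doubling m"
  shows "(\<Sum>c\<in>cell m. \<Sum>y\<in>cell (mL m). periodise (mL m) f y * periodise (mL m) f (x + latt_scale L c - y)) = B x"
proof -
  have "(\<Sum>c\<in>cell m. \<Sum>y\<in>cell (mL m). periodise (mL m) f y * periodise (mL m) f (x + latt_scale L c - y))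
      = (\<Sum>y\<in>cell (mL m). periodise (mL m) f y * (\<Sum>c\<in>cell m. periodise (mL m) f (x - y + latt_scale L c)))"
    by (subst sum.swap) (simp add: sum_distrib_left algebra_simps)
  also have "\<dots> = B x"
    unfolding periodise_sum[OF assms, symmetric] by (rule B_mL[OF assms])
  finally show ?thesis .
qed

lemma B_nonneg: "0 \<le> B x"
  unfolding B_def by (intro sum_nonneg mult_nonneg_nonneg periodise_nonneg f_nonneg)

lemma f_uminus: "f (- x) = f x"
  by (rule tau_uminus[OF \<beta>0])

text \<open>A stage costs the correlation at \<open>?\<gamma>\<close>. This is at most the new
  periodisation there, which equals the drop of the periodisation at 0 caused by the doubling, and
  the drops telescope. The set \<open>A\<close> of inequivalent points provides the diagonal terms
  that are subtracted from \<open>B 0\<close>.\<close>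

theorem sum_torus_corr_le:
  assumes "doubling m"
    and A: "finite A" "inj_on (red L) A" and half: "B 0 - (\<Sum>z\<in>A. f z * f z) \<le> 1 / 2"
  shows "(\<Sum>c\<in>cell m. torus_corr (mL m) \<beta> (x + latt_scale L c)) - torus_corr L \<beta> x
    \<le> 2 * B x * (periodise L f 0 - periodise (mL m) f 0)"
  using assms(1)
proof induction
  case doubling_one
  show ?case
    unfolding cell_one by (simp add: latt_scale_0)
next
  case (doubling_step m j)
  let ?m' = "m(j := 2 * m j)"
  let ?\<gamma> = "axis j (int (m j * L j))"
  let ?e = "axis j (int (m j))"
  have dm': "doubling ?m'"
    by (rule doubling.doubling_step[OF doubling_step.hyps])
  interpret torus_double "mL m" "mL ?m'" j ?\<gamma> \<beta>
    by (rule doubling_locale[OF doubling_step.hyps])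
  let ?Q = "periodise (mL m) f" and ?Q' = "periodise (mL ?m') f"
  have split: "?Q z = ?Q' z + ?Q' (z + ?\<gamma>)" for z
    by (rule periodise_split[OF tau_summable])
  have P_le: "P z \<le> ?Q z" for z
    unfolding P_def split by (intro add_mono torus_corr_mL_le[OF dm'])
  have P0: "0 \<le> P z" for z
    unfolding P_def using torus_corr_nonneg[of "mL ?m'" \<beta>] L'_pos \<beta>0 by (simp add: add_nonneg_nonneg)
  have \<theta>: "torus_corr (mL ?m') \<beta> ?\<gamma> \<le> ?Q 0 - ?Q' 0" "0 \<le> torus_corr (mL ?m') \<beta> ?\<gamma>"
    using torus_corr_mL_le[OF dm', of ?\<gamma>] split[of 0] torus_corr_nonneg[of "mL ?m'" \<beta>] L'_pos \<beta>0 by auto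
  \<comment> \<open>\<open>B 0\<close> contains the term \<open>f 0 * f 0 = 1\<close> and is never
    small. But \<open>- z\<close> and \<open>?\<gamma> - z\<close> belong to different copies, so
    the values of \<open>?Q'\<close> at both add up to at most \<open>periodise L f (0 - z)\<close>,
    and the square of \<open>?Q' z\<close> can be subtracted.\<close>
  have \<kappa>: "(\<Sum>z\<in>cell (mL ?m'). torus_corr (mL ?m') \<beta> z * torus_corr (mL ?m') \<beta> (?\<gamma> - z)) \<le> 1 / 2"
  proof -
    have mj: "0 < m j"
      by (rule doubling_pos[OF doubling_step.hyps])
    have c: "0 \<in> cell ?m'" "?e \<in> cell ?m'" "0 \<noteq> ?e"
      using doubling_pos[OF doubling_step.hyps] by (auto simp: cell_def axis_def axis_eq_0_iff vec_eq_iff)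
    have *: "?Q' (- z) + ?Q' (?\<gamma> - z) \<le> periodise L f (0 - z)" for z
    proof -
      have "?Q' (- z) + ?Q' (?\<gamma> - z) = (\<Sum>c\<in>{0, ?e}. ?Q' (0 - z + latt_scale L c))"
        using c(3) by (simp add: latt_scale_0 latt_scale_axis mult.commute)
      also have "\<dots> \<le> (\<Sum>c\<in>cell ?m'. ?Q' (0 - z + latt_scale L c))"
        using c by (intro sum_mono2 finite_cell periodise_nonneg f_nonneg) auto
      also have "\<dots> = periodise L f (0 - z)"
        by (rule periodise_sum[OF dm', symmetric])
      finally show ?thesis .
    qed
    have nn: "0 \<le> ?Q' z" for z
      by (rule periodise_nonneg) (rule f_nonneg)
    have "(\<Sum>z\<in>cell (mL ?m'). torus_corr (mL ?m') \<beta> z * torus_corr (mL ?m') \<beta> (?\<gamma> - z))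
        \<le> (\<Sum>z\<in>cell (mL ?m'). ?Q' z * ?Q' (?\<gamma> - z))"
      using torus_corr_nonneg[of "mL ?m'" \<beta>] L'_pos \<beta>0
      by (intro sum_mono mult_mono torus_corr_mL_le[OF dm'] nn) auto
    also have "\<dots> \<le> (\<Sum>z\<in>cell (mL ?m'). ?Q' z * periodise L f (0 - z) - ?Q' z * ?Q' z)"
    proof (rule sum_mono)
      fix z
      have "?Q' (?\<gamma> - z) \<le> periodise L f (0 - z) - ?Q' z"
        using *[of z] periodise_uminus[of f "mL ?m'" z] f_uminus by simp
      then show "?Q' z * ?Q' (?\<gamma> - z) \<le> ?Q' z * periodise L f (0 - z) - ?Q' z * ?Q' z"
        using mult_left_mono[OF _ nn[of z]] by (simp add: right_diff_distrib[symmetric])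
    qed
    also have "\<dots> = B 0 - (\<Sum>z\<in>cell (mL ?m'). ?Q' z * ?Q' z)"
      using B_mL[OF dm', of 0] by (simp add: sum_subtractf)
    also have "\<dots> \<le> B 0 - (\<Sum>z\<in>A. f z * f z)"
    proof -
      have inj: "inj_on (red (mL ?m')) A"
      proof (rule inj_onI)
        fix u v assume uv: "u \<in> A" "v \<in> A" "red (mL ?m') u = red (mL ?m') v"
        then have "u - v \<in> latt L"
          by (auto simp: red_eq_iff latt_def intro: dvd_mult_right)
        then show "u = v"
          using uv A(2) by (auto simp: inj_on_def red_eq_iff)
      qed
      have "(\<Sum>z\<in>A. f z * f z) \<le> (\<Sum>z\<in>A. ?Q' (red (mL ?m') z) * ?Q' (red (mL ?m') z))"
      proof (rule sum_mono)
        fix z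
        have "f z \<le> ?Q' z"
          by (rule le_periodise[OF tau_summable f_nonneg])
        moreover have "?Q' (red (mL ?m') z) = ?Q' z"
          by (rule periodise_cong) (rule red_diff_latt)
        ultimately show "f z * f z \<le> ?Q' (red (mL ?m') z) * ?Q' (red (mL ?m') z)"
          using f_nonneg[of z] by (simp add: mult_mono)
      qed
      also have "\<dots> = (\<Sum>z\<in>red (mL ?m') ` A. ?Q' z * ?Q' z)"
        by (simp only: sum.reindex[OF inj] comp_def)
      also have "\<dots> \<le> (\<Sum>z\<in>cell (mL ?m'). ?Q' z * ?Q' z)"
        using cell_L' by (intro sum_mono2 finite_cell) auto
      finally show ?thesis by simp
    qed
    finally show ?thesis
      using half by simp
  qed
  have eq: "(\<Sum>c\<in>cell ?m'. torus_corr (mL ?m') \<beta> (x + latt_scale L c))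
      = (\<Sum>c\<in>cell m. torus_corr (mL ?m') \<beta> (x + latt_scale L c)
          + torus_corr (mL ?m') \<beta> (x + latt_scale L (c + ?e)))"
    using doubling_pos[OF doubling_step.hyps] by (intro sum_cell_double)
  have "(\<Sum>c\<in>cell ?m'. torus_corr (mL ?m') \<beta> (x + latt_scale L c))
      - (\<Sum>c\<in>cell m. torus_corr (mL m) \<beta> (x + latt_scale L c))
      \<le> (\<Sum>c\<in>cell m. torus_corr (mL ?m') \<beta> ?\<gamma> * (2 * (\<Sum>y\<in>cell (mL m). P y * P (x + latt_scale L c - y))))"
    unfolding eq sum_subtractf[symmetric] shift_axis add.assoc[symmetric] by (intro sum_mono le_torus_corr \<kappa>)
  also have "\<dots> \<le> (\<Sum>c\<in>cell m. (?Q 0 - ?Q' 0) * (2 * (\<Sum>y\<in>cell (mL m). ?Q y * ?Q (x + latt_scale L c - y))))"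
  proof (rule sum_mono)
    fix c
    let ?z = "x + latt_scale L c"
    have 1: "(\<Sum>y\<in>cell (mL m). P y * P (?z - y)) \<le> (\<Sum>y\<in>cell (mL m). ?Q y * ?Q (?z - y))"
      by (intro sum_mono mult_mono P_le P0 order.trans[OF P0 P_le])
    have 2: "0 \<le> (\<Sum>y\<in>cell (mL m). P y * P (?z - y))"
      by (intro sum_nonneg mult_nonneg_nonneg P0)
    show "torus_corr (mL ?m') \<beta> ?\<gamma> * (2 * (\<Sum>y\<in>cell (mL m). P y * P (?z - y)))
        \<le> (?Q 0 - ?Q' 0) * (2 * (\<Sum>y\<in>cell (mL m). ?Q y * ?Q (?z - y)))"
      by (rule mult_mono[OF \<theta>(1)]) (use 1 2 \<theta> in linarith)+
  qed
  also have "\<dots> = 2 * B x * (?Q 0 - ?Q' 0)"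
    unfolding sum_distrib_left[symmetric] B_conv[OF doubling_step.hyps] by simp
  finally have step: "(\<Sum>c\<in>cell ?m'. torus_corr (mL ?m') \<beta> (x + latt_scale L c))
      - (\<Sum>c\<in>cell m. torus_corr (mL m) \<beta> (x + latt_scale L c)) \<le> 2 * B x * (?Q 0 - ?Q' 0)" .
  have "2 * B x * (periodise L f 0 - ?Q' 0) = 2 * B x * (?Q 0 - ?Q' 0) + 2 * B x * (periodise L f 0 - ?Q 0)"
    by (simp only: distrib_left[symmetric]) simp
  then show ?case
    using step doubling_step.IH by linarith
qed

text \<open>A finite part of the periodisation is visible in boxes of side \<open>2 ^ k\<close>,
  which embed in the torus enlarged by that factor; there the defect is bounded uniformly in
  \<open>k\<close>. The 1 is \<open>f 0\<close>, which stays in every periodisation at 0.\<close>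

theorem periodise_le_torus_corr:
  assumes A: "finite A" "inj_on (red L) A" and half: "B 0 - (\<Sum>z\<in>A. f z * f z) \<le> 1 / 2"
  shows "periodise L f x \<le> torus_corr L \<beta> x + 2 * B x * (periodise L f 0 - 1)"
  unfolding periodise_def[of L f x]
proof (rule infsum_le_finite_sums)
  show "(\<lambda>v. f (x + v)) summable_on latt L"
    by (rule summable_shift[OF tau_summable])
  fix F assume F: "finite F" "F \<subseteq> latt L"
  have le: "(\<Sum>v\<in>F. tau_box (2 ^ k) \<beta> 0 (x + v)) \<le> torus_corr L \<beta> x + 2 * B x * (periodise L f 0 - 1)"
    if box: "\<forall>v\<in>F. x + v \<in> box_vertices (2 ^ k)" for k
  proof -
    define M :: nat where "M = 2 ^ k"
    let ?m = "\<lambda>_ :: 'd. M"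
    have dm: "doubling ?m"
      unfolding M_def by (rule doubling_power)
    have M: "0 < M" "\<And>i. M \<le> mL ?m i"
      using L_pos' by (auto simp: M_def Suc_le_eq)
    \<comment> \<open>The copy to which the period \<open>v\<close> leads, with its index reduced
      modulo \<open>M\<close>.\<close>
    define c where "c v = red ?m (\<chi> i. v $ i div int (L i))" for v :: "int ^ 'd"
    have c: "latt_scale L (c v) - v \<in> latt (mL ?m)" if "v \<in> F" for v
    proof -
      have "c v - (\<chi> i. v $ i div int (L i)) \<in> latt ?m"
        unfolding c_def by (rule red_diff_latt)
      then have "latt_scale L (c v) - latt_scale L (\<chi> i. v $ i div int (L i)) \<in> latt (mL ?m)"
        by (simp add: latt_def latt_scale_def right_diff_distrib[symmetric] mult.commute[of "int M"])
      then show ?thesis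
        using latt_scale_div[of v L] that F by auto
    qed
    have inj: "inj_on c F"
    proof (rule inj_onI)
      fix u v assume uv: "u \<in> F" "v \<in> F" "c u = c v"
      have "latt_scale L (c v) - v - (latt_scale L (c u) - u) \<in> latt (mL ?m)"
        by (rule latt_diff[OF c[OF uv(2)] c[OF uv(1)]])
      then have "x + u - (x + v) \<in> latt (mL ?m)"
        using uv(3) by simp
      then have "x + u = x + v"
        using box uv(1,2) by (intro box_latt_eq[OF M(2)]) (auto simp: M_def)
      then show "u = v" by simp
    qed
    have "(\<Sum>v\<in>F. tau_box (2 ^ k) \<beta> 0 (x + v)) \<le> (\<Sum>v\<in>F. torus_corr (mL ?m) \<beta> (x + v))"
      using box by (intro sum_mono) (use M in \<open>auto simp: M_def[symmetric] intro!: tau_box_le_torus_corr \<beta>0\<close>)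
    also have "\<dots> = (\<Sum>v\<in>F. torus_corr (mL ?m) \<beta> (x + latt_scale L (c v)))"
      using latt_uminus_iff[of "latt_scale L (c _) - _" "mL ?m"] c
      by (intro sum.cong refl torus_corr_cong) (metis (no_types, lifting) add_diff_cancel_left minus_diff_eq)
    also have "\<dots> = (\<Sum>c\<in>c ` F. torus_corr (mL ?m) \<beta> (x + latt_scale L c))"
      by (simp add: sum.reindex[OF inj])
    also have "\<dots> \<le> (\<Sum>c\<in>cell ?m. torus_corr (mL ?m) \<beta> (x + latt_scale L c))"
      using M(1) L_pos' \<beta>0 by (intro sum_mono2 finite_cell torus_corr_nonneg) (auto simp: c_def intro: red_cell)
    also have "\<dots> \<le> torus_corr L \<beta> x + 2 * B x * (periodise L f 0 - periodise (mL ?m) f 0)"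
      using sum_torus_corr_le[OF dm A half, of x] by simp
    also have "\<dots> \<le> torus_corr L \<beta> x + 2 * B x * (periodise L f 0 - 1)"
    proof -
      have "f 0 = 1"
        by (rule tau_0[OF \<beta>0])
      then show ?thesis
        using le_periodise[OF tau_summable f_nonneg, of 0 "mL ?m"] B_nonneg[of x]
        by (intro add_left_mono mult_left_mono) auto
    qed
    finally show ?thesis .
  qed
  have "\<exists>r. \<forall>v\<in>F. x + v \<in> box_vertices r"
  proof -
    have "\<forall>v. \<exists>r. x + v \<in> box_vertices r"
      using ex_box by blast
    then obtain R where R: "\<And>v. x + v \<in> box_vertices (R v)"
      by metis
    have "x + v \<in> box_vertices (Max (R ` F))" if "v \<in> F" for v
      using R[of v] box_mono[of "R v" "Max (R ` F)"] F(1) that by auto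
    then show ?thesis by blast
  qed
  then obtain r where r: "\<forall>v\<in>F. x + v \<in> box_vertices r" ..
  have "r \<le> 2 ^ k" if "r \<le> k" for k
    using that less_exp[of k] by linarith
  then have ev: "\<forall>k\<ge>r. (\<Sum>v\<in>F. tau_box (2 ^ k) \<beta> 0 (x + v)) \<le> torus_corr L \<beta> x + 2 * B x * (periodise L f 0 - 1)"
    using r box_mono le by (meson subsetD)
  have "filterlim (\<lambda>k. 2 ^ k :: nat) sequentially sequentially"
    by (rule filterlim_subseq) (simp add: strict_mono_def)
  then have "(\<lambda>k. \<Sum>v\<in>F. tau_box (2 ^ k) \<beta> 0 (x + v)) \<longlonglongrightarrow> (\<Sum>v\<in>F. f (x + v))"
    by (intro tendsto_sum filterlim_compose[OF tau_box_tendsto_tau[OF \<beta>0]])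
  then show "(\<Sum>v\<in>F. f (x + v)) \<le> torus_corr L \<beta> x + 2 * B x * (periodise L f 0 - 1)"
    using ev by (rule LIMSEQ_le_const2[OF _ exI])
qed

end

section \<open>Sums over the lattice\<close>

lemma sup_norm_attained: "\<exists>i. sup_norm x = real_of_int \<bar>x $ i\<bar>"
proof -
  have "Max (range (\<lambda>i. \<bar>x $ i\<bar>)) \<in> range (\<lambda>i. \<bar>x $ i\<bar>)"
    by (rule Max_in) auto
  then obtain i where "Max (range (\<lambda>i. \<bar>x $ i\<bar>)) = \<bar>x $ i\<bar>"
    by (rule rangeE)
  then show ?thesis
    unfolding sup_norm_def by (intro exI[of _ i]) (simp only:)
qed

lemma sup_norm_le: "(\<And>i. real_of_int \<bar>x $ i\<bar> \<le> t) \<Longrightarrow> sup_norm x \<le> t"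
  using sup_norm_attained[of x] by metis

lemma sup_norm_nonneg: "0 \<le> sup_norm x"
  using sup_norm_ge[of x undefined] by linarith

lemma sup_norm_triangle: "sup_norm (x + y) \<le> sup_norm x + sup_norm y"
proof (rule sup_norm_le)
  fix i
  show "real_of_int \<bar>(x + y) $ i\<bar> \<le> sup_norm x + sup_norm y"
    using sup_norm_ge[of x i] sup_norm_ge[of y i] by simp
qed

lemma sup_norm_uminus: "sup_norm (- x) = sup_norm x"
  by (simp add: sup_norm_def)

lemma sup_norm_scale: "sup_norm (latt_scale (\<lambda>_. r) u) = real r * sup_norm u"
proof (rule antisym)
  show "sup_norm (latt_scale (\<lambda>_. r) u) \<le> real r * sup_norm u"
    by (rule sup_norm_le) (simp add: latt_scale_def abs_mult mult_left_mono[OF sup_norm_ge[simplified]])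
  obtain i where "sup_norm u = real_of_int \<bar>u $ i\<bar>"
    using sup_norm_attained by blast
  then show "real r * sup_norm u \<le> sup_norm (latt_scale (\<lambda>_. r) u)"
    using sup_norm_ge[of "latt_scale (\<lambda>_. r) u" i] by (simp add: latt_scale_def abs_mult)
qed

lemma sup_norm_ge_1:
  assumes "u \<noteq> 0"
  shows "1 \<le> sup_norm u"
proof -
  obtain i where "u $ i \<noteq> 0"
    using assms by (auto simp: vec_eq_iff)
  then have "1 \<le> real_of_int \<bar>u $ i\<bar>"
    by linarith
  then show ?thesis
    using sup_norm_ge[of u i] by linarith
qed

lemma sup_norm_box: "x \<in> box_vertices r \<Longrightarrow> sup_norm x \<le> real r / 2"
proof (rule sup_norm_le)
  fix i assume "x \<in> box_vertices r"
  then have "- int r \<le> 2 * x $ i" "2 * x $ i < int r"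
    by (auto simp: box_iff)
  then show "real_of_int \<bar>x $ i\<bar> \<le> real r / 2"
    by linarith
qed

lemma card_box: "card (box_vertices r :: (int ^ 'd::finite) set) = r ^ CARD('d)"
proof (cases "r = 0")
  case True
  have "x \<notin> box_vertices 0" for x :: "int ^ 'd"
    unfolding box_iff by (auto intro!: exI[of _ undefined])
  then have "box_vertices r = ({} :: (int ^ 'd) set)"
    using True by blast
  then show ?thesis
    using True by simp
next
  case False
  have "bij_betw (red (\<lambda>_ :: 'd. r)) (box_vertices r) (cell (\<lambda>_. r))"
    using False by (intro red_box_cell) simp
  then show ?thesis
    using bij_betw_same_card card_cell_power by metis
qed

definition sup_nat :: "int ^ 'd::finite \<Rightarrow> nat" where
  "sup_nat x = nat (Max (range (\<lambda>i. \<bar>x $ i\<bar>)))"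

section \<open>Sums over shells of the sup norm\<close>

lemma real_sup_nat: "real (sup_nat x) = sup_norm x"
  using sup_norm_nonneg[of x] by (simp add: sup_nat_def sup_norm_def)

lemma sup_nat_ge: "\<bar>x $ i\<bar> \<le> int (sup_nat x)"
  using sup_norm_ge[of x i] unfolding real_sup_nat[symmetric] by linarith

lemma sup_nat_attained: "\<exists>i. int (sup_nat x) = \<bar>x $ i\<bar>"
  using sup_norm_attained[of x] unfolding real_sup_nat[symmetric] by (metis of_int_eq_iff of_int_of_nat_eq)

lemma sup_nat_0_iff: "sup_nat x = 0 \<longleftrightarrow> x = 0"
  using sup_norm_ge_1[of x] real_sup_nat[of x] by (force simp: sup_nat_def)

text \<open>One of the d coordinates is \<open>n\<close> or \<open>- n\<close> and the others lie in
  an interval of 2n + 1 integers; 2n + 1 is rounded up to 2(n + 1) to obtain a clean power.\<close>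

lemma card_shell_le:
  "finite {u :: int ^ 'd::finite. sup_nat u = n}"
  "real (card {u :: int ^ 'd. sup_nat u = n}) \<le> real (CARD('d) * 2 ^ CARD('d)) * real (n + 1) ^ (CARD('d) - 1)"
proof -
  define S :: "'d \<Rightarrow> 'd \<Rightarrow> int set" where
    "S i j = (if j = i then {int n, - int n} else {- int n..int n})" for i j
  define A where "A i = vec_lambda ` (PiE UNIV (S i))" for i
  have fin: "finite (A i)" for i
    unfolding A_def S_def by (intro finite_imageI finite_PiE) auto
  have sub: "{u :: int ^ 'd. sup_nat u = n} \<subseteq> (\<Union>i\<in>UNIV. A i)"
  proof
    fix u :: "int ^ 'd" assume u: "u \<in> {u. sup_nat u = n}"
    obtain i where i: "int n = \<bar>u $ i\<bar>"
      using sup_nat_attained[of u] u by auto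
    have "vec_nth u \<in> PiE UNIV (S i)"
      using sup_nat_ge[of u] u i by (auto simp: S_def abs_le_iff minus_le_iff split: if_splits)
    then have "u \<in> A i"
      unfolding A_def by (metis image_eqI vec_nth_inverse)
    then show "u \<in> (\<Union>i\<in>UNIV. A i)"
      by blast
  qed
  show "finite {u :: int ^ 'd. sup_nat u = n}"
    by (rule finite_subset[OF sub]) (simp add: fin)
  have cardA: "card (A i) \<le> 2 * (2 * n + 1) ^ (CARD('d) - 1)" for i
  proof -
    have "card (A i) \<le> card (PiE UNIV (S i))"
      unfolding A_def S_def by (intro card_image_le finite_PiE) auto
    also have "\<dots> = (\<Prod>j\<in>UNIV. card (S i j))"
      by (simp add: card_PiE)
    also have "\<dots> = card (S i i) * (\<Prod>j\<in>UNIV - {i}. card (S i j))"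
      by (rule prod.remove) auto
    also have "(\<Prod>j\<in>UNIV - {i}. card (S i j)) = (\<Prod>j\<in>UNIV - {i}. 2 * n + 1)"
      by (rule prod.cong) (auto simp: S_def)
    also have "\<dots> = (2 * n + 1) ^ (CARD('d) - 1)"
      by (simp add: card_Diff_singleton)
    also have "card (S i i) \<le> 2"
      by (simp add: S_def card_insert_if)
    finally show ?thesis by simp
  qed
  have "card {u :: int ^ 'd. sup_nat u = n} \<le> card (\<Union>i\<in>UNIV. A i)"
    using sub fin by (intro card_mono) auto
  also have "\<dots> \<le> (\<Sum>i\<in>UNIV. card (A i))"
    by (rule card_UN_le) simp
  also have "\<dots> \<le> (\<Sum>i\<in>(UNIV :: 'd set). 2 * (2 * n + 1) ^ (CARD('d) - 1))"
    by (intro sum_mono cardA)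
  also have "\<dots> \<le> CARD('d) * (2 * (2 * (n + 1)) ^ (CARD('d) - 1))"
    by (auto intro!: mult_left_mono power_mono)
  also have "\<dots> = CARD('d) * 2 ^ CARD('d) * (n + 1) ^ (CARD('d) - 1)"
    unfolding power_mult_distrib by (metis (no_types) mult.assoc power_eq_if zero_less_card_finite less_numeral_extra(3))
  finally show "real (card {u :: int ^ 'd. sup_nat u = n}) \<le> real (CARD('d) * 2 ^ CARD('d)) * real (n + 1) ^ (CARD('d) - 1)"
    by (metis of_nat_le_iff of_nat_mult of_nat_power)
qed

lemma shell_sum:
  fixes g :: "nat \<Rightarrow> real"
  assumes g: "\<And>n. 0 \<le> g n" and s: "summable (\<lambda>n. real (n + 1) ^ (CARD('d::finite) - 1) * g n)"
    and F: "finite (F :: (int ^ 'd) set)"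
  shows "(\<Sum>u\<in>F. g (sup_nat u)) \<le> real (CARD('d) * 2 ^ CARD('d)) * (\<Sum>n. real (n + 1) ^ (CARD('d) - 1) * g n)"
proof -
  let ?S = "real (CARD('d) * 2 ^ CARD('d))"
  have "(\<Sum>u\<in>F. g (sup_nat u)) = (\<Sum>n\<in>sup_nat ` F. \<Sum>u | u \<in> F \<and> sup_nat u = n. g (sup_nat u))"
    by (rule sum.image_gen[OF F])
  also have "\<dots> \<le> (\<Sum>n\<in>sup_nat ` F. ?S * (real (n + 1) ^ (CARD('d) - 1) * g n))"
  proof (rule sum_mono)
    fix n
    have "(\<Sum>u | u \<in> F \<and> sup_nat u = n. g (sup_nat u)) = real (card {u \<in> F. sup_nat u = n}) * g n"
      by simp
    also have "\<dots> \<le> real (card {u :: int ^ 'd. sup_nat u = n}) * g n"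
      using card_shell_le(1)[of n, where 'd = 'd] by (intro mult_right_mono g) (auto intro!: card_mono)
    also have "\<dots> \<le> (?S * real (n + 1) ^ (CARD('d) - 1)) * g n"
      by (intro mult_right_mono g card_shell_le(2))
    finally show "(\<Sum>u | u \<in> F \<and> sup_nat u = n. g (sup_nat u)) \<le> ?S * (real (n + 1) ^ (CARD('d) - 1) * g n)"
      by (simp add: mult.assoc)
  qed
  also have "\<dots> \<le> ?S * (\<Sum>n. real (n + 1) ^ (CARD('d) - 1) * g n)"
    unfolding sum_distrib_left[symmetric] using F g
    by (intro mult_left_mono sum_le_suminf[OF s]) auto
  finally show ?thesis .
qed

lemma shell_summable:
  fixes g :: "nat \<Rightarrow> real"
  assumes "\<And>n. 0 \<le> g n" "summable (\<lambda>n. real (n + 1) ^ (CARD('d::finite) - 1) * g n)"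
  shows "(\<lambda>u :: int ^ 'd. g (sup_nat u)) summable_on UNIV"
  using shell_sum[OF assms] assms(1)
  by (intro nonneg_bounded_partial_sums_imp_summable_on eventually_finite_subsets_at_top_weakI) auto

section \<open>Exponential and power sums\<close>

lemma power_le_fact_exp:
  assumes "0 \<le> (y::real)"
  shows "y ^ n \<le> fact n * exp y"
proof -
  have "(\<Sum>i\<in>{n}. y ^ i /\<^sub>R fact i) \<le> (\<Sum>i. y ^ i /\<^sub>R fact i)"
    using assms by (intro sum_le_suminf[OF summable_exp_generic]) auto
  then show ?thesis
    by (simp add: exp_def field_simps)
qed

text \<open>Half of the exponential decay absorbs the power, and a geometric series is left.\<close>

lemma summable_power_exp:
  assumes "0 < (a::real)"
  shows "summable (\<lambda>n. real (n + 1) ^ p * exp (- a * real n))"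
proof -
  define C where "C = fact p / (a / 2) ^ p * exp (a / 2)"
  have le: "real (n + 1) ^ p * exp (- a * real n) \<le> C * exp (- a / 2) ^ n" for n
  proof -
    have "(a / 2) ^ p * real (n + 1) ^ p \<le> fact p * exp (a / 2 * real (n + 1))"
      using power_le_fact_exp[of "a / 2 * real (n + 1)" p] assms by (simp only: power_mult_distrib) simp
    then have "real (n + 1) ^ p \<le> fact p / (a / 2) ^ p * exp (a / 2 * real (n + 1))"
      using assms by (simp add: field_simps)
    then have "real (n + 1) ^ p * exp (- a * real n)
        \<le> fact p / (a / 2) ^ p * exp (a / 2 * real (n + 1)) * exp (- a * real n)"
      by (rule mult_right_mono) simp
    also have "\<dots> = C * exp (- a / 2) ^ n"
    proof -
      have "a / 2 * real (n + 1) + - a * real n = a / 2 + real n * (- a / 2)"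
        by (simp add: field_simps)
      then show ?thesis
        unfolding C_def mult.assoc exp_add[symmetric] exp_of_nat_mult[symmetric] by (simp only:)
    qed
    finally show ?thesis .
  qed
  have "summable (\<lambda>n. C * exp (- a / 2) ^ n)"
    using assms by (intro summable_mult summable_geometric) simp
  then show ?thesis
    by (rule summable_comparison_test'[where N = 0]) (use le in auto)
qed

text \<open>The sum is x / (1 - x)^2 with x = exp (- a), and 1 - x is at least a / 2 times the
  square root of x. The order a^(-2) is what later becomes the inverse distance to
  criticality.\<close>

lemma sum_n_exp_le:
  assumes "0 < (a::real)"
  shows "summable (\<lambda>n. real n * exp (- a * real n))" "(\<Sum>n. real n * exp (- a * real n)) \<le> 4 / a\<^sup>2"
proof -
  define x where "x = exp (- a)"
  have x: "0 < x" "x < 1"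
    using assms by (auto simp: x_def)
  have pow: "exp (- a * real n) = x ^ n" for n
    unfolding x_def exp_of_nat_mult[symmetric] by (simp add: mult.commute)
  have "(\<lambda>n. real (Suc n) * x ^ n) sums (1 / (1 - x)\<^sup>2)"
    using geometric_deriv_sums[of x] x by simp
  then have "(\<lambda>n. x * (real (Suc n) * x ^ n)) sums (x * (1 / (1 - x)\<^sup>2))"
    by (rule sums_mult)
  then have "(\<lambda>n. real (Suc n) * x ^ Suc n) sums (x / (1 - x)\<^sup>2)"
    by (simp add: mult_ac)
  then have S: "(\<lambda>n. real n * x ^ n) sums (x / (1 - x)\<^sup>2)"
    using sums_Suc_iff[of "\<lambda>n. real n * x ^ n"] by simp
  then show "summable (\<lambda>n. real n * exp (- a * real n))"
    unfolding pow by (rule sums_summable)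
  have "exp (- a / 2) \<le> 1"
    using assms by simp
  then have "a / 2 \<le> exp (a / 2) - exp (- a / 2)"
    using exp_ge_add_one_self[of "a / 2"] by linarith
  then have "exp (- a / 2) * (a / 2) \<le> exp (- a / 2) * (exp (a / 2) - exp (- a / 2))"
    by (rule mult_left_mono) simp
  also have "\<dots> = 1 - x"
    unfolding right_diff_distrib exp_add[symmetric] by (simp add: x_def)
  finally have "(exp (- a / 2) * (a / 2))\<^sup>2 \<le> (1 - x)\<^sup>2"
    using assms by (intro power_mono) auto
  moreover have "(exp (- a / 2))\<^sup>2 = x"
    unfolding x_def exp_double[symmetric] by simp
  ultimately have "x * a\<^sup>2 \<le> 4 * (1 - x)\<^sup>2"
    by (simp add: power_mult_distrib power_divide)
  then have "x / (1 - x)\<^sup>2 \<le> 4 / a\<^sup>2"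
    using x assms by (simp add: field_simps)
  then show "(\<Sum>n. real n * exp (- a * real n)) \<le> 4 / a\<^sup>2"
    unfolding pow sums_unique[OF S, symmetric] .
qed

text \<open>A shell of radius n has of order n^(d - 1) points, so the denominator leaves a single
  factor n and \<open>sum_n_exp_le\<close> applies. The origin is excluded because the denominator
  vanishes there.\<close>

lemma sum_decay:
  fixes F :: "(int ^ 'd::finite) set"
  assumes "1 < CARD('d)" "0 < a" "finite F" "0 \<notin> F"
  shows "(\<Sum>u\<in>F. exp (- a * sup_norm u) / sup_norm u ^ (CARD('d) - 2))
    \<le> real (CARD('d) * 2 ^ CARD('d)) * 2 ^ (CARD('d) + 1) / a\<^sup>2"
proof -
  define g where "g n = (if n = 0 then 0 else exp (- a * real n) / real n ^ (CARD('d) - 2))" for n :: nat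
  let ?D = "(2::real) ^ (CARD('d) - 1)"
  have le: "real (n + 1) ^ (CARD('d) - 1) * g n \<le> ?D * (real n * exp (- a * real n))" for n
  proof (cases "n = 0")
    case False
    have d: "CARD('d) - 1 = Suc (CARD('d) - 2)"
      using assms(1) by simp
    have "real (n + 1) ^ (CARD('d) - 1) \<le> (2 * real n) ^ (CARD('d) - 1)"
      using False by (intro power_mono) auto
    also have "\<dots> = ?D * real n * real n ^ (CARD('d) - 2)"
      unfolding d by (simp add: power_mult_distrib)
    finally show ?thesis
      using False mult_right_mono[of "real (n + 1) ^ (CARD('d) - 1)" "?D * real n * real n ^ (CARD('d) - 2)" "exp (- a * real n) / real n ^ (CARD('d) - 2)"]
      by (simp add: g_def)
  qed (simp add: g_def)
  have g0: "0 \<le> g n" for n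
    by (simp add: g_def)
  have s: "summable (\<lambda>n. real (n + 1) ^ (CARD('d) - 1) * g n)"
    by (rule summable_comparison_test'[where N = 0, OF summable_mult[OF sum_n_exp_le(1)[OF assms(2)], of ?D]])
      (use le g0 in \<open>auto simp: abs_mult\<close>)
  have "(\<Sum>u\<in>F. exp (- a * sup_norm u) / sup_norm u ^ (CARD('d) - 2)) = (\<Sum>u\<in>F. g (sup_nat u))"
    using assms(4) by (intro sum.cong refl) (auto simp: g_def real_sup_nat sup_nat_0_iff)
  also have "\<dots> \<le> real (CARD('d) * 2 ^ CARD('d)) * (\<Sum>n. real (n + 1) ^ (CARD('d) - 1) * g n)"
    by (rule shell_sum[OF g0 s assms(3)])
  also have "\<dots> \<le> real (CARD('d) * 2 ^ CARD('d)) * (\<Sum>n. ?D * (real n * exp (- a * real n)))"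
    by (intro mult_left_mono suminf_le[OF le s summable_mult[OF sum_n_exp_le(1)[OF assms(2)]]]) auto
  also have "\<dots> \<le> real (CARD('d) * 2 ^ CARD('d)) * (?D * (4 / a\<^sup>2))"
    unfolding suminf_mult[OF sum_n_exp_le(1)[OF assms(2)]]
    by (intro mult_left_mono sum_n_exp_le(2)[OF assms(2)]) auto
  also have "?D * 4 = 2 ^ (CARD('d) + 1)"
    using assms(1) power_add[of "2::real" "CARD('d) - 1" 2] by simp
  then have "real (CARD('d) * 2 ^ CARD('d)) * (?D * (4 / a\<^sup>2)) = real (CARD('d) * 2 ^ CARD('d)) * 2 ^ (CARD('d) + 1) / a\<^sup>2"
    by simp
  finally show ?thesis .
qed

text \<open>The shells contribute of order n^(d - 1) n^(4 - 2d) = n^(3 - d), which is bounded by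
  n^(-2) because d > 4.\<close>

lemma square_summable:
  assumes "4 < CARD('d::finite)"
  shows "(\<lambda>u :: int ^ 'd. (1 / max 1 (sup_norm u) ^ (CARD('d) - 2))\<^sup>2) summable_on UNIV"
proof -
  define g where "g n = (1 / max 1 (real n) ^ (CARD('d) - 2))\<^sup>2" for n :: nat
  have le: "real (n + 1) ^ (CARD('d) - 1) * g n \<le> 2 ^ (CARD('d) - 1) * (4 * inverse (real (n + 1) ^ 2))" for n
  proof -
    let ?m = "max 1 (real n)"
    have m: "1 \<le> ?m" "real (n + 1) \<le> 2 * ?m"
      by auto
    have d: "2 * (CARD('d) - 2) = (CARD('d) - 1) + (CARD('d) - 3)" "CARD('d) - 3 = 2 + (CARD('d) - 5)"
      using assms by auto
    have "real (n + 1) ^ (CARD('d) - 1) * g n \<le> (2 * ?m) ^ (CARD('d) - 1) * g n"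
      using m by (intro mult_right_mono power_mono) (auto simp: g_def)
    also have "\<dots> = 2 ^ (CARD('d) - 1) / ?m ^ (CARD('d) - 3)"
      unfolding g_def power_divide power_mult[symmetric] mult.commute[of _ 2] d(1) power_add power_mult_distrib
      using m(1) by simp
    also have "\<dots> \<le> 2 ^ (CARD('d) - 1) / ?m ^ 2"
      using m(1) unfolding d(2) by (intro divide_left_mono power_increasing) auto
    also have "\<dots> \<le> 2 ^ (CARD('d) - 1) * (4 * inverse (real (n + 1) ^ 2))"
    proof -
      have "real (n + 1) ^ 2 \<le> (2 * ?m) ^ 2"
        using m by (intro power_mono) auto
      then have "1 / ?m ^ 2 \<le> 4 * inverse (real (n + 1) ^ 2)"
        using m(1) by (simp add: field_simps power_mult_distrib)
      then show ?thesis
        using mult_left_mono[of "1 / ?m ^ 2" "4 * inverse (real (n + 1) ^ 2)" "2 ^ (CARD('d) - 1)"] by simp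
    qed
    finally show ?thesis .
  qed
  have "summable (\<lambda>n. inverse (real (Suc n) ^ 2))"
    unfolding summable_Suc_iff[of "\<lambda>n. inverse (real n ^ 2)"] by (rule inverse_power_summable) simp
  then have "summable (\<lambda>n. 2 ^ (CARD('d) - 1) * (4 * inverse (real (n + 1) ^ 2)))"
    by (intro summable_mult) simp
  then have "summable (\<lambda>n. real (n + 1) ^ (CARD('d) - 1) * g n)"
    by (rule summable_comparison_test'[where N = 0]) (use le in \<open>auto simp: abs_mult g_def\<close>)
  then have "(\<lambda>u :: int ^ 'd. g (sup_nat u)) summable_on UNIV"
    by (intro shell_summable) (auto simp: g_def)
  then show ?thesis
    by (simp add: g_def real_sup_nat)
qed

text \<open>A coordinate of a congruent point is either the same or differs by at least r in
  absolute value, while the coordinate in the box is at most r / 2 in absolute value.\<close>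

lemma sup_norm_box_minimal:
  assumes "x \<in> box_vertices r" "v - x \<in> latt (\<lambda>_. r)"
  shows "sup_norm x \<le> sup_norm v"
proof (rule sup_norm_le)
  fix i
  have x: "- int r \<le> 2 * x $ i" "2 * x $ i < int r"
    using assms(1) by (auto simp: box_iff)
  obtain k where k: "v $ i - x $ i = int r * k"
    using assms(2) by (auto simp: latt_def)
  have "\<bar>x $ i\<bar> \<le> \<bar>v $ i\<bar>"
  proof (cases "k = 0")
    case False
    then have "int r * 1 \<le> int r * \<bar>k\<bar>"
      by (intro mult_left_mono) auto
    then have "int r \<le> \<bar>v $ i - x $ i\<bar>"
      by (simp add: k abs_mult)
    then show ?thesis
      using x by linarith
  qed (use k in simp)
  then show "real_of_int \<bar>x $ i\<bar> \<le> sup_norm v"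
    using sup_norm_ge[of v i] by linarith
qed

definition box_rep :: "nat \<Rightarrow> int ^ 'd::finite \<Rightarrow> int ^ 'd" where
  "box_rep r z = inv_into (box_vertices r) (red (\<lambda>_. r)) (red (\<lambda>_. r) z)"

lemma box_rep_box_latt:
  fixes z :: "int ^ 'd::finite"
  assumes "0 < r"
  shows "box_rep r z \<in> box_vertices r" "z - box_rep r z \<in> latt (\<lambda>_. r)"
proof -
  have "red (\<lambda>_. r) ` box_vertices r = cell (\<lambda>_ :: 'd. r)"
    using red_box_cell[OF assms] by (rule bij_betw_imp_surj_on)
  then have "red (\<lambda>_. r) z \<in> red (\<lambda>_. r) ` box_vertices r"
    using red_cell[of "\<lambda>_. r" z] assms by simp
  then show "box_rep r z \<in> box_vertices r" "z - box_rep r z \<in> latt (\<lambda>_. r)"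
    unfolding box_rep_def red_eq_iff[symmetric] by (auto simp: inv_into_into f_inv_into_f)
qed

text \<open>In every product at least one factor lies in the tail. Young's inequality with weight
  \<open>\<eta>\<close> bounds the product by the square of the tail factor over
  \<open>\<eta>\<close> plus \<open>\<eta>\<close> times the other square. The injection
  \<open>\<sigma>\<close> stands for y |-> x - y modulo the periods, so the bound is uniform in the
  point and in the period.\<close>

lemma convolution_tail:
  assumes "4 < CARD('d::finite)" "0 < \<delta>"
  defines "h \<equiv> \<lambda>u :: int ^ 'd. 1 / max 1 (sup_norm u) ^ (CARD('d) - 2)"
  shows "\<exists>m::nat. \<forall>Y \<sigma>. finite Y \<longrightarrow> inj_on \<sigma> Y \<longrightarrow> (\<forall>y\<in>Y. real m \<le> sup_norm y \<or> real m \<le> sup_norm (\<sigma> y)) \<longrightarrow>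
    (\<Sum>y\<in>Y. h y * h (\<sigma> y)) \<le> \<delta>"
proof -
  have h2: "(\<lambda>u. (h u)\<^sup>2) summable_on UNIV"
    unfolding h_def by (rule square_summable[OF assms(1)])
  define H where "H = infsum (\<lambda>u. (h u)\<^sup>2) UNIV"
  have H: "(\<Sum>u\<in>G. (h u)\<^sup>2) \<le> H" if "finite G" for G
    unfolding H_def by (intro finite_sum_le_infsum h2 that) auto
  have H0: "0 \<le> H"
    using H[of "{}"] by simp
  \<comment> \<open>Makes the untruncated squares cost at most half of \<open>\<delta>\<close>; the
    tail bound \<open>\<delta> * \<eta> / 4\<close> keeps the two tails within the other
    half.\<close>
  define \<eta> where "\<eta> = \<delta> / (4 * (H + 1))"
  have \<eta>: "0 < \<eta>"
    using assms(2) H0 by (simp add: \<eta>_def)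
  have "0 < \<delta> * \<eta> / 4"
    using \<eta> assms(2) by simp
  from small_tail[OF this h2] obtain m where m: "\<And>G. finite G \<Longrightarrow> \<forall>u\<in>G. real m \<le> sup_norm u \<Longrightarrow> (\<Sum>u\<in>G. (h u)\<^sup>2) < \<delta> * \<eta> / 4"
    by auto
  show ?thesis
  proof (intro exI[of _ m] allI impI)
    fix Y :: "(int ^ 'd) set" and \<sigma> :: "int ^ 'd \<Rightarrow> int ^ 'd"
    assume Y: "finite Y" and inj: "inj_on \<sigma> Y" and far: "\<forall>y\<in>Y. real m \<le> sup_norm y \<or> real m \<le> sup_norm (\<sigma> y)"
    define t where "t u = (if real m \<le> sup_norm u then (h u)\<^sup>2 else 0)" for u
    have young: "a * b \<le> a\<^sup>2 / \<eta> + \<eta> * b\<^sup>2" for a b :: real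
    proof -
      have "a * c \<le> a\<^sup>2 + c\<^sup>2" for c
        using zero_le_power2[of "a - c"] zero_le_power2[of a] zero_le_power2[of c]
        unfolding power2_diff by linarith
      from this[of "\<eta> * b"] have "\<eta> * (a * b) \<le> a\<^sup>2 + (\<eta> * b)\<^sup>2"
        by (simp add: mult.left_commute)
      also have "\<dots> = \<eta> * (a\<^sup>2 / \<eta> + \<eta> * b\<^sup>2)"
        using \<eta> by (simp add: field_simps power2_eq_square)
      finally show ?thesis
        using \<eta> by simp
    qed
    have t0: "0 \<le> t u" for u
      by (simp add: t_def)
    have le: "h y * h (\<sigma> y) \<le> (t y + t (\<sigma> y)) / \<eta> + \<eta> * ((h y)\<^sup>2 + (h (\<sigma> y))\<^sup>2)" if "y \<in> Y" for y
    proof (cases "real m \<le> sup_norm y")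
      case True
      have "h y * h (\<sigma> y) \<le> t y / \<eta> + \<eta> * (h (\<sigma> y))\<^sup>2"
        using True young[of "h y" "h (\<sigma> y)"] by (simp add: t_def)
      moreover have "0 \<le> t (\<sigma> y) / \<eta> + \<eta> * (h y)\<^sup>2"
        using t0 \<eta> by simp
      ultimately show ?thesis
        by (simp add: add_divide_distrib distrib_left)
    next
      case False
      then have "h y * h (\<sigma> y) \<le> t (\<sigma> y) / \<eta> + \<eta> * (h y)\<^sup>2"
        using far that young[of "h (\<sigma> y)" "h y"] by (auto simp: t_def mult.commute)
      moreover have "0 \<le> t y / \<eta> + \<eta> * (h (\<sigma> y))\<^sup>2"
        using t0 \<eta> by simp
      ultimately show ?thesis
        by (simp add: add_divide_distrib distrib_left)
    qed
    have tail: "(\<Sum>u\<in>G. t u) \<le> \<delta> * \<eta> / 4" if "finite G" for G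
    proof -
      have "(\<Sum>u\<in>G. t u) = (\<Sum>u | u \<in> G \<and> real m \<le> sup_norm u. (h u)\<^sup>2)"
        unfolding t_def using that by (simp add: sum.inter_filter)
      also have "\<dots> < \<delta> * \<eta> / 4"
        using that by (intro m) auto
      finally show ?thesis by simp
    qed
    have re: "(\<Sum>y\<in>Y. g (\<sigma> y)) = (\<Sum>u\<in>\<sigma> ` Y. g u)" for g :: "int ^ 'd \<Rightarrow> real"
      using inj by (simp add: sum.reindex)
    have "(\<Sum>y\<in>Y. h y * h (\<sigma> y)) \<le> (\<Sum>y\<in>Y. (t y + t (\<sigma> y)) / \<eta> + \<eta> * ((h y)\<^sup>2 + (h (\<sigma> y))\<^sup>2))"
      by (intro sum_mono le)
    also have "\<dots> = ((\<Sum>y\<in>Y. t y) + (\<Sum>y\<in>Y. t (\<sigma> y))) / \<eta> + \<eta> * ((\<Sum>y\<in>Y. (h y)\<^sup>2) + (\<Sum>y\<in>Y. (h (\<sigma> y))\<^sup>2))"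
      by (simp only: sum.distrib sum_divide_distrib[symmetric] sum_distrib_left[symmetric])
    also have "\<dots> \<le> (\<delta> * \<eta> / 4 + \<delta> * \<eta> / 4) / \<eta> + \<eta> * (H + H)"
      unfolding re[of t] re[of "\<lambda>u. (h u)\<^sup>2"] using Y \<eta> by (intro add_mono divide_right_mono mult_left_mono tail H) auto
    also have "\<dots> = \<delta> / 2 + 2 * \<eta> * H"
      using \<eta> by simp
    also have "2 * \<eta> * H \<le> \<delta> / 2"
      using H0 assms(2) by (simp add: \<eta>_def field_simps)
    finally show "(\<Sum>y\<in>Y. h y * h (\<sigma> y)) \<le> \<delta>"
      by simp
  qed
qed

section \<open>Near-critical estimates\<close>

lemma chi_eq:
  assumes "(\<lambda>x :: int ^ 'd::finite. tau \<beta> 0 x) summable_on UNIV"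
  shows "chi TYPE('d) \<beta> = ereal (infsum (\<lambda>x :: int ^ 'd. tau \<beta> 0 x) UNIV)"
proof -
  have "((\<lambda>F :: (int ^ 'd) set. \<Sum>x\<in>F. tau \<beta> 0 x) \<longlongrightarrow> infsum (\<lambda>x :: int ^ 'd. tau \<beta> 0 x) UNIV) (finite_subsets_at_top UNIV)"
    using has_sum_infsum[OF assms] unfolding has_sum_def .
  then have "((\<lambda>F :: (int ^ 'd) set. ereal (\<Sum>x\<in>F. tau \<beta> 0 x)) \<longlongrightarrow> ereal (infsum (\<lambda>x :: int ^ 'd. tau \<beta> 0 x) UNIV)) (finite_subsets_at_top UNIV)"
    by (rule tendsto_ereal)
  moreover have "sum (\<lambda>x :: int ^ 'd. ereal (tau \<beta> 0 x)) = (\<lambda>F. ereal (\<Sum>x\<in>F. tau \<beta> 0 x))"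
    by (rule ext) simp
  ultimately have "((\<lambda>x :: int ^ 'd. ereal (tau \<beta> 0 x)) has_sum ereal (infsum (\<lambda>x :: int ^ 'd. tau \<beta> 0 x) UNIV)) UNIV"
    unfolding has_sum_def by (simp only:)
  then show ?thesis
    unfolding chi_def by (rule infsumI)
qed

locale near_critical =
  fixes \<beta>c c0 C0 :: real and d :: "'d::finite itself"
  assumes dim: "4 < CARD('d)" and c0: "0 < c0" and C0: "0 < C0"
    and upper: "\<And>\<beta> (x :: int ^ 'd). 0 < \<beta> \<Longrightarrow> \<beta> \<le> \<beta>c \<Longrightarrow>
      tau \<beta> 0 x \<le> C0 / max 1 (sup_norm x) ^ (CARD('d) - 2)
                     * exp (- c0 * (\<beta>c - \<beta>) powr (1/2) * sup_norm x)"
    and lower: "\<And>\<beta> (x :: int ^ 'd). 0 < \<beta> \<Longrightarrow> \<beta> \<le> \<beta>c \<Longrightarrow>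
      sup_norm x \<le> c0 * (\<beta>c - \<beta>) powr (-1/2) \<Longrightarrow>
      tau \<beta> 0 x \<ge> c0 / max 1 (sup_norm x) ^ (CARD('d) - 2)"
begin

definition K :: real where
  "K = real (CARD('d) * 2 ^ CARD('d)) * 2 ^ (CARD('d) + 1)"

text \<open>Bounds the periodisation without its main term. With \<epsilon> the distance to
  \<open>\<beta>c\<close>, \<open>sum_decay\<close> for the rate c0 sqrt \<epsilon> r / 2 gives 4 K
  / (c0^2 \<epsilon> r^2), and the denominators give C0 (2 / r)^(d - 2).\<close>

definition Cb :: real where
  "Cb = C0 * 2 ^ CARD('d) * K / c0\<^sup>2"

text \<open>Below, \<open>CX\<close> and \<open>cX\<close> divided by \<epsilon> enclose the
  susceptibility. The summand \<open>\<beta>c\<close> pays for the origin, since 1 is at most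
  \<open>\<beta>c\<close> over \<epsilon>.\<close>

definition CX :: real where
  "CX = \<beta>c + C0 * K / c0\<^sup>2"

definition cX :: real where
  "cX = min (c0 ^ 3 / 4) (c0\<^sup>2)"

text \<open>The lower counterpart of \<open>Cb\<close>: 4 / 25 is the square of the 2 / 5 lost in
  \<open>periodise_lower\<close> by rounding the range of the shifts, and
  \<open>2 ^ (CARD('d) - 2)\<close> comes from bounding the norm of a shifted point by
  \<open>2 * (r * N)\<close>.\<close>

definition ca :: real where
  "ca = 4 * c0 ^ 3 / (25 * 2 ^ (CARD('d) - 2))"

lemma power_split: "x ^ CARD('d) = x ^ (CARD('d) - 2) * (x :: real)\<^sup>2"
proof -
  have "CARD('d) = (CARD('d) - 2) + 2"
    using dim by simp
  then show ?thesis
    using power_add[of x "CARD('d) - 2" 2] by (simp only:)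
qed

lemma constants_pos: "0 < K" "0 < Cb" "0 < cX" "0 < ca"
  using c0 C0 by (auto simp: K_def Cb_def cX_def ca_def)

end

locale subcritical = near_critical \<beta>c c0 C0 d for \<beta>c c0 C0 :: real and d :: "'d::finite itself" +
  fixes \<beta> :: real
  assumes \<beta>: "0 < \<beta>" "\<beta> < \<beta>c"
begin

definition \<epsilon> :: real where "\<epsilon> = \<beta>c - \<beta>"

lemma \<epsilon>: "0 < \<epsilon>"
  using \<beta> by (simp add: \<epsilon>_def)

abbreviation f :: "int ^ 'd \<Rightarrow> real" where
  "f \<equiv> tau \<beta> 0"

lemma f_nonneg: "0 \<le> f x"
  using \<beta> by (intro tau_nonneg) simp

lemma f_upper: "f x \<le> C0 / max 1 (sup_norm x) ^ (CARD('d) - 2) * exp (- (c0 * sqrt \<epsilon>) * sup_norm x)"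
  using upper[of \<beta> x] \<beta> \<epsilon> by (simp add: \<epsilon>_def powr_half_sqrt)

lemma f_lower: "sup_norm x \<le> c0 / sqrt \<epsilon> \<Longrightarrow> c0 / max 1 (sup_norm x) ^ (CARD('d) - 2) \<le> f x"
  using lower[of \<beta> x] \<beta> \<epsilon> by (simp add: \<epsilon>_def powr_minus_divide powr_half_sqrt)

lemma f_le_h: "f x \<le> C0 * (1 / max 1 (sup_norm x) ^ (CARD('d) - 2))"
proof -
  have "exp (- (c0 * sqrt \<epsilon>) * sup_norm x) \<le> 1"
    using c0 \<epsilon> sup_norm_nonneg[of x] by simp
  then have "C0 / max 1 (sup_norm x) ^ (CARD('d) - 2) * exp (- (c0 * sqrt \<epsilon>) * sup_norm x)
      \<le> C0 / max 1 (sup_norm x) ^ (CARD('d) - 2) * 1"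
    using C0 by (intro mult_left_mono) auto
  then show ?thesis
    using f_upper[of x] by simp
qed

text \<open>Strictly below \<open>\<beta>c\<close> the exponential decay dominates the moment weight
  and the growth of the shells.\<close>

lemma moment_summable: "(\<lambda>x. (2 * sup_norm x + 2) ^ CARD('d) * f x) summable_on UNIV"
proof -
  define a where "a = c0 * sqrt \<epsilon>"
  have a: "0 < a"
    using c0 \<epsilon> by (simp add: a_def)
  define g where "g n = (2 * real n + 2) ^ CARD('d) * (C0 * exp (- a * real n))" for n :: nat
  have "summable (\<lambda>n. 2 ^ CARD('d) * C0 * (real (n + 1) ^ (CARD('d) - 1 + CARD('d)) * exp (- a * real n)))"
    by (intro summable_mult summable_power_exp a)
  moreover have "real (n + 1) ^ (CARD('d) - 1) * g n
      = 2 ^ CARD('d) * C0 * (real (n + 1) ^ (CARD('d) - 1 + CARD('d)) * exp (- a * real n))" for n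
  proof -
    have "2 * real n + 2 = 2 * real (n + 1)"
      by simp
    then show ?thesis
      unfolding g_def power_add by (simp only: power_mult_distrib) (simp add: mult_ac)
  qed
  ultimately have "summable (\<lambda>n. real (n + 1) ^ (CARD('d) - 1) * g n)"
    by simp
  then have "(\<lambda>u :: int ^ 'd. g (sup_nat u)) summable_on UNIV"
    using C0 by (intro shell_summable) (auto simp: g_def)
  then show ?thesis
  proof (rule summable_on_comparison_test)
    fix x :: "int ^ 'd"
    have "C0 / max 1 (sup_norm x) ^ (CARD('d) - 2) \<le> C0 / 1"
      using C0 by (intro divide_left_mono) (auto simp: one_le_power)
    then have "f x \<le> C0 * exp (- a * sup_norm x)"
      using f_upper[of x] mult_right_mono[of "C0 / max 1 (sup_norm x) ^ (CARD('d) - 2)" C0 "exp (- a * sup_norm x)"]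
      by (simp add: a_def)
    then show "(2 * sup_norm x + 2) ^ CARD('d) * f x \<le> g (sup_nat x)"
      using sup_norm_nonneg[of x] unfolding g_def real_sup_nat by (intro mult_left_mono) auto
    show "0 \<le> (2 * sup_norm x + 2) ^ CARD('d) * f x"
      using sup_norm_nonneg[of x] f_nonneg[of x] by simp
  qed
qed

lemma f_summable: "f summable_on UNIV"
proof (rule summable_on_comparison_test[OF moment_summable])
  fix x :: "int ^ 'd"
  have "1 \<le> (2 * sup_norm x + 2) ^ CARD('d)"
    using sup_norm_nonneg[of x] by (intro one_le_power) simp
  then show "f x \<le> (2 * sup_norm x + 2) ^ CARD('d) * f x"
    using f_nonneg[of x] mult_right_mono[of 1 _ "f x"] by simp
qed (rule f_nonneg)

lemma f_0: "f 0 = 1"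
  using \<beta> by (intro tau_0) simp

section \<open>The order of the susceptibility\<close>

definition X :: real where "X = infsum f UNIV"

lemma chi_X: "chi TYPE('d) \<beta> = ereal X"
  unfolding X_def by (rule chi_eq[OF f_summable])

lemma sum_le_X: "finite F \<Longrightarrow> sum f F \<le> X"
  unfolding X_def using f_nonneg by (intro finite_sum_le_infsum f_summable) auto

lemma X_ge_1: "1 \<le> X"
  using sum_le_X[of "{0}"] by (simp add: f_0)

lemma X_upper: "X \<le> CX / \<epsilon>"
  unfolding X_def
proof (rule infsum_le_finite_sums[OF f_summable])
  fix F :: "(int ^ 'd) set" assume F: "finite F"
  define a where "a = c0 * sqrt \<epsilon>"
  have a: "0 < a" "a\<^sup>2 = c0\<^sup>2 * \<epsilon>"
    using c0 \<epsilon> by (auto simp: a_def power_mult_distrib)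
  have "sum f F \<le> sum f ({0} \<union> (F - {0}))"
    using F f_nonneg by (intro sum_mono2) auto
  also have "\<dots> = 1 + sum f (F - {0})"
    using F by (subst sum.union_disjoint) (auto simp: f_0)
  also have "sum f (F - {0}) \<le> (\<Sum>u\<in>F - {0}. C0 * (exp (- a * sup_norm u) / sup_norm u ^ (CARD('d) - 2)))"
  proof (rule sum_mono)
    fix u assume "u \<in> F - {0}"
    then show "f u \<le> C0 * (exp (- a * sup_norm u) / sup_norm u ^ (CARD('d) - 2))"
      using f_upper[of u] sup_norm_ge_1[of u] by (simp add: a_def max_absorb2)
  qed
  also have "\<dots> \<le> C0 * (K / a\<^sup>2)"
    unfolding sum_distrib_left[symmetric] K_def using dim a(1) F C0
    by (intro mult_left_mono sum_decay) auto
  also have "1 \<le> \<beta>c / \<epsilon>"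
    using \<beta> by (simp add: \<epsilon>_def)
  also have "\<beta>c / \<epsilon> + C0 * (K / a\<^sup>2) = CX / \<epsilon>"
    by (simp add: CX_def a(2) add_divide_distrib)
  finally show "sum f F \<le> CX / \<epsilon>" by simp
qed

text \<open>Within a radius N comparable to c0 / sqrt \<epsilon> every term is at least c0 / N^(d -
  2), and there are at least N^d points, which gives c0 N^2. If c0 / sqrt \<epsilon> is below 1, the
  term at the origin alone suffices; this is the second entry of the minimum in
  \<open>cX\<close>.\<close>

lemma X_lower: "cX / \<epsilon> \<le> X"
proof -
  define N where "N = nat \<lfloor>c0 / sqrt \<epsilon>\<rfloor>"
  have pos: "0 < c0 / sqrt \<epsilon>" "(c0 / sqrt \<epsilon>)\<^sup>2 = c0\<^sup>2 / \<epsilon>"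
    using c0 \<epsilon> by (auto simp: power_divide)
  show ?thesis
  proof (cases "1 \<le> c0 / sqrt \<epsilon>")
    case True
    have "1 \<le> \<lfloor>c0 / sqrt \<epsilon>\<rfloor>"
      using True by simp
    then have N1: "1 \<le> real N" and "real N = of_int \<lfloor>c0 / sqrt \<epsilon>\<rfloor>"
      unfolding N_def by simp_all
    then have N2: "real N \<le> c0 / sqrt \<epsilon>" "c0 / sqrt \<epsilon> < real N + 1"
      by (simp_all only: of_int_floor_le floor_less_iff[symmetric]) linarith+
    have N: "1 \<le> real N" "real N \<le> c0 / sqrt \<epsilon>" "c0 / sqrt \<epsilon> \<le> 2 * real N"
      using N1 N2 by linarith+
    have "c0 ^ 3 / 4 / \<epsilon> = c0 * (c0 / sqrt \<epsilon>)\<^sup>2 / 4"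
      unfolding pos(2) by (simp add: power3_eq_cube power2_eq_square)
    also have "\<dots> \<le> c0 * (2 * real N)\<^sup>2 / 4"
      using N c0 pos(1) by (intro divide_right_mono mult_left_mono power_mono) auto
    also have "\<dots> = c0 * real N ^ 2"
      by (simp add: power_mult_distrib)
    also have "\<dots> = real N ^ CARD('d) * (c0 / real N ^ (CARD('d) - 2))"
      using N unfolding power_split[of "real N"] by simp
    also have "\<dots> \<le> real (card (box_vertices (2 * N) :: (int ^ 'd) set)) * (c0 / real N ^ (CARD('d) - 2))"
      using c0 unfolding card_box of_nat_power by (intro mult_right_mono power_mono) auto
    also have "\<dots> = (\<Sum>u\<in>(box_vertices (2 * N) :: (int ^ 'd) set). c0 / real N ^ (CARD('d) - 2))"
      by simp
    also have "\<dots> \<le> (\<Sum>u\<in>(box_vertices (2 * N) :: (int ^ 'd) set). f u)"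
    proof (rule sum_mono)
      fix u :: "int ^ 'd" assume "u \<in> box_vertices (2 * N)"
      then have u: "sup_norm u \<le> real N"
        using sup_norm_box by fastforce
      have "c0 / real N ^ (CARD('d) - 2) \<le> c0 / max 1 (sup_norm u) ^ (CARD('d) - 2)"
        using u N c0 by (intro divide_left_mono power_mono) auto
      also have "\<dots> \<le> f u"
        using u N by (intro f_lower) simp
      finally show "c0 / real N ^ (CARD('d) - 2) \<le> f u" .
    qed
    also have "\<dots> \<le> X"
      by (rule sum_le_X[OF finite_box])
    finally have "c0 ^ 3 / 4 / \<epsilon> \<le> X" .
    moreover have "cX / \<epsilon> \<le> c0 ^ 3 / 4 / \<epsilon>"
      using \<epsilon> by (intro divide_right_mono) (auto simp: cX_def)
    ultimately show ?thesis by linarith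
  next
    case False
    then have "(c0 / sqrt \<epsilon>)\<^sup>2 \<le> 1"
      using pos(1) by (simp add: power_le_one)
    moreover have "cX / \<epsilon> \<le> c0\<^sup>2 / \<epsilon>"
      using \<epsilon> by (intro divide_right_mono) (auto simp: cX_def)
    ultimately show ?thesis
      using X_ge_1 unfolding pos(2) by linarith
  qed
qed

section \<open>The periodisation and the torus near criticality\<close>

lemma torus_sequence:
  assumes "3 \<le> r"
  shows "torus_sequence (\<lambda>_ :: 'd. r) \<beta>"
  using assms \<beta> f_summable moment_summable by unfold_locales auto

lemma latt_const: "v \<in> latt (\<lambda>_. r) \<Longrightarrow> \<exists>u. v = latt_scale (\<lambda>_. r) u"
  using latt_scale_div by blast

text \<open>A point of the box shifted by the period \<open>r\<close> times a nonzero
  \<open>u\<close> has norm at least r / 2 times that of \<open>u\<close>, so the terms other than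
  \<open>f z\<close> are bounded by a lattice sum in \<open>u\<close> with decay rate c0 sqrt
  \<epsilon> r / 2.\<close>

lemma periodise_upper:
  assumes r: "3 \<le> r" and z: "z \<in> box_vertices r"
  shows "periodise (\<lambda>_. r) f z \<le> f z + Cb / \<epsilon> / real r ^ CARD('d)"
  unfolding periodise_def
proof (rule infsum_le_finite_sums)
  let ?L = "\<lambda>_ :: 'd. r"
  show "(\<lambda>v. f (z + v)) summable_on latt ?L"
    by (rule summable_shift[OF f_summable])
  fix F assume F: "finite F" "F \<subseteq> latt ?L"
  define U where "U = {u. u \<noteq> 0 \<and> latt_scale ?L u \<in> F}"
  define a where "a = c0 * sqrt \<epsilon> * real r / 2"
  have a: "0 < a" "a\<^sup>2 = c0\<^sup>2 * \<epsilon> * (real r)\<^sup>2 / 4"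
    using c0 \<epsilon> r by (auto simp: a_def power_mult_distrib power_divide)
  have inj: "inj (latt_scale ?L)"
    using r by (auto simp: inj_def latt_scale_def vec_eq_iff)
  have finU: "finite U"
    using finite_vimageI[OF F(1) inj] by (rule finite_subset[rotated]) (auto simp: U_def)
  have sub: "F \<subseteq> {0} \<union> latt_scale ?L ` U"
  proof
    fix v assume v: "v \<in> F"
    then obtain u where u: "v = latt_scale ?L u"
      using F(2) latt_const by blast
    show "v \<in> {0} \<union> latt_scale ?L ` U"
      using v u by (cases "u = 0") (auto simp: U_def latt_scale_0)
  qed
  have f_le: "f (z + latt_scale ?L u) \<le> C0 * (2 / real r) ^ (CARD('d) - 2) * (exp (- a * sup_norm u) / sup_norm u ^ (CARD('d) - 2))"
    if u: "u \<in> U" for u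
  proof -
    let ?w = "z + latt_scale ?L u"
    have u1: "1 \<le> sup_norm u"
      using u by (intro sup_norm_ge_1) (auto simp: U_def)
    have "real r * sup_norm u \<le> sup_norm ?w + sup_norm (- z)"
      using sup_norm_triangle[of ?w "- z"] by (simp add: sup_norm_scale)
    moreover have "sup_norm (- z) \<le> real r / 2"
      using sup_norm_box[OF z] by (simp add: sup_norm_uminus)
    moreover have "real r / 2 * 1 \<le> real r / 2 * sup_norm u"
      using u1 by (intro mult_left_mono) auto
    ultimately have w: "real r / 2 * sup_norm u \<le> sup_norm ?w"
      by (simp add: field_simps)
    have rw: "0 < real r / 2 * sup_norm u"
      using r u1 by simp
    have "C0 / max 1 (sup_norm ?w) ^ (CARD('d) - 2) \<le> C0 / (real r / 2 * sup_norm u) ^ (CARD('d) - 2)"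
      using w rw C0 by (intro divide_left_mono power_mono) auto
    moreover have "exp (- (c0 * sqrt \<epsilon>) * sup_norm ?w) \<le> exp (- a * sup_norm u)"
      using mult_left_mono[OF w, of "c0 * sqrt \<epsilon>"] c0 \<epsilon> by (simp add: a_def mult_ac)
    ultimately have "C0 / max 1 (sup_norm ?w) ^ (CARD('d) - 2) * exp (- (c0 * sqrt \<epsilon>) * sup_norm ?w)
        \<le> C0 / (real r / 2 * sup_norm u) ^ (CARD('d) - 2) * exp (- a * sup_norm u)"
      using C0 rw by (intro mult_mono) auto
    also have "\<dots> = C0 * (2 / real r) ^ (CARD('d) - 2) * (exp (- a * sup_norm u) / sup_norm u ^ (CARD('d) - 2))"
      by (simp add: power_mult_distrib power_divide)
    finally show ?thesis
      using f_upper[of ?w] by linarith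
  qed
  have "(\<Sum>v\<in>F. f (z + v)) \<le> (\<Sum>v\<in>{0} \<union> latt_scale ?L ` U. f (z + v))"
    using sub finU f_nonneg by (intro sum_mono2) auto
  also have "\<dots> = f z + (\<Sum>u\<in>U. f (z + latt_scale ?L u))"
  proof -
    have "0 \<notin> latt_scale ?L ` U"
      using inj latt_scale_0[of ?L] by (auto simp: U_def inj_def)
    then show ?thesis
      using finU inj by (simp add: sum.reindex inj_on_subset)
  qed
  also have "(\<Sum>u\<in>U. f (z + latt_scale ?L u))
      \<le> C0 * (2 / real r) ^ (CARD('d) - 2) * (\<Sum>u\<in>U. exp (- a * sup_norm u) / sup_norm u ^ (CARD('d) - 2))"
    unfolding sum_distrib_left by (intro sum_mono f_le)
  also have "\<dots> \<le> C0 * (2 / real r) ^ (CARD('d) - 2) * (K / a\<^sup>2)"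
    unfolding K_def using dim a(1) finU C0
    by (intro mult_left_mono sum_decay) (auto simp: U_def)
  also have "\<dots> = Cb / \<epsilon> / real r ^ CARD('d)"
  proof -
    have p: "x ^ CARD('d) = x ^ (CARD('d) - 2) * x\<^sup>2" for x :: real
      by (rule power_split)
    show ?thesis
      unfolding Cb_def a(2) p using r c0 \<epsilon> by (simp add: power_divide field_simps)
  qed
  finally show "(\<Sum>v\<in>F. f (z + v)) \<le> f z + Cb / \<epsilon> / real r ^ CARD('d)" by simp
qed

theorem torus_upper:
  assumes "3 \<le> r" "x \<in> box_vertices r"
  shows "tau_torus r \<beta> 0 x \<le> f x + Cb / cX * (X / real r ^ CARD('d))"
proof -
  have "tau_torus r \<beta> 0 x \<le> periodise (\<lambda>_. r) f x"
    unfolding tau_torus_eq[OF assms] by (rule torus_sequence.torus_corr_le_periodise[OF torus_sequence[OF assms(1)]])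
  also have "\<dots> \<le> f x + Cb / \<epsilon> / real r ^ CARD('d)"
    by (rule periodise_upper[OF assms])
  also have "Cb / \<epsilon> / real r ^ CARD('d) \<le> Cb / cX * (X / real r ^ CARD('d))"
  proof -
    have "Cb / cX * (cX / \<epsilon>) \<le> Cb / cX * X"
      using constants_pos by (intro mult_left_mono X_lower) auto
    then have "Cb / \<epsilon> \<le> Cb / cX * X"
      using constants_pos by simp
    then show ?thesis
      using divide_right_mono[of "Cb / \<epsilon>" "Cb / cX * X" "real r ^ CARD('d)"] by simp
  qed
  finally show ?thesis by simp
qed

end

context subcritical
begin

text \<open>Here \<open>q\<close> is the range of the lower bound on \<open>tau\<close> in units of
  the period. Of order N^d shifts with N comparable to \<open>q\<close> stay in range, each
  contributing at least of order (r N)^(2 - d), in total N^2 r^(2 - d), which is of order 1 /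
  (\<epsilon> r^d).\<close>

lemma periodise_lower:
  assumes r: "3 \<le> r" and x: "x \<in> box_vertices r" and e: "\<epsilon> * (real r)\<^sup>2 \<le> 4 / 9 * c0\<^sup>2"
  shows "f x + ca / \<epsilon> / real r ^ CARD('d) \<le> periodise (\<lambda>_. r) f x"
proof -
  let ?L = "\<lambda>_ :: 'd. r"
  define q where "q = c0 / sqrt \<epsilon> / real r"
  have q2: "q\<^sup>2 = c0\<^sup>2 / \<epsilon> / (real r)\<^sup>2"
    using \<epsilon> by (simp add: q_def power_divide power_mult_distrib)
  have q0: "0 < q"
    using \<epsilon> c0 r by (simp add: q_def)
  (* The constant 4/9 in e is what makes N positive, so that there is a nonzero lattice point
     within the range of the lower bound for tau. *)
  have "(3 / 2)\<^sup>2 \<le> q\<^sup>2"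
    using e \<epsilon> r unfolding q2 divide_divide_eq_left by (subst pos_le_divide_eq) (auto simp: power_divide)
  then have q: "3 / 2 \<le> q"
    using q0 by (intro power2_le_imp_le[of "3 / 2" q]) auto
  \<comment> \<open>The 1 / 2 makes room for \<open>x\<close> itself, whose norm is at most r /
    2.\<close>
  define N where "N = nat \<lfloor>q - 1 / 2\<rfloor>"
  have "1 \<le> \<lfloor>q - 1 / 2\<rfloor>"
    using q by simp
  then have N1: "1 \<le> real N" and "real N = of_int \<lfloor>q - 1 / 2\<rfloor>"
    unfolding N_def by simp_all
  then have N2: "real N \<le> q - 1 / 2" "q - 1 / 2 < real N + 1"
    by (simp_all only: of_int_floor_le floor_less_iff[symmetric]) linarith+
  \<comment> \<open>For \<open>q\<close> up to 5 / 2 this follows from \<open>1 \<le> N\<close>,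
    beyond that from \<open>q - 3 / 2 < N\<close>; the two bounds meet at 5 / 2.\<close>
  have N3: "2 / 5 * q \<le> real N"
    using N1 N2 by linarith
  have r0: "0 < real r"
    using r by simp
  define U where "U = (box_vertices (2 * N) :: (int ^ 'd) set)"
  have finU: "finite U"
    unfolding U_def by (rule finite_box)
  have U0: "0 \<in> U"
    using N1 by (simp add: U_def box_iff)
  have inj: "inj (latt_scale ?L)"
    using r by (auto simp: inj_def latt_scale_def vec_eq_iff)
  have each: "c0 / (2 * (real r * real N)) ^ (CARD('d) - 2) \<le> f (x + latt_scale ?L u)" if "u \<in> U" for u
  proof -
    let ?w = "x + latt_scale ?L u"
    have u: "sup_norm u \<le> real N"
      using sup_norm_box[of u "2 * N"] that by (simp add: U_def)
    have "sup_norm ?w \<le> sup_norm x + real r * sup_norm u"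
      using sup_norm_triangle[of x "latt_scale ?L u"] by (simp add: sup_norm_scale)
    also have "\<dots> \<le> real r / 2 + real r * real N"
      using sup_norm_box[OF x] mult_left_mono[OF u, of "real r"] by simp
    finally have w: "sup_norm ?w \<le> real r / 2 + real r * real N" .
    have "real r * (1 / 2 + real N) \<le> real r * q"
      using N2 by (intro mult_left_mono) auto
    then have "real r / 2 + real r * real N \<le> c0 / sqrt \<epsilon>"
      using r0 by (simp add: q_def algebra_simps)
    then have fw: "c0 / max 1 (sup_norm ?w) ^ (CARD('d) - 2) \<le> f ?w"
      using w by (intro f_lower) simp
    have rN: "real r * 1 \<le> real r * real N"
      using N1 by (intro mult_left_mono) auto
    then have "max 1 (sup_norm ?w) \<le> 2 * (real r * real N)"
      using w N1 r by (intro max.boundedI) linarith+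
    then have "c0 / (2 * (real r * real N)) ^ (CARD('d) - 2) \<le> c0 / max 1 (sup_norm ?w) ^ (CARD('d) - 2)"
      using c0 by (intro divide_left_mono power_mono mult_pos_pos zero_less_power) (use r N1 in auto)
    then show ?thesis
      using fw by linarith
  qed
  have "ca / \<epsilon> / real r ^ CARD('d) = (2 / 5 * q)\<^sup>2 * (c0 / (2 * real r) ^ (CARD('d) - 2))"
  proof -
    have "4 * c0 ^ 3 / (25 * A) / \<epsilon> / (R * (real r)\<^sup>2) = (2 / 5)\<^sup>2 * (c0\<^sup>2 / \<epsilon> / (real r)\<^sup>2) * (c0 / (A * R))" for A R
      by (simp add: power3_eq_cube power2_eq_square mult_ac)
    then show ?thesis
      unfolding ca_def power_split[of "real r"] power_mult_distrib q2 by (simp only:)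
  qed
  also have "\<dots> \<le> (real N)\<^sup>2 * (c0 / (2 * real r) ^ (CARD('d) - 2))"
    using N3 q0 c0 by (intro mult_right_mono power_mono) auto
  also have "\<dots> = real N ^ CARD('d) * (c0 / (2 * (real r * real N)) ^ (CARD('d) - 2))"
  proof -
    have "x * (c0 / A) = M * x * (c0 / (A * M))" if "0 < M" for A M x
      using that by simp
    from this[of "real N ^ (CARD('d) - 2)"] show ?thesis
      unfolding power_split[of "real N"] mult.assoc[of 2, symmetric] power_mult_distrib[of _ "real N"] using N1 by simp
  qed
  \<comment> \<open>The shift 0 is reserved for the term \<open>f x\<close>; (2N)^d - 1 is still at
    least N^d.\<close>
  also have "\<dots> \<le> real (card (U - {0})) * (c0 / (2 * (real r * real N)) ^ (CARD('d) - 2))"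
  proof (intro mult_right_mono)
    have "2 * real N ^ CARD('d) \<le> 2 ^ CARD('d) * real N ^ CARD('d)"
      using power_increasing[of 1 "CARD('d)" "2::real"] dim by (intro mult_right_mono) auto
    moreover have "1 \<le> real N ^ CARD('d)"
      using N1 by (rule one_le_power)
    moreover have "real (card (U - {0})) = real (card U) - 1"
      using card.remove[OF finU U0] by linarith
    ultimately show "real N ^ CARD('d) \<le> real (card (U - {0}))"
      by (simp add: U_def card_box power_mult_distrib)
  qed (use c0 in auto)
  also have "\<dots> = (\<Sum>u\<in>U - {0}. c0 / (2 * (real r * real N)) ^ (CARD('d) - 2))"
    by simp
  also have "\<dots> \<le> (\<Sum>u\<in>U - {0}. f (x + latt_scale ?L u))"
    using each by (intro sum_mono) auto
  finally have "f x + ca / \<epsilon> / real r ^ CARD('d) \<le> f (x + latt_scale ?L 0) + (\<Sum>u\<in>U - {0}. f (x + latt_scale ?L u))"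
    by (simp add: latt_scale_0)
  also have "\<dots> = (\<Sum>u\<in>U. f (x + latt_scale ?L u))"
    using finU U0 by (rule sum.remove[symmetric])
  also have "\<dots> = (\<Sum>v\<in>latt_scale ?L ` U. f (x + v))"
    using inj by (simp add: sum.reindex inj_on_subset)
  also have "\<dots> \<le> periodise ?L f x"
    using finU latt_scale_latt by (intro sum_le_periodise f_summable f_nonneg) auto
  finally show ?thesis .
qed

text \<open>Each periodisation is at most \<open>f\<close> plus a plateau b of order 1 / (\<epsilon>
  r^d). The mixed terms give b times the susceptibility and the square gives r^d b^2, both of order
  1 / (\<epsilon>^2 r^d). The map \<open>\<sigma>\<close> is used as the identity for the point 0
  and as y |-> x - y brought back to the box for a general point.\<close>

lemma convolution_le:
  assumes r: "3 \<le> r" and inj: "inj_on \<sigma> (box_vertices r)" and sub: "\<sigma> ` box_vertices r \<subseteq> box_vertices r"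
    and eq: "\<And>y. y \<in> box_vertices r \<Longrightarrow> periodise (\<lambda>_. r) f (x - y) = periodise (\<lambda>_. r) f (\<sigma> y)"
  shows "torus_sequence.B (\<lambda>_. r) \<beta> x
    \<le> (\<Sum>y\<in>box_vertices r. f y * f (\<sigma> y)) + (2 * Cb * CX + Cb\<^sup>2) / (\<epsilon>\<^sup>2 * real r ^ CARD('d))"
proof -
  let ?L = "\<lambda>_ :: 'd. r" and ?P = "periodise (\<lambda>_ :: 'd. r) f" and ?Y = "box_vertices r :: (int ^ 'd) set"
  interpret T: torus_sequence ?L \<beta>
    by (rule torus_sequence[OF r])
  define b where "b = Cb / \<epsilon> / real r ^ CARD('d)"
  have b0: "0 \<le> b"
    using constants_pos \<epsilon> by (simp add: b_def)
  have Y: "finite ?Y"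
    by (rule finite_box)
  have red: "?P (red ?L y) = ?P y" "?P (x - red ?L y) = ?P (x - y)" for y
    using red_diff_latt[of ?L y] latt_uminus_iff[of "red ?L y - y" ?L]
    by (auto intro!: periodise_cong simp del: latt_uminus_iff)
  have "bij_betw (red ?L) ?Y (cell ?L)"
    using r by (intro red_box_cell) simp
  then have "T.B x = (\<Sum>y\<in>?Y. ?P (red ?L y) * ?P (x - red ?L y))"
    unfolding T.B_def by (rule sum.reindex_bij_betw[symmetric])
  also have "\<dots> = (\<Sum>y\<in>?Y. ?P y * ?P (\<sigma> y))"
    unfolding red by (intro sum.cong refl) (simp add: eq)
  also have "\<dots> \<le> (\<Sum>y\<in>?Y. (f y + b) * (f (\<sigma> y) + b))"
    using periodise_upper[OF r] sub b0 f_nonneg unfolding b_def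
    by (intro sum_mono mult_mono periodise_nonneg add_nonneg_nonneg) auto
  also have "\<dots> = (\<Sum>y\<in>?Y. f y * f (\<sigma> y)) + b * ((\<Sum>y\<in>?Y. f y) + (\<Sum>y\<in>?Y. f (\<sigma> y))) + real r ^ CARD('d) * b\<^sup>2"
  proof -
    have "(f y + b) * (f (\<sigma> y) + b) = f y * f (\<sigma> y) + b * (f y + f (\<sigma> y)) + b\<^sup>2" for y
      by (simp add: algebra_simps power2_eq_square)
    then show ?thesis
      by (simp add: sum.distrib sum_distrib_left[symmetric] card_box)
  qed
  also have "(\<Sum>y\<in>?Y. f (\<sigma> y)) = sum f (\<sigma> ` ?Y)"
    using inj by (simp add: sum.reindex)
  also have "b * (sum f ?Y + sum f (\<sigma> ` ?Y)) \<le> b * (CX / \<epsilon> + CX / \<epsilon>)"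
    using Y b0 by (intro mult_left_mono add_mono order_trans[OF sum_le_X X_upper]) auto
  also have "b * (CX / \<epsilon> + CX / \<epsilon>) = 2 * Cb * CX / (\<epsilon>\<^sup>2 * real r ^ CARD('d))"
    by (simp add: b_def power2_eq_square mult_ac)
  also have "real r ^ CARD('d) * b\<^sup>2 = Cb\<^sup>2 / (\<epsilon>\<^sup>2 * real r ^ CARD('d))"
    using r by (simp add: b_def power_divide power2_eq_square)
  finally show ?thesis
    by (simp add: add_divide_distrib)
qed

text \<open>The gain of the periodisation over \<open>f x\<close> is at least ca / R with R =
  \<epsilon> r^d, and its excess at 0 is at most Cb / R. If \<open>B x\<close> is at most ca / (4
  Cb), the defect consumes no more than half of the gain; half of this bound is supplied by the
  window and half by the tail of the convolution.\<close>

theorem torus_lower: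
  assumes r: "3 \<le> r" and x: "x \<in> box_vertices r" and e: "\<epsilon> * (real r)\<^sup>2 \<le> 4 / 9 * c0\<^sup>2"
    and window: "(2 * Cb * CX + Cb\<^sup>2) / (\<epsilon>\<^sup>2 * real r ^ CARD('d)) \<le> min (1 / 2) (ca / (8 * Cb))"
    and m: "\<forall>(Y :: (int ^ 'd) set) \<sigma>. finite Y \<longrightarrow> inj_on \<sigma> Y \<longrightarrow> (\<forall>y\<in>Y. real m \<le> sup_norm y \<or> real m \<le> sup_norm (\<sigma> y)) \<longrightarrow>
      (\<Sum>y\<in>Y. 1 / max 1 (sup_norm y) ^ (CARD('d) - 2) * (1 / max 1 (sup_norm (\<sigma> y :: int ^ 'd)) ^ (CARD('d) - 2)))
        \<le> ca / (8 * Cb * C0\<^sup>2)"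
    and far: "2 * real m \<le> sup_norm x"
  shows "f x + ca / (2 * CX) * (X / real r ^ CARD('d)) \<le> tau_torus r \<beta> 0 x"
proof -
  let ?L = "\<lambda>_ :: 'd. r" and ?P = "periodise (\<lambda>_ :: 'd. r) f" and ?Y = "box_vertices r :: (int ^ 'd) set"
  interpret T: torus_sequence ?L \<beta>
    by (rule torus_sequence[OF r])
  have r0: "0 < r"
    using r by simp
  have Y: "finite ?Y"
    by (rule finite_box)
  have "T.B 0 \<le> (\<Sum>y\<in>?Y. f y * f y) + (2 * Cb * CX + Cb\<^sup>2) / (\<epsilon>\<^sup>2 * real r ^ CARD('d))"
    by (rule convolution_le[OF r, of "\<lambda>y. y"]) (auto simp: inj_on_def intro!: periodise_uminus T.f_uminus)
  \<comment> \<open>With the identity as the map, the main term is exactly the sum of squares that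
    is subtracted here.\<close>
  then have half: "T.B 0 - (\<Sum>y\<in>?Y. f y * f y) \<le> 1 / 2"
    using window unfolding min.bounded_iff by linarith
  have Bx: "T.B x \<le> ca / (4 * Cb)"
  proof -
    define \<sigma> where "\<sigma> y = box_rep r (x - y)" for y
    have \<sigma>: "\<sigma> y \<in> ?Y" "x - y - \<sigma> y \<in> latt ?L" for y
      unfolding \<sigma>_def by (rule box_rep_box_latt[OF r0])+
    have inj: "inj_on \<sigma> ?Y"
    proof (rule inj_onI)
      fix y y' assume y: "y \<in> ?Y" "y' \<in> ?Y" "\<sigma> y = \<sigma> y'"
      then have "y - y' \<in> latt ?L"
        using latt_diff[OF \<sigma>(2)[of y'] \<sigma>(2)[of y]] by simp
      then show "y = y'"
        using y by (intro box_latt_eq[of r ?L]) auto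
    qed
    have "T.B x \<le> (\<Sum>y\<in>?Y. f y * f (\<sigma> y)) + (2 * Cb * CX + Cb\<^sup>2) / (\<epsilon>\<^sup>2 * real r ^ CARD('d))"
      using \<sigma> by (intro convolution_le[OF r inj] periodise_cong) auto
    also have "(\<Sum>y\<in>?Y. f y * f (\<sigma> y)) \<le> (\<Sum>y\<in>?Y. C0\<^sup>2 * (1 / max 1 (sup_norm y) ^ (CARD('d) - 2) * (1 / max 1 (sup_norm (\<sigma> y)) ^ (CARD('d) - 2))))"
    proof (rule sum_mono)
      fix y
      have "f y * f (\<sigma> y) \<le> C0 * (1 / max 1 (sup_norm y) ^ (CARD('d) - 2)) * (C0 * (1 / max 1 (sup_norm (\<sigma> y)) ^ (CARD('d) - 2)))"
        using C0 by (intro mult_mono f_le_h f_nonneg) auto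
      then show "f y * f (\<sigma> y) \<le> C0\<^sup>2 * (1 / max 1 (sup_norm y) ^ (CARD('d) - 2) * (1 / max 1 (sup_norm (\<sigma> y)) ^ (CARD('d) - 2)))"
        by (simp add: power2_eq_square)
    qed
    also have "\<dots> \<le> C0\<^sup>2 * (ca / (8 * Cb * C0\<^sup>2))"
    proof -
      \<comment> \<open>\<open>y + \<sigma> y\<close> is congruent to \<open>x\<close>, hence its
        norm is at least that of the box representative \<open>x\<close>, and one of the summands
        has at least half of it.\<close>
      have "real m \<le> sup_norm y \<or> real m \<le> sup_norm (\<sigma> y)" for y
      proof -
        have "(y + \<sigma> y) - x \<in> latt ?L"
          using \<sigma>(2)[of y] latt_uminus_iff[of "x - y - \<sigma> y" ?L] by (simp add: algebra_simps del: latt_uminus_iff)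
        then have "sup_norm x \<le> sup_norm (y + \<sigma> y)"
          by (rule sup_norm_box_minimal[OF x])
        then show ?thesis
          using far sup_norm_triangle[of y "\<sigma> y"] by linarith
      qed
      then have "(\<Sum>y\<in>?Y. 1 / max 1 (sup_norm y) ^ (CARD('d) - 2) * (1 / max 1 (sup_norm (\<sigma> y)) ^ (CARD('d) - 2))) \<le> ca / (8 * Cb * C0\<^sup>2)"
        using m[rule_format, OF Y inj] by simp
      then show ?thesis
        unfolding sum_distrib_left[symmetric] by (intro mult_left_mono) auto
    qed
    also have "C0\<^sup>2 * (ca / (8 * Cb * C0\<^sup>2)) = ca / (8 * Cb)"
      using C0 by simp
    finally show ?thesis
      using window by simp
  qed
  define R where "R = \<epsilon> * real r ^ CARD('d)"
  have R: "0 < R"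
    using \<epsilon> r by (simp add: R_def)
  have tt: "tau_torus r \<beta> 0 x = torus_corr ?L \<beta> x"
    by (rule tau_torus_eq[OF r x])
  have "?P x \<le> torus_corr ?L \<beta> x + 2 * T.B x * (?P 0 - 1)"
    by (rule T.periodise_le_torus_corr[OF Y inj_on_red_box half]) simp
  moreover have "f x + ca / R \<le> ?P x"
    using periodise_lower[OF r x e] by (simp add: R_def)
  moreover have "2 * T.B x * (?P 0 - 1) \<le> ca / R / 2"
  proof -
    have "2 * T.B x * (?P 0 - 1) \<le> 2 * (ca / (4 * Cb)) * (Cb / R)"
    proof (intro mult_mono mult_left_mono Bx)
    have "0 \<in> ?Y"
      using r by (simp add: box_iff)
    then show "?P 0 - 1 \<le> Cb / R"
      using periodise_upper[OF r, of 0] by (simp add: R_def f_0)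
    show "0 \<le> ?P 0 - 1"
      using le_periodise[OF f_summable f_nonneg, of 0 ?L] by (simp add: f_0)
  qed (use constants_pos T.B_nonneg in auto)
    also have "\<dots> = ca / R / 2"
      using constants_pos by simp
    finally show ?thesis .
  qed
  moreover have "ca / (2 * CX) * (X / real r ^ CARD('d)) \<le> ca / R / 2"
  proof -
    have CX: "0 < CX"
      using constants_pos C0 c0 \<beta> by (simp add: CX_def add_pos_pos)
    have "ca / (2 * CX) * (X / real r ^ CARD('d)) \<le> ca / (2 * CX) * (CX / \<epsilon> / real r ^ CARD('d))"
      using CX constants_pos X_upper by (intro mult_left_mono divide_right_mono) auto
    also have "\<dots> = ca / R / 2"
      using CX by (simp add: R_def)
    finally show ?thesis .
  qed
  ultimately show ?thesis
    unfolding tt by linarith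
qed

end


section \<open>Choice of the constants\<close>

context near_critical
begin

theorem upper_constant:
  "\<exists>c1>0. \<forall>r \<beta>. \<forall>x :: int ^ 'd. 3 \<le> r \<longrightarrow> 0 < \<beta> \<longrightarrow> \<beta> < \<beta>c \<longrightarrow> x \<in> box_vertices r \<longrightarrow>
    ereal (tau_torus r \<beta> 0 x) \<le> ereal (tau \<beta> 0 x) + ereal c1 * (chi TYPE('d) \<beta> / ereal (real r ^ CARD('d)))"
proof (intro exI[of _ "Cb / cX"] conjI allI impI)
  show "0 < Cb / cX"
    using constants_pos by simp
  fix r \<beta> and x :: "int ^ 'd"
  assume A: "3 \<le> r" "0 < \<beta>" "\<beta> < \<beta>c" "x \<in> box_vertices r"
  then interpret S: subcritical \<beta>c c0 C0 d \<beta>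
    by unfold_locales auto
  show "ereal (tau_torus r \<beta> 0 x) \<le> ereal (tau \<beta> 0 x) + ereal (Cb / cX) * (chi TYPE('d) \<beta> / ereal (real r ^ CARD('d)))"
    using S.torus_upper[OF A(1,4)] A(1) by (simp add: S.chi_X)
qed

theorem lower_constants:
  "\<exists>c2>0. \<exists>c4>0. \<exists>c5>0. \<forall>r \<beta>. \<forall>x :: int ^ 'd. 3 \<le> r \<longrightarrow> 0 < \<beta> \<longrightarrow>
    \<beta> \<in> {\<beta>c - 4 / 9 * c0\<^sup>2 * real r powr (-2) .. \<beta>c - c4 * real r powr (- real CARD('d) / 2)} \<longrightarrow>
    x \<in> box_vertices r \<longrightarrow> c5 \<le> sup_norm x \<longrightarrow>
    ereal (tau \<beta> 0 x) + ereal c2 * (chi TYPE('d) \<beta> / ereal (real r ^ CARD('d))) \<le> ereal (tau_torus r \<beta> 0 x)"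
proof (cases "0 < \<beta>c")
  case True
  have CX: "0 < CX"
    using True constants_pos C0 c0 by (simp add: CX_def add_pos_pos)
  have "0 < ca / (8 * Cb * C0\<^sup>2)"
    using constants_pos C0 by simp
  from convolution_tail[OF dim this] obtain m :: nat where m:
    "\<forall>(Y :: (int ^ 'd) set) \<sigma>. finite Y \<longrightarrow> inj_on \<sigma> Y \<longrightarrow> (\<forall>y\<in>Y. real m \<le> sup_norm y \<or> real m \<le> sup_norm (\<sigma> y)) \<longrightarrow>
      (\<Sum>y\<in>Y. 1 / max 1 (sup_norm y) ^ (CARD('d) - 2) * (1 / max 1 (sup_norm (\<sigma> y :: int ^ 'd)) ^ (CARD('d) - 2)))
        \<le> ca / (8 * Cb * C0\<^sup>2)"
    by blast
  \<comment> \<open>With \<open>c4 = sqrt (D / \<kappa>)\<close> the window says that \<epsilon>^2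
    r^d is at least \<open>D / \<kappa>\<close>, which is the smallness required in
    \<open>torus_lower\<close>. The 1 added in \<open>2 * real m + 1\<close> keeps \<open>c5\<close>
    positive.\<close>
  define D where "D = 2 * Cb * CX + Cb\<^sup>2"
  define \<kappa> where "\<kappa> = min (1 / 2) (ca / (8 * Cb))"
  have D: "0 < D"
    using CX constants_pos by (simp add: D_def add_pos_pos)
  have \<kappa>: "0 < \<kappa>"
    using constants_pos by (simp add: \<kappa>_def)
  show ?thesis
  proof (rule exI[of _ "ca / (2 * CX)"], rule conjI[rotated], rule exI[of _ "sqrt (D / \<kappa>)"], rule conjI[rotated],
      rule exI[of _ "2 * real m + 1"], rule conjI[rotated], intro allI impI)
    fix r \<beta> and x :: "int ^ 'd"
    assume r: "3 \<le> r" and \<beta>: "0 < \<beta>"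
      and win: "\<beta> \<in> {\<beta>c - 4 / 9 * c0\<^sup>2 * real r powr (-2) .. \<beta>c - sqrt (D / \<kappa>) * real r powr (- real CARD('d) / 2)}"
      and x: "x \<in> box_vertices r" and far: "2 * real m + 1 \<le> sup_norm x"
    have r0: "0 < real r"
      using r by simp
    define s where "s = real r powr (- real CARD('d) / 2)"
    have s: "0 < s" "s\<^sup>2 * real r ^ CARD('d) = 1"
    proof -
      show "0 < s"
        using r0 by (simp add: s_def)
      have "s\<^sup>2 = real r powr (- real CARD('d))"
        by (simp add: s_def power2_eq_square powr_add[symmetric])
      then show "s\<^sup>2 * real r ^ CARD('d) = 1"
        using r0 by (simp add: powr_minus powr_realpow)
    qed
    have gap: "sqrt (D / \<kappa>) * s \<le> \<beta>c - \<beta>" "\<beta>c - \<beta> \<le> 4 / 9 * c0\<^sup>2 * real r powr (-2)"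
      using win by (simp_all add: s_def)
    moreover have "0 < sqrt (D / \<kappa>) * s"
      using D \<kappa> s by simp
    ultimately interpret S: subcritical \<beta>c c0 C0 d \<beta>
      using \<beta> by unfold_locales auto
    have "S.\<epsilon> * (real r)\<^sup>2 \<le> 4 / 9 * c0\<^sup>2 * real r powr (-2) * (real r)\<^sup>2"
      using gap(2) by (intro mult_right_mono) (auto simp: S.\<epsilon>_def)
    moreover have "real r powr (-2) * (real r)\<^sup>2 = 1"
      using r0 by (simp add: powr_minus)
    ultimately have e: "S.\<epsilon> * (real r)\<^sup>2 \<le> 4 / 9 * c0\<^sup>2"
      by (simp only: mult.assoc mult_1_right)
    have "D / \<kappa> * s\<^sup>2 = (sqrt (D / \<kappa>) * s)\<^sup>2"
      using D \<kappa> by (simp add: power_mult_distrib)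
    also have "\<dots> \<le> S.\<epsilon>\<^sup>2"
      using gap(1) D \<kappa> s by (intro power_mono) (auto simp: S.\<epsilon>_def)
    finally have "D / \<kappa> * s\<^sup>2 * real r ^ CARD('d) \<le> S.\<epsilon>\<^sup>2 * real r ^ CARD('d)"
      by (rule mult_right_mono) simp
    then have "D / \<kappa> \<le> S.\<epsilon>\<^sup>2 * real r ^ CARD('d)"
      using s(2) by (simp add: mult.assoc)
    then have "D / (S.\<epsilon>\<^sup>2 * real r ^ CARD('d)) \<le> \<kappa>"
      using \<kappa> S.\<epsilon> r0 by (simp add: field_simps)
    then have "(2 * Cb * CX + Cb\<^sup>2) / (S.\<epsilon>\<^sup>2 * real r ^ CARD('d)) \<le> min (1 / 2) (ca / (8 * Cb))"
      by (simp only: D_def \<kappa>_def)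
    from S.torus_lower[OF r x e this m] far
    show "ereal (tau \<beta> 0 x) + ereal (ca / (2 * CX)) * (chi TYPE('d) \<beta> / ereal (real r ^ CARD('d))) \<le> ereal (tau_torus r \<beta> 0 x)"
      using r by (simp add: S.chi_X)
  qed (use CX constants_pos D \<kappa> in auto)
next
  \<comment> \<open>For nonpositive \<open>\<beta>c\<close> the window contains no positive
    \<open>\<beta>\<close>, so any positive constants will do.\<close>
  case False
  have "False" if "0 < \<beta>" "\<beta> \<in> {a .. \<beta>c - 1 * real r powr (- real CARD('d) / 2)}" for a \<beta> and r :: nat
    using False that powr_ge_zero[of "real r" "- real CARD('d) / 2"] unfolding atLeastAtMost_iff by linarith
  then show ?thesis
    by (intro exI[of _ 1] conjI allI impI zero_less_one) (rule FalseE, blast)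
qed

end

theorem theorem1p1:
  fixes c\<^sub>0 C\<^sub>0 :: real
  assumes dim: "CARD('d::finite) > 4"
    and pos: "c\<^sub>0 > 0" "C\<^sub>0 > 0"
    and upper: "\<And>\<beta> (x :: int ^ 'd). 0 < \<beta> \<Longrightarrow> \<beta> \<le> beta_c TYPE('d) \<Longrightarrow>
      tau \<beta> 0 x \<le> C\<^sub>0 / max 1 (sup_norm x) ^ (CARD('d) - 2)
                     * exp (- c\<^sub>0 * (beta_c TYPE('d) - \<beta>) powr (1/2) * sup_norm x)"
    and lower: "\<And>\<beta> (x :: int ^ 'd). 0 < \<beta> \<Longrightarrow> \<beta> \<le> beta_c TYPE('d) \<Longrightarrow>
      \<beta> = beta_c TYPE('d) \<or> sup_norm x \<le> c\<^sub>0 * (beta_c TYPE('d) - \<beta>) powr (-1/2) \<Longrightarrow>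
      tau \<beta> 0 x \<ge> c\<^sub>0 / max 1 (sup_norm x) ^ (CARD('d) - 2)"
  shows "\<exists>c\<^sub>1 c\<^sub>2 c\<^sub>3 c\<^sub>4 c\<^sub>5 :: real. c\<^sub>1 > 0 \<and> c\<^sub>2 > 0 \<and> c\<^sub>3 > 0 \<and> c\<^sub>4 > 0 \<and> c\<^sub>5 > 0 \<and>
    c\<^sub>3 = 4/9 * c\<^sub>0\<^sup>2 \<and>
    (\<forall>r::nat. \<forall>\<beta>. \<forall>x :: int ^ 'd.
       r \<ge> 3 \<longrightarrow> 0 < \<beta> \<longrightarrow> \<beta> < beta_c TYPE('d) \<longrightarrow> x \<in> box_vertices r \<longrightarrow>
       ereal (tau_torus r \<beta> 0 x)
         \<le> ereal (tau \<beta> 0 x) + ereal c\<^sub>1 * (chi TYPE('d) \<beta> / ereal (real r ^ CARD('d)))) \<and>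
    (\<forall>r::nat. \<forall>\<beta>. \<forall>x :: int ^ 'd.
       r \<ge> 3 \<longrightarrow> 0 < \<beta> \<longrightarrow>
       \<beta> \<in> {beta_c TYPE('d) - c\<^sub>3 * real r powr (-2) ..
             beta_c TYPE('d) - c\<^sub>4 * real r powr (- real CARD('d) / 2)} \<longrightarrow>
       x \<in> box_vertices r \<longrightarrow> sup_norm x \<ge> c\<^sub>5 \<longrightarrow>
       ereal (tau_torus r \<beta> 0 x)
         \<ge> ereal (tau \<beta> 0 x) + ereal c\<^sub>2 * (chi TYPE('d) \<beta> / ereal (real r ^ CARD('d))))"
proof -
  interpret near_critical "beta_c TYPE('d)" c\<^sub>0 C\<^sub>0 "TYPE('d)"
    using dim pos upper lower by unfold_locales auto
  have "0 < 4 / 9 * c\<^sub>0\<^sup>2"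
    using pos by simp
  with upper_constant lower_constants show ?thesis
    by (elim exE conjE) (intro exI conjI, assumption+, rule refl, assumption+)
qed

end
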